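(* Let $\mathcal G$ be a finite connected groupoid, $x\in\mathcal G_0$, $\tau(x)=\{\tau_y\}_{y\in\mathcal G_0}$ a transversal for $x$, $A$ a ring, and $\beta=(B_g,\beta_g)_{g\in\mathcal G}$ the lifted partial action of $\mathcal G$ on $A$ coming from a datum $(I,\gamma_{\tau(x)},\gamma_{(x)})\in\mathcal D_{\tau(x)}(A)$. Assume that $\beta$ is $\tau(x)$-global and $\gamma$-unital, and that $A=\bigoplus_{y\in\mathcal G_0}I_y=\bigoplus_{y\in\mathcal G_0}B_y$. If $A$ is a finitely generated projective left $A^\beta$-module and $B_x$ is a finitely generated projective left $B_x^{\beta_{(x)}}$-module, then the following statements are equivalent: (i) The Morita context $(A^\beta,\ A\star_\beta\mathcal G,\ A,\ A,\ \Gamma,\ \Gamma')$ is strict. (ii) The Morita context $(B_x^{\beta_{(x)}},\ B_x\star_{\beta_{(x)}}\mathcal G(x),\ B_x,\ B_x,\ \Gamma_x,\ \Gamma'_x)$ is strict.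
   Context: Conventions. Rings are associative, not necessarily unital; ideals are two-sided. A groupoid $\mathcal G$ is a small category in which every morphism is invertible; it is identified with its set of morphisms, and its set of objects $\mathcal G_0$ is identified with the set of identity morphisms. For $g\in\mathcal G$, $s(g)=g^{-1}g$ and $t(g)=gg^{-1}$; $gh$ is defined iff $s(g)=t(h)$. Put $\mathcal G(y,z)=\{g: s(g)=y,\ t(g)=z\}$ and $\mathcal G(x)=\mathcal G(x,x)$ (a group). $\mathcal G$ is connected if $\mathcal G(y,z)\neq\emptyset$ for all $y,z\in\mathcal G_0$. A transversal for $x$ is a family $\tau(x)=\{\tau_y: y\in\mathcal G_0\}$ with $\tau_y\in\mathcal G(x,y)$ and $\tau_x=x$. Put $g_x=\tau_{t(g)}^{-1}g\tau_{s(g)}\in\mathcal G(x)$. For partial bijections, $u\circ v$ has domain $v^{-1}(\mathrm{dom}(u)\cap\mathrm{ran}(v))$ and range $u(\mathrm{dom}(u)\cap\mathrm{ran}(v))$. A partial action of a groupoid $\mathcal G$ on a ring $A$ is a family $\alpha=(A_g,\alpha_g)_{g\in\mathcal G}$ where, for each $g$, $A_{t(g)}$ is an ideal of $A$, $A_g$ is an ideal of $A_{t(g)}$, $\alpha_g:A_{g^{-1}}\to A_g$ is a ring isomorphism, $\alpha_y=\mathrm{id}_{A_y}$ for $y\in\mathcal G_0$, and $\alpha_{gh}$ extends $\alpha_g\circ\alpha_h$ whenever $s(g)=t(h)$. A partial action of a group $H$ on a ring $R$ is the one-object case with the ideal attached to the identity equal to $R$; it is unital if each of its ideals is a unital ring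 whose identity is a central idempotent of $R$. The partial action $\alpha$ is $\tau(x)$-global if $A_{\tau_y^{-1}}=A_x$ and $A_{\tau_y}=A_y$ for all $y\in\mathcal G_0$. An object of $\mathcal D_{\tau(x)}(A)$ is a datum $(I,\gamma_{\tau(x)},\gamma_{(x)})$ consisting of: (a) a family $I=\{I_y\}_{y\in\mathcal G_0}$ of ideals of $A$; (b) ring isomorphisms $\gamma_{\tau(x)}=\{\gamma_{\tau_y}:I_{\tau_y^{-1}}\to I_{\tau_y}\}_{y\in\mathcal G_0}$; (c) a partial action $\gamma_{(x)}=(I_h,\gamma_h)_{h\in\mathcal G(x)}$ of the group $\mathcal G(x)$ on $I_x$; such that (d) $\gamma_x=\gamma_{\tau_x}$ is the identity map of $I_x=I_{\tau_x}$; (e) $I_{\tau_y}$ is an ideal of $I_y$ and $I_{\tau_y^{-1}}$ is an ideal of $I_x$ for all $y$; (f) $\gamma_{\tau_{t(g)}}\big(I_{\tau_{t(g)}^{-1}}\cap\gamma_{g_x}(I_{\tau_{s(g)}^{-1}}\cap I_{g_x^{-1}})\big)$ is an ideal of $I_{t(g)}$ for all $g\in\mathcal G$. The lifted partial action coming from it is $\beta=(B_g,\beta_g)_{g\in\mathcal G}$ with $\beta_y=\mathrm{id}_{I_y}$ for $y\in\mathcal G_0$, $\beta_g=\gamma_{\tau_{t(g)}}\circ\gamma_{g_x}\circ\gamma_{\tau_{s(g)}}^{-1}$ for $g\notin\mathcal G_0$ (composition of partial bijections), and $B_g$ the range of $\beta_g$; it is a partial action of $\mathcal G$ on $A$. It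 is called $\gamma$-unital if $I_x$ is a unital ring and $\gamma_{(x)}$ is a unital partial group action. When $\beta$ is $\tau(x)$-global and $\gamma$-unital, $B_g=\gamma_{\tau_{t(g)}}(I_{g_x})=A1_g$ for all $g\in\mathcal G$, where $1_h$ is the identity of $I_h$ for $h\in\mathcal G(x)$ and $1_g=\gamma_{\tau_{t(g)}}(1_{g_x})$ is the identity of $B_g$, a central idempotent of $A$. The restriction $\beta_{(x)}=(B_h,\beta_h)_{h\in\mathcal G(x)}$ is a partial action of $\mathcal G(x)$ on $B_x$; it equals $\gamma_{(x)}$. The partial skew groupoid ring is $A\star_\beta\mathcal G=\bigoplus_{g\in\mathcal G}B_g\delta_g$ ($\delta_g$ placeholder symbols), with multiplication determined by $(a\delta_g)(b\delta_h)=a\beta_g(b1_{g^{-1}})\delta_{gh}$ if $s(g)=t(h)$ and $0$ otherwise ($a\in B_g$, $b\in B_h$); its identity is $\sum_{y\in\mathcal G_0}1_y\delta_y$. Similarly $B_x\star_{\beta_{(x)}}\mathcal G(x)=\bigoplus_{h\in\mathcal G(x)}B_h\delta_h$. $A^\beta=\{a\in A:\beta_g(a1_{g^{-1}})=a1_g\ \forall g\in\mathcal G\}$ and $t_\beta:A\to A^\beta$, $t_\beta(a)=\sum_{g\in\mathcal G}\beta_g(a1_{g^{-1}})$. $A$ is an $(A^\beta,A\star_\beta\mathcal G)$-bimodule and an $(A\star_\beta\mathcal G,A^\beta)$-bimodule: $A^\beta$ acts by multiplication, and $a\delta_g\cdot b=a\beta_g(b1_{g^{-1}})$, $b\cdot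 a\delta_g=\beta_{g^{-1}}(ba)$ for $a\in B_g$, $b\in A$. The bimodule maps are $\Gamma:A\otimes_{A\star_\beta\mathcal G}A\to A^\beta$, $a\otimes b\mapsto t_\beta(ab)$, and $\Gamma':A\otimes_{A^\beta}A\to A\star_\beta\mathcal G$, $a\otimes b\mapsto\sum_{g\in\mathcal G}a\beta_g(b1_{g^{-1}})\delta_g$; $(A^\beta,A\star_\beta\mathcal G,A,A,\Gamma,\Gamma')$ is a Morita context. $B_x^{\beta_{(x)}}$, $t_{\beta_{(x)}}$, $\Gamma_x:B_x\otimes_{B_x\star_{\beta_{(x)}}\mathcal G(x)}B_x\to B_x^{\beta_{(x)}}$ and $\Gamma'_x:B_x\otimes_{B_x^{\beta_{(x)}}}B_x\to B_x\star_{\beta_{(x)}}\mathcal G(x)$ are defined by the same formulas with $(\mathcal G,A,\beta)$ replaced by $(\mathcal G(x),B_x,\beta_{(x)})$, and also give a Morita context. A Morita context $(R,S,U,V,\mu,\nu)$ (unital rings $R,S$, bimodules ${}_RU_S$, ${}_SV_R$, bimodule maps $\mu:U\otimes_SV\to R$, $\nu:V\otimes_RU\to S$ with $u\nu(v\otimes u')=\mu(u\otimes v)u'$ and $v\mu(u\otimes v')=\nu(v\otimes u)v'$) is strict if $\mu$ and $\nu$ are isomorphisms. *)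

theory Defs
  imports "HOL-Algebra.Free_Abelian_Groups" "HOL-Algebra.Generated_Groups"
    "HOL-Algebra.Module" "HOL-Algebra.AbelCoset"
begin

section \<open>Groupoids\<close>

text \<open>
  A category is identified with its set of morphisms, and its objects with the identity morphisms;
  \<open>src g\<close> and \<open>tgt g\<close> are therefore morphisms, and \<open>cmp g h\<close> is meaningful when
  \<open>src g = tgt h\<close>.
\<close>

record 'g category =
  mor :: "'g set"
  src :: "'g \<Rightarrow> 'g"
  tgt :: "'g \<Rightarrow> 'g"
  cmp :: "'g \<Rightarrow> 'g \<Rightarrow> 'g"

definition objs :: "('g, 'z) category_scheme \<Rightarrow> 'g set"
  where "objs G = {y \<in> mor G. src G y = y \<and> tgt G y = y}"

locale small_category =
  fixes G :: "('g, 'z) category_scheme"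
  assumes src_obj: "g \<in> mor G \<Longrightarrow> src G g \<in> objs G"
    and tgt_obj: "g \<in> mor G \<Longrightarrow> tgt G g \<in> objs G"
    and cmp_mor: "\<lbrakk>g \<in> mor G; h \<in> mor G; src G g = tgt G h\<rbrakk> \<Longrightarrow> cmp G g h \<in> mor G"
    and src_cmp: "\<lbrakk>g \<in> mor G; h \<in> mor G; src G g = tgt G h\<rbrakk> \<Longrightarrow> src G (cmp G g h) = src G h"
    and tgt_cmp: "\<lbrakk>g \<in> mor G; h \<in> mor G; src G g = tgt G h\<rbrakk> \<Longrightarrow> tgt G (cmp G g h) = tgt G g"
    and cmp_assoc: "\<lbrakk>g \<in> mor G; h \<in> mor G; k \<in> mor G; src G g = tgt G h; src G h = tgt G k\<rbrakk>
      \<Longrightarrow> cmp G (cmp G g h) k = cmp G g (cmp G h k)"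
    and cmp_src: "g \<in> mor G \<Longrightarrow> cmp G g (src G g) = g"
    and cmp_tgt: "g \<in> mor G \<Longrightarrow> cmp G (tgt G g) g = g"

definition is_inverse :: "('g, 'z) category_scheme \<Rightarrow> 'g \<Rightarrow> 'g \<Rightarrow> bool"
  where "is_inverse G g h \<longleftrightarrow> h \<in> mor G \<and> src G h = tgt G g \<and> tgt G h = src G g
    \<and> cmp G h g = src G g \<and> cmp G g h = tgt G g"

locale groupoid = small_category +
  assumes invertible: "g \<in> mor G \<Longrightarrow> \<exists>h. is_inverse G g h"

definition ginv :: "('g, 'z) category_scheme \<Rightarrow> 'g \<Rightarrow> 'g"
  where "ginv G g = (THE h. is_inverse G g h)"

definition hom_set :: "('g, 'z) category_scheme \<Rightarrow> 'g \<Rightarrow> 'g \<Rightarrow> 'g set"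
  where "hom_set G y z = {g \<in> mor G. src G g = y \<and> tgt G g = z}"

definition connected_groupoid :: "('g, 'z) category_scheme \<Rightarrow> bool"
  where "connected_groupoid G \<longleftrightarrow> groupoid G \<and> (\<forall>y\<in>objs G. \<forall>z\<in>objs G. hom_set G y z \<noteq> {})"

text \<open>The group of endomorphisms of \<open>x\<close>, as a groupoid with one object.\<close>

definition isotropy :: "('g, 'z) category_scheme \<Rightarrow> 'g \<Rightarrow> ('g, 'z) category_scheme"
  where "isotropy G x = G\<lparr>mor := hom_set G x x\<rparr>"

definition transversal :: "('g, 'z) category_scheme \<Rightarrow> 'g \<Rightarrow> ('g \<Rightarrow> 'g) \<Rightarrow> bool"
  where "transversal G x \<tau> \<longleftrightarrow> (\<forall>y\<in>objs G. \<tau> y \<in> hom_set G x y) \<and> \<tau> x = x"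

definition to_isotropy :: "('g, 'z) category_scheme \<Rightarrow> ('g \<Rightarrow> 'g) \<Rightarrow> 'g \<Rightarrow> 'g"
  where "to_isotropy G \<tau> g = cmp G (cmp G (ginv G (\<tau> (tgt G g))) g) (\<tau> (src G g))"


section \<open>Rings that need not be unital\<close>

text \<open>
  Such rings are carried by subsets of a type of class \<open>ring\<close> (which has no \<open>1\<close>), with the
  operations of the type. Unital rings occurring in Morita contexts are records satisfying the
  locale \<open>ring\<close> of HOL-Algebra.
\<close>

definition subrng :: "'a::ring set \<Rightarrow> bool"
  where "subrng A \<longleftrightarrow> 0 \<in> A \<and> (\<forall>a\<in>A. \<forall>b\<in>A. a + b \<in> A \<and> a * b \<in> A) \<and> (\<forall>a\<in>A. - a \<in> A)"

definition rng_ideal :: "'a::ring set \<Rightarrow> 'a set \<Rightarrow> bool"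
  where "rng_ideal J A \<longleftrightarrow> J \<subseteq> A \<and> 0 \<in> J \<and> (\<forall>a\<in>J. \<forall>b\<in>J. a + b \<in> J) \<and> (\<forall>a\<in>J. - a \<in> J)
    \<and> (\<forall>a\<in>A. \<forall>b\<in>J. a * b \<in> J \<and> b * a \<in> J)"

definition rng_iso :: "('a::ring \<Rightarrow> 'b::ring) \<Rightarrow> 'a set \<Rightarrow> 'b set \<Rightarrow> bool"
  where "rng_iso f J K \<longleftrightarrow> bij_betw f J K
    \<and> (\<forall>a\<in>J. \<forall>b\<in>J. f (a + b) = f a + f b \<and> f (a * b) = f a * f b)"

definition is_identity :: "'a::ring set \<Rightarrow> 'a \<Rightarrow> bool"
  where "is_identity J e \<longleftrightarrow> e \<in> J \<and> (\<forall>a\<in>J. e * a = a \<and> a * e = a)"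

definition rng_unital :: "'a::ring set \<Rightarrow> bool"
  where "rng_unital J \<longleftrightarrow> (\<exists>e. is_identity J e)"

definition one_of :: "'a::ring set \<Rightarrow> 'a"
  where "one_of J = (THE e. is_identity J e)"

definition central_idempotent :: "'a::ring set \<Rightarrow> 'a \<Rightarrow> bool"
  where "central_idempotent A e \<longleftrightarrow> e \<in> A \<and> e * e = e \<and> (\<forall>a\<in>A. e * a = a * e)"

text \<open>Internal direct sum; the index set is meant to be finite.\<close>

definition finite_direct_sum :: "'a::ring set \<Rightarrow> 'y set \<Rightarrow> ('y \<Rightarrow> 'a set) \<Rightarrow> bool"
  where "finite_direct_sum A Y J \<longleftrightarrow> (\<forall>y\<in>Y. J y \<subseteq> A)
    \<and> (\<forall>a\<in>A. \<exists>!f. f \<in> (\<Pi>\<^sub>E y\<in>Y. J y) \<and> a = (\<Sum>y\<in>Y. f y))"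


section \<open>Partial actions of groupoids\<close>

text \<open>
  A family \<open>(D g, \<alpha> g)\<close> of ring isomorphisms \<open>D (g\<inverse>) \<rightarrow> D g\<close>; the values of \<open>\<alpha> g\<close> outside
  \<open>D (g\<inverse>)\<close> are irrelevant. The last assumption says that \<open>\<alpha> (gh)\<close> extends the partial bijection
  \<open>\<alpha> g \<circ> \<alpha> h\<close>.
\<close>

locale partial_action =
  fixes G :: "('g, 'z) category_scheme" and A :: "'a::ring set"
    and D :: "'g \<Rightarrow> 'a set" and \<alpha> :: "'g \<Rightarrow> 'a \<Rightarrow> 'a"
  assumes groupoid: "groupoid G"
    and rng: "subrng A"
    and ideal_tgt: "g \<in> mor G \<Longrightarrow> rng_ideal (D (tgt G g)) A"
    and ideal_mor: "g \<in> mor G \<Longrightarrow> rng_ideal (D g) (D (tgt G g))"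
    and iso: "g \<in> mor G \<Longrightarrow> rng_iso (\<alpha> g) (D (ginv G g)) (D g)"
    and act_obj: "\<lbrakk>y \<in> objs G; a \<in> D y\<rbrakk> \<Longrightarrow> \<alpha> y a = a"
    and extends: "\<lbrakk>g \<in> mor G; h \<in> mor G; src G g = tgt G h;
        a \<in> D (ginv G h); \<alpha> h a \<in> D (ginv G g)\<rbrakk>
      \<Longrightarrow> a \<in> D (ginv G (cmp G g h)) \<and> \<alpha> (cmp G g h) a = \<alpha> g (\<alpha> h a)"

text \<open>A group is a groupoid \<open>H\<close> whose only object is its identity \<open>e\<close>.\<close>

definition partial_group_action ::
    "('g, 'z) category_scheme \<Rightarrow> 'g \<Rightarrow> 'a::ring set \<Rightarrow> ('g \<Rightarrow> 'a set) \<Rightarrow> ('g \<Rightarrow> 'a \<Rightarrow> 'a) \<Rightarrow> bool"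
  where "partial_group_action H e R D \<alpha> \<longleftrightarrow> objs H = {e} \<and> partial_action H R D \<alpha> \<and> D e = R"

definition unital_partial_group_action ::
    "('g, 'z) category_scheme \<Rightarrow> 'g \<Rightarrow> 'a::ring set \<Rightarrow> ('g \<Rightarrow> 'a set) \<Rightarrow> ('g \<Rightarrow> 'a \<Rightarrow> 'a) \<Rightarrow> bool"
  where "unital_partial_group_action H e R D \<alpha> \<longleftrightarrow> partial_group_action H e R D \<alpha>
    \<and> (\<forall>h\<in>mor H. \<exists>u. is_identity (D h) u \<and> central_idempotent R u)"

definition transversal_global ::
    "('g, 'z) category_scheme \<Rightarrow> 'g \<Rightarrow> ('g \<Rightarrow> 'g) \<Rightarrow> ('g \<Rightarrow> 'a set) \<Rightarrow> bool"
  where "transversal_global G x \<tau> D \<longleftrightarrow>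
    (\<forall>y\<in>objs G. D (ginv G (\<tau> y)) = D x \<and> D (\<tau> y) = D y)"


section \<open>Lifted partial actions\<close>

text \<open>
  The three families of a datum share one indexing by morphisms: \<open>J y\<close> for objects \<open>y\<close>,
  \<open>J (\<tau> y)\<close>, \<open>J ((\<tau> y)\<inverse>)\<close>, and \<open>J h\<close> for endomorphisms \<open>h\<close> of \<open>x\<close>, and likewise for \<open>\<gamma>\<close>.
  These index sets overlap only in \<open>x\<close>, where the notations agree because \<open>\<tau> x = x\<close>.
\<close>

locale lifting_datum =
  fixes G :: "('g, 'z) category_scheme" and x :: 'g and \<tau> :: "'g \<Rightarrow> 'g"
    and A :: "'a::ring set" and J :: "'g \<Rightarrow> 'a set" and \<gamma> :: "'g \<Rightarrow> 'a \<Rightarrow> 'a"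
  assumes ideals: "y \<in> objs G \<Longrightarrow> rng_ideal (J y) A"
    and iso_transversal: "y \<in> objs G \<Longrightarrow> rng_iso (\<gamma> (\<tau> y)) (J (ginv G (\<tau> y))) (J (\<tau> y))"
    and action: "partial_group_action (isotropy G x) x (J x) J \<gamma>"
    and base: "J (\<tau> x) = J x" "a \<in> J x \<Longrightarrow> \<gamma> (\<tau> x) a = a"
    and ideal_transversal: "y \<in> objs G \<Longrightarrow> rng_ideal (J (\<tau> y)) (J y)"
    and ideal_transversal_inv: "y \<in> objs G \<Longrightarrow> rng_ideal (J (ginv G (\<tau> y))) (J x)"
    and ideal_lifted: "g \<in> mor G \<Longrightarrow>
      rng_ideal
        (\<gamma> (\<tau> (tgt G g)) ` (J (ginv G (\<tau> (tgt G g))) \<inter>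
          \<gamma> (to_isotropy G \<tau> g) `
            (J (ginv G (\<tau> (src G g))) \<inter> J (ginv G (to_isotropy G \<tau> g)))))
        (J (tgt G g))"

text \<open>A partial bijection is a domain together with a map that is injective on it.\<close>

type_synonym 'a pbij = "'a set \<times> ('a \<Rightarrow> 'a)"

definition pb_comp :: "'a pbij \<Rightarrow> 'a pbij \<Rightarrow> 'a pbij"
  where "pb_comp u v = ({a \<in> fst v. snd v a \<in> fst u}, snd u \<circ> snd v)"

definition pb_range :: "'a pbij \<Rightarrow> 'a set"
  where "pb_range u = snd u ` fst u"

definition pb_inv :: "'a pbij \<Rightarrow> 'a pbij"
  where "pb_inv u = (pb_range u, inv_into (fst u) (snd u))"

definition lifted ::
    "('g, 'z) category_scheme \<Rightarrow> ('g \<Rightarrow> 'g) \<Rightarrow> ('g \<Rightarrow> 'a set) \<Rightarrow> ('g \<Rightarrow> 'a \<Rightarrow> 'a) \<Rightarrow> 'g \<Rightarrow> 'a pbij"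
  where "lifted G \<tau> J \<gamma> g =
    (if g \<in> objs G then (J g, id)
     else let p = (\<lambda>k. (J (ginv G k), \<gamma> k))
       in pb_comp (pb_comp (p (\<tau> (tgt G g))) (p (to_isotropy G \<tau> g))) (pb_inv (p (\<tau> (src G g)))))"

definition lifted_ideal ::
    "('g, 'z) category_scheme \<Rightarrow> ('g \<Rightarrow> 'g) \<Rightarrow> ('g \<Rightarrow> 'a set) \<Rightarrow> ('g \<Rightarrow> 'a \<Rightarrow> 'a) \<Rightarrow> 'g \<Rightarrow> 'a set"
  where "lifted_ideal G \<tau> J \<gamma> g = pb_range (lifted G \<tau> J \<gamma> g)"

definition lifted_map ::
    "('g, 'z) category_scheme \<Rightarrow> ('g \<Rightarrow> 'g) \<Rightarrow> ('g \<Rightarrow> 'a set) \<Rightarrow> ('g \<Rightarrow> 'a \<Rightarrow> 'a) \<Rightarrow> 'g \<Rightarrow> 'a \<Rightarrow> 'a"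
  where "lifted_map G \<tau> J \<gamma> g = snd (lifted G \<tau> J \<gamma> g)"

definition gamma_unital ::
    "('g, 'z) category_scheme \<Rightarrow> 'g \<Rightarrow> ('g \<Rightarrow> 'a::ring set) \<Rightarrow> ('g \<Rightarrow> 'a \<Rightarrow> 'a) \<Rightarrow> bool"
  where "gamma_unital G x J \<gamma> \<longleftrightarrow>
    rng_unital (J x) \<and> unital_partial_group_action (isotropy G x) x (J x) J \<gamma>"


section \<open>Modules and bimodules over noncommutative rings\<close>

text \<open>The locale \<open>module\<close> of HOL-Algebra requires a commutative ring of scalars.\<close>

locale left_module = R?: ring R + M?: abelian_group M
  for R :: "('r, 'k) ring_scheme" (structure) and M :: "('r, 'm, 'z) module_scheme" (structure) +
  assumes smult_closed: "\<lbrakk>a \<in> carrier R; m \<in> carrier M\<rbrakk> \<Longrightarrow> a \<odot>\<^bsub>M\<^esub> m \<in> carrier M"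
    and smult_l_distr: "\<lbrakk>a \<in> carrier R; b \<in> carrier R; m \<in> carrier M\<rbrakk> \<Longrightarrow>
      (a \<oplus> b) \<odot>\<^bsub>M\<^esub> m = a \<odot>\<^bsub>M\<^esub> m \<oplus>\<^bsub>M\<^esub> b \<odot>\<^bsub>M\<^esub> m"
    and smult_r_distr: "\<lbrakk>a \<in> carrier R; m \<in> carrier M; n \<in> carrier M\<rbrakk> \<Longrightarrow>
      a \<odot>\<^bsub>M\<^esub> (m \<oplus>\<^bsub>M\<^esub> n) = a \<odot>\<^bsub>M\<^esub> m \<oplus>\<^bsub>M\<^esub> a \<odot>\<^bsub>M\<^esub> n"
    and smult_assoc: "\<lbrakk>a \<in> carrier R; b \<in> carrier R; m \<in> carrier M\<rbrakk> \<Longrightarrow>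
      (a \<otimes> b) \<odot>\<^bsub>M\<^esub> m = a \<odot>\<^bsub>M\<^esub> (b \<odot>\<^bsub>M\<^esub> m)"
    and smult_one: "m \<in> carrier M \<Longrightarrow> \<one> \<odot>\<^bsub>M\<^esub> m = m"

definition finitely_generated :: "('r, 'k) ring_scheme \<Rightarrow> ('r, 'm, 'l) module_scheme \<Rightarrow> bool"
  where "finitely_generated R M \<longleftrightarrow> (\<exists>X. finite X \<and> X \<subseteq> carrier M \<and>
    (\<forall>m\<in>carrier M. \<exists>r \<in> X \<rightarrow> carrier R. m = (\<Oplus>\<^bsub>M\<^esub>v\<in>X. r v \<odot>\<^bsub>M\<^esub> v)))"

definition free_module :: "('r, 'k) ring_scheme \<Rightarrow> 'i set \<Rightarrow> ('r, 'i \<Rightarrow> 'r) module"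
  where "free_module R X = \<lparr>
    carrier = {f \<in> (\<Pi>\<^sub>E i\<in>X. carrier R). finite {i \<in> X. f i \<noteq> \<zero>\<^bsub>R\<^esub>}},
    monoid.mult = (\<lambda>f g. undefined), one = undefined,
    zero = (\<lambda>i\<in>X. \<zero>\<^bsub>R\<^esub>),
    add = (\<lambda>f g. \<lambda>i\<in>X. f i \<oplus>\<^bsub>R\<^esub> g i),
    smult = (\<lambda>r f. \<lambda>i\<in>X. r \<otimes>\<^bsub>R\<^esub> f i)\<rparr>"

text \<open>
  A projective module is one isomorphic to a direct summand of a free module. Taking the basis
  \<open>X\<close> from the type of elements of \<open>M\<close> is no restriction: a projective \<open>M\<close> is a direct summand of
  the free module on its own elements.
\<close>

definition projective :: "('r, 'k) ring_scheme \<Rightarrow> ('r, 'm, 'l) module_scheme \<Rightarrow> bool"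
  where "projective R M \<longleftrightarrow> (\<exists>(X :: 'm set) P Q \<phi>. let F = free_module R X in
    submodule P R F \<and> submodule Q R F
    \<and> P \<inter> Q = {\<zero>\<^bsub>F\<^esub>} \<and> P <+>\<^bsub>F\<^esub> Q = carrier F
    \<and> bij_betw \<phi> (carrier M) P
    \<and> (\<forall>m\<in>carrier M. \<forall>n\<in>carrier M. \<phi> (m \<oplus>\<^bsub>M\<^esub> n) = \<phi> m \<oplus>\<^bsub>F\<^esub> \<phi> n)
    \<and> (\<forall>r\<in>carrier R. \<forall>m\<in>carrier M. \<phi> (r \<odot>\<^bsub>M\<^esub> m) = r \<odot>\<^bsub>F\<^esub> \<phi> m))"

definition fg_projective :: "('r, 'k) ring_scheme \<Rightarrow> ('r, 'm, 'l) module_scheme \<Rightarrow> bool"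
  where "fg_projective R M \<longleftrightarrow> left_module R M \<and> finitely_generated R M \<and> projective R M"

text \<open>
  As in the record \<open>module\<close> of HOL-Algebra, the fields \<open>mult\<close> and \<open>one\<close> play no role.
\<close>

record ('r, 'm, 's) bimodule = "('r, 'm) module" +
  rsmult :: "'m \<Rightarrow> 's \<Rightarrow> 'm"

locale bimodule = left_module R M + S?: ring S
  for R :: "('r, 'k) ring_scheme" (structure) and S :: "('s, 'l) ring_scheme" (structure)
    and M :: "('r, 'm, 's, 'z) bimodule_scheme" (structure) +
  assumes rsmult_closed: "\<lbrakk>m \<in> carrier M; s \<in> carrier S\<rbrakk> \<Longrightarrow> rsmult M m s \<in> carrier M"
    and rsmult_l_distr: "\<lbrakk>m \<in> carrier M; n \<in> carrier M; s \<in> carrier S\<rbrakk> \<Longrightarrow>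
      rsmult M (m \<oplus>\<^bsub>M\<^esub> n) s = rsmult M m s \<oplus>\<^bsub>M\<^esub> rsmult M n s"
    and rsmult_r_distr: "\<lbrakk>m \<in> carrier M; s \<in> carrier S; t \<in> carrier S\<rbrakk> \<Longrightarrow>
      rsmult M m (s \<oplus>\<^bsub>S\<^esub> t) = rsmult M m s \<oplus>\<^bsub>M\<^esub> rsmult M m t"
    and rsmult_assoc: "\<lbrakk>m \<in> carrier M; s \<in> carrier S; t \<in> carrier S\<rbrakk> \<Longrightarrow>
      rsmult M m (s \<otimes>\<^bsub>S\<^esub> t) = rsmult M (rsmult M m s) t"
    and rsmult_one: "m \<in> carrier M \<Longrightarrow> rsmult M m \<one>\<^bsub>S\<^esub> = m"
    and smult_rsmult: "\<lbrakk>a \<in> carrier R; m \<in> carrier M; s \<in> carrier S\<rbrakk> \<Longrightarrow>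
      rsmult M (a \<odot>\<^bsub>M\<^esub> m) s = a \<odot>\<^bsub>M\<^esub> rsmult M m s"

definition regular_bimodule :: "('r, 'k) ring_scheme \<Rightarrow> ('r, 'r, 'r) bimodule"
  where "regular_bimodule R = \<lparr>carrier = carrier R, monoid.mult = monoid.mult R, one = one R,
    zero = zero R, add = add R, smult = monoid.mult R, rsmult = monoid.mult R\<rparr>"

definition bimodule_hom :: "('r, 'k) ring_scheme \<Rightarrow> ('s, 'l) ring_scheme \<Rightarrow>
    ('r, 'm, 's, 'y) bimodule_scheme \<Rightarrow> ('r, 'n, 's, 'z) bimodule_scheme \<Rightarrow> ('m \<Rightarrow> 'n) set"
  where "bimodule_hom R S M N = {\<phi> \<in> carrier M \<rightarrow> carrier N.
    (\<forall>m\<in>carrier M. \<forall>n\<in>carrier M. \<phi> (m \<oplus>\<^bsub>M\<^esub> n) = \<phi> m \<oplus>\<^bsub>N\<^esub> \<phi> n)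
    \<and> (\<forall>r\<in>carrier R. \<forall>m\<in>carrier M. \<phi> (r \<odot>\<^bsub>M\<^esub> m) = r \<odot>\<^bsub>N\<^esub> \<phi> m)
    \<and> (\<forall>m\<in>carrier M. \<forall>s\<in>carrier S. \<phi> (rsmult M m s) = rsmult N (\<phi> m) s)}"


section \<open>Tensor products\<close>

text \<open>
  \<open>U \<otimes>\<^sub>S V\<close> is the free abelian group on \<open>carrier U \<times> carrier V\<close> modulo the subgroup generated
  by the usual relations, so its elements are cosets.
\<close>

definition tensor_free ::
    "('r, 'u, 's, 'y) bimodule_scheme \<Rightarrow> ('s, 'v, 't, 'z) bimodule_scheme \<Rightarrow> ('u \<times> 'v \<Rightarrow>\<^sub>0 int) monoid"
  where "tensor_free U V = free_Abelian_group (carrier U \<times> carrier V)"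

definition tensor_relations :: "('s, 'k) ring_scheme \<Rightarrow>
    ('r, 'u, 's, 'y) bimodule_scheme \<Rightarrow> ('s, 'v, 't, 'z) bimodule_scheme \<Rightarrow> ('u \<times> 'v \<Rightarrow>\<^sub>0 int) set"
  where "tensor_relations S U V = generate (tensor_free U V)
    ({frag_of (u \<oplus>\<^bsub>U\<^esub> u', v) - frag_of (u, v) - frag_of (u', v) | u u' v.
        u \<in> carrier U \<and> u' \<in> carrier U \<and> v \<in> carrier V}
     \<union> {frag_of (u, v \<oplus>\<^bsub>V\<^esub> v') - frag_of (u, v) - frag_of (u, v') | u v v'.
        u \<in> carrier U \<and> v \<in> carrier V \<and> v' \<in> carrier V}
     \<union> {frag_of (rsmult U u s, v) - frag_of (u, s \<odot>\<^bsub>V\<^esub> v) | u s v.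
        u \<in> carrier U \<and> s \<in> carrier S \<and> v \<in> carrier V})"

definition elem_tensor :: "('s, 'k) ring_scheme \<Rightarrow> ('r, 'u, 's, 'y) bimodule_scheme \<Rightarrow>
    ('s, 'v, 't, 'z) bimodule_scheme \<Rightarrow> 'u \<Rightarrow> 'v \<Rightarrow> ('u \<times> 'v \<Rightarrow>\<^sub>0 int) set"
  where "elem_tensor S U V u v = tensor_relations S U V #>\<^bsub>tensor_free U V\<^esub> frag_of (u, v)"

text \<open>The additive map on \<open>U \<otimes>\<^sub>S V\<close> induced by a balanced map \<open>f\<close>, i.e. \<open>u \<otimes> v \<mapsto> f u v\<close>.\<close>

definition tensor_lift :: "('w, 'k) ring_scheme \<Rightarrow> ('u \<Rightarrow> 'v \<Rightarrow> 'w) \<Rightarrow> ('u \<times> 'v \<Rightarrow>\<^sub>0 int) set \<Rightarrow> 'w"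
  where "tensor_lift W f Z = the_elem ((\<lambda>c. \<Oplus>\<^bsub>W\<^esub>p\<in>Poly_Mapping.keys c.
    [Poly_Mapping.lookup c p] \<cdot>\<^bsub>W\<^esub> f (fst p) (snd p)) ` Z)"

definition tensor_group :: "('s, 'k) ring_scheme \<Rightarrow> ('r, 'u, 's, 'y) bimodule_scheme \<Rightarrow>
    ('s, 'v, 't, 'z) bimodule_scheme \<Rightarrow> (('u \<times> 'v \<Rightarrow>\<^sub>0 int) set) ring"
  where "tensor_group S U V = (let Q = tensor_free U V Mod tensor_relations S U V in
    \<lparr>carrier = carrier Q, monoid.mult = (\<lambda>X Y. undefined), one = undefined,
     zero = \<one>\<^bsub>Q\<^esub>, add = monoid.mult Q\<rparr>)"

text \<open>The outer actions are \<open>r (u \<otimes> v) = r u \<otimes> v\<close> and \<open>(u \<otimes> v) t = u \<otimes> v t\<close>.\<close>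

definition tensor :: "('s, 'k) ring_scheme \<Rightarrow> ('r, 'u, 's, 'y) bimodule_scheme \<Rightarrow>
    ('s, 'v, 't, 'z) bimodule_scheme \<Rightarrow> ('r, ('u \<times> 'v \<Rightarrow>\<^sub>0 int) set, 't) bimodule"
  where "tensor S U V = (let T = tensor_group S U V in
    \<lparr>carrier = carrier T, monoid.mult = monoid.mult T, one = one T,
     zero = zero T, add = add T,
     smult = (\<lambda>r. tensor_lift T (\<lambda>u v. elem_tensor S U V (r \<odot>\<^bsub>U\<^esub> u) v)),
     rsmult = (\<lambda>Z t. tensor_lift T (\<lambda>u v. elem_tensor S U V u (rsmult V v t)) Z)\<rparr>)"


section \<open>Morita contexts\<close>

locale morita_context = U?: bimodule R S U + V?: bimodule S R V
  for R :: "('r, 'k) ring_scheme" (structure) and S :: "('s, 'l) ring_scheme" (structure)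
    and U :: "('r, 'u, 's, 'y) bimodule_scheme" (structure)
    and V :: "('s, 'v, 'r, 'z) bimodule_scheme" (structure) +
  fixes \<mu> :: "('u \<times> 'v \<Rightarrow>\<^sub>0 int) set \<Rightarrow> 'r" and \<nu> :: "('v \<times> 'u \<Rightarrow>\<^sub>0 int) set \<Rightarrow> 's"
  assumes mu_hom: "\<mu> \<in> bimodule_hom R R (tensor S U V) (regular_bimodule R)"
    and nu_hom: "\<nu> \<in> bimodule_hom S S (tensor R V U) (regular_bimodule S)"
    and compat_U: "\<lbrakk>u \<in> carrier U; v \<in> carrier V; u' \<in> carrier U\<rbrakk> \<Longrightarrow>
      rsmult U u (\<nu> (elem_tensor R V U v u')) = \<mu> (elem_tensor S U V u v) \<odot>\<^bsub>U\<^esub> u'"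
    and compat_V: "\<lbrakk>v \<in> carrier V; u \<in> carrier U; v' \<in> carrier V\<rbrakk> \<Longrightarrow>
      rsmult V v (\<mu> (elem_tensor S U V u v')) = \<nu> (elem_tensor R V U v u) \<odot>\<^bsub>V\<^esub> v'"

locale strict_morita_context = morita_context +
  assumes mu_iso: "bij_betw \<mu> (carrier (tensor S U V)) (carrier R)"
    and nu_iso: "bij_betw \<nu> (carrier (tensor R V U)) (carrier S)"


section \<open>The Morita context of a partial action\<close>

text \<open>
  In this section \<open>G\<close> is finite and \<open>(B, \<beta>)\<close> is a partial action of \<open>G\<close> on a ring \<open>A\<close> such that \<open>A\<close>
  and all \<open>B g\<close> are unital; \<open>one_of (B g)\<close> is the identity \<open>1\<^sub>g\<close> of \<open>B g\<close>.
\<close>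

definition pull :: "('g, 'z) category_scheme \<Rightarrow> ('g \<Rightarrow> 'a::ring set) \<Rightarrow> ('g \<Rightarrow> 'a \<Rightarrow> 'a) \<Rightarrow> 'g \<Rightarrow> 'a \<Rightarrow> 'a"
  where "pull G B \<beta> g a = \<beta> g (a * one_of (B (ginv G g)))"

definition fixed_ring ::
    "('g, 'z) category_scheme \<Rightarrow> 'a::ring set \<Rightarrow> ('g \<Rightarrow> 'a set) \<Rightarrow> ('g \<Rightarrow> 'a \<Rightarrow> 'a) \<Rightarrow> 'a Ring.ring"
  where "fixed_ring G A B \<beta> = \<lparr>
    carrier = {a \<in> A. \<forall>g\<in>mor G. pull G B \<beta> g a = a * one_of (B g)},
    monoid.mult = (*), one = one_of A, zero = 0, add = (+)\<rparr>"

definition trace ::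
    "('g, 'z) category_scheme \<Rightarrow> ('g \<Rightarrow> 'a::ring set) \<Rightarrow> ('g \<Rightarrow> 'a \<Rightarrow> 'a) \<Rightarrow> 'a \<Rightarrow> 'a"
  where "trace G B \<beta> a = (\<Sum>g\<in>mor G. pull G B \<beta> g a)"

text \<open>
  The element \<open>\<Sum>g. f g \<delta>\<^sub>g\<close> of the partial skew groupoid ring is the function \<open>f\<close>, extended by \<open>0\<close>
  outside \<open>G\<close>.
\<close>

definition skew_ring ::
    "('g, 'z) category_scheme \<Rightarrow> ('g \<Rightarrow> 'a::ring set) \<Rightarrow> ('g \<Rightarrow> 'a \<Rightarrow> 'a) \<Rightarrow> ('g \<Rightarrow> 'a) Ring.ring"
  where "skew_ring G B \<beta> = \<lparr>
    carrier = {f. (\<forall>g\<in>mor G. f g \<in> B g) \<and> (\<forall>g. g \<notin> mor G \<longrightarrow> f g = 0)},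
    monoid.mult = (\<lambda>f f' k.
      \<Sum>(g, h) \<in> {(g, h) \<in> mor G \<times> mor G. src G g = tgt G h \<and> cmp G g h = k}.
        f g * pull G B \<beta> g (f' h)),
    one = (\<lambda>y. if y \<in> objs G then one_of (B y) else 0),
    zero = (\<lambda>g. 0),
    add = (\<lambda>f f' g. f g + f' g)\<rparr>"

text \<open>\<open>A\<close> as a bimodule over the fixed ring (left) and the skew groupoid ring (right).\<close>

definition fixed_skew_bimodule :: "('g, 'z) category_scheme \<Rightarrow> 'a::ring set \<Rightarrow> ('g \<Rightarrow> 'a set) \<Rightarrow>
    ('g \<Rightarrow> 'a \<Rightarrow> 'a) \<Rightarrow> ('a, 'a, 'g \<Rightarrow> 'a) bimodule"
  where "fixed_skew_bimodule G A B \<beta> = \<lparr>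
    carrier = A, monoid.mult = (*), one = one_of A, zero = 0, add = (+),
    smult = (*),
    rsmult = (\<lambda>b f. \<Sum>g\<in>mor G. \<beta> (ginv G g) (b * f g))\<rparr>"

text \<open>\<open>A\<close> as a bimodule over the skew groupoid ring (left) and the fixed ring (right).\<close>

definition skew_fixed_bimodule :: "('g, 'z) category_scheme \<Rightarrow> 'a::ring set \<Rightarrow> ('g \<Rightarrow> 'a set) \<Rightarrow>
    ('g \<Rightarrow> 'a \<Rightarrow> 'a) \<Rightarrow> ('g \<Rightarrow> 'a, 'a, 'a) bimodule"
  where "skew_fixed_bimodule G A B \<beta> = \<lparr>
    carrier = A, monoid.mult = (*), one = one_of A, zero = 0, add = (+),
    smult = (\<lambda>f b. \<Sum>g\<in>mor G. f g * pull G B \<beta> g b),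
    rsmult = (*)\<rparr>"

text \<open>\<open>\<Gamma> (a \<otimes> b) = t\<^sub>\<beta> (a b)\<close> and \<open>\<Gamma>' (a \<otimes> b) = \<Sum>g. a \<beta>\<^sub>g (b 1\<^bsub>g\<inverse>\<^esub>) \<delta>\<^sub>g\<close>.\<close>

definition Gamma_map :: "('g, 'z) category_scheme \<Rightarrow> 'a::ring set \<Rightarrow> ('g \<Rightarrow> 'a set) \<Rightarrow>
    ('g \<Rightarrow> 'a \<Rightarrow> 'a) \<Rightarrow> ('a \<times> 'a \<Rightarrow>\<^sub>0 int) set \<Rightarrow> 'a"
  where "Gamma_map G A B \<beta> = tensor_lift (fixed_ring G A B \<beta>) (\<lambda>a b. trace G B \<beta> (a * b))"

definition Gamma_map' :: "('g, 'z) category_scheme \<Rightarrow> ('g \<Rightarrow> 'a::ring set) \<Rightarrow>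
    ('g \<Rightarrow> 'a \<Rightarrow> 'a) \<Rightarrow> ('a \<times> 'a \<Rightarrow>\<^sub>0 int) set \<Rightarrow> ('g \<Rightarrow> 'a)"
  where "Gamma_map' G B \<beta> = tensor_lift (skew_ring G B \<beta>)
    (\<lambda>a b g. if g \<in> mor G then a * pull G B \<beta> g b else 0)"

end

(*
  Strictness of a Morita context only requires both of its maps to be surjective, i.e. to hit the
  identity. For the contexts at hand this means that the trace takes the value 1, respectively that
  the identity of the skew groupoid ring is a sum of elements of the form Gamma'(a (x) b).

  Both conditions descend to the isotropy group at x and ascend from it. A morphism g from y to z
  is tau_z g_x tau_y^-1, so the x-component of t_beta(a) is the trace over the group of
  sum_y beta_(tau_y^-1)(a 1_y), and for a in B_x the element t_beta(a) is the sum of the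
  translates beta_(tau_y) of its trace over the group. Elements of the skew ring are restricted to
  the group by cutting with 1_x; conversely a sum representing the identity over the group is
  translated along every tau_y and added up.
*)
theory Submission
  imports Defs
begin

section \<open>Maps out of tensor products\<close>

text \<open>The obstacle is partiality: \<open>\<alpha> g\<close> lives on one ideal and composites
  live on smaller ones, so sums over the groupoid cannot be manipulated directly. Because every
  \<open>D g\<close> has an identity \<open>e g\<close>, each map is extended to a total map
  \<open>P g\<close>, which first multiplies by the identity of the domain. All partiality is then
  condensed in two rules: for composable morphisms \<open>P h (P g a)\<close> is \<open>P\<close> of
  the composite at \<open>a\<close>, multiplied by \<open>e h\<close>; otherwise it is
  \<open>0\<close>. Globality along the transversal makes this factor harmless for
  \<open>\<tau> y\<close>. Both Morita contexts are instances of one locale, so the criterion for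
  strictness is proved once. Its condition on the skew ring is membership of the identity in a
  generated additive subgroup; it is transported by additive maps between the two skew rings that
  send generators into the generated subgroup. The lifted action is defined by composing partial
  bijections. Globality brings it into a closed form: \<open>B g\<close> is the image of
  \<open>J (red g)\<close> under the transversal map at the target of \<open>g\<close>.\<close>

lemma (in abelian_group) hom_free_Abelian_group_finsum:
  assumes f: "f \<in> X \<rightarrow> carrier G"
  defines "h \<equiv> \<lambda>c. \<Oplus>p\<in>Poly_Mapping.keys c. [Poly_Mapping.lookup c p] \<cdot> f p"
  shows "h \<in> hom (free_Abelian_group X) (add_monoid G)"
    and "p \<in> X \<Longrightarrow> h (frag_of p) = f p"
proof -
  have closed: "[(k::int)] \<cdot> f p \<in> carrier G" if "p \<in> X" for k p
    using f that by (simp add: Pi_iff)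
  \<comment> \<open>The index set \<open>keys c\<close> varies with \<open>c\<close>, and
    cancellation can make the keys of \<open>c + d\<close> smaller than the union. Any larger finite
    index set inside \<open>X\<close> gives the same sum, so the three sums can be compared over one
    set.\<close>
  have h_eq: "h c = (\<Oplus>p\<in>K. [Poly_Mapping.lookup c p] \<cdot> f p)"
    if K: "finite K" "K \<subseteq> X" "Poly_Mapping.keys c \<subseteq> K" for c K
    unfolding h_def
  proof (rule add.finprod_mono_neutral_cong_left[OF K(1,3)])
    show "[Poly_Mapping.lookup c p] \<cdot> f p = \<zero>" if "p \<in> K - Poly_Mapping.keys c" for p
      using that by (simp add: in_keys_iff add_pow_def)
    show "(\<lambda>p. [Poly_Mapping.lookup c p] \<cdot> f p) \<in> K \<rightarrow> carrier G"
      using K closed by blast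
  qed simp
  show "h \<in> hom (free_Abelian_group X) (add_monoid G)"
  proof (rule homI)
    fix c assume c: "c \<in> carrier (free_Abelian_group X)"
    then show "h c \<in> carrier (add_monoid G)"
      by (auto simp: h_def intro!: finsum_closed closed)
    fix d assume d: "d \<in> carrier (free_Abelian_group X)"
    define K where "K = Poly_Mapping.keys c \<union> Poly_Mapping.keys d"
    have K: "finite K" "K \<subseteq> X" using c d by (auto simp: K_def)
    have "h (c + d) = (\<Oplus>p\<in>K. [(Poly_Mapping.lookup c p + Poly_Mapping.lookup d p)] \<cdot> f p)"
      using h_eq[of K "c + d"] K keys_add[of c d] by (auto simp: K_def lookup_add)
    also have "\<dots> = (\<Oplus>p\<in>K. [Poly_Mapping.lookup c p] \<cdot> f p \<oplus> [Poly_Mapping.lookup d p] \<cdot> f p)"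
      by (rule finsum_cong') (use K f in \<open>auto simp: add.int_pow_mult Pi_iff subset_iff\<close>)
    also have "\<dots> = h c \<oplus> h d"
      using h_eq[of K c] h_eq[of K d] K closed
      by (subst finsum_addf) (auto simp: K_def)
    finally show "h (c \<otimes>\<^bsub>free_Abelian_group X\<^esub> d) = h c \<otimes>\<^bsub>add_monoid G\<^esub> h d"
      by simp
  qed
  show "h (frag_of p) = f p" if "p \<in> X"
    using that f closed by (auto simp: h_def Pi_iff)
qed

text \<open>The last three clauses are what makes the additive extension of \<open>f\<close> vanish
  on the three families of generators of \<open>tensor_relations\<close>.\<close>

definition balanced :: "('s, 'k) ring_scheme \<Rightarrow> ('r, 'u, 's, 'y) bimodule_scheme \<Rightarrow>
    ('s, 'v, 't, 'z) bimodule_scheme \<Rightarrow> ('w, 'l) ring_scheme \<Rightarrow> ('u \<Rightarrow> 'v \<Rightarrow> 'w) \<Rightarrow> bool"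
  where "balanced S U V W f \<longleftrightarrow>
    (\<forall>u\<in>carrier U. \<forall>v\<in>carrier V. f u v \<in> carrier W)
    \<and> (\<forall>u\<in>carrier U. \<forall>u'\<in>carrier U. \<forall>v\<in>carrier V. f (u \<oplus>\<^bsub>U\<^esub> u') v = f u v \<oplus>\<^bsub>W\<^esub> f u' v)
    \<and> (\<forall>u\<in>carrier U. \<forall>v\<in>carrier V. \<forall>v'\<in>carrier V. f u (v \<oplus>\<^bsub>V\<^esub> v') = f u v \<oplus>\<^bsub>W\<^esub> f u v')
    \<and> (\<forall>u\<in>carrier U. \<forall>s\<in>carrier S. \<forall>v\<in>carrier V. f (rsmult U u s) v = f u (s \<odot>\<^bsub>V\<^esub> v))"

lemma add_monoid_tensor_group:
  "add_monoid (tensor_group S U V) = tensor_free U V Mod tensor_relations S U V"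
  by (simp add: tensor_group_def Let_def FactGroup_def)

lemma tensor_simps [simp]:
  "carrier (tensor S U V) = carrier (tensor_group S U V)"
  "add (tensor S U V) = add (tensor_group S U V)"
  "zero (tensor S U V) = zero (tensor_group S U V)"
  by (simp_all add: tensor_def Let_def)

locale tensor_product = U?: bimodule R S U + V?: bimodule S T V
  for R :: "('r, 'k) ring_scheme" and S :: "('s, 'l) ring_scheme" and T :: "('t, 'm) ring_scheme"
    and U :: "('r, 'u, 's, 'y) bimodule_scheme" and V :: "('s, 'v, 't, 'z) bimodule_scheme"
begin

abbreviation "F \<equiv> tensor_free U V"
abbreviation "N \<equiv> tensor_relations S U V"
abbreviation "TG \<equiv> tensor_group S U V"
abbreviation "el \<equiv> elem_tensor S U V"

abbreviation "relators \<equiv> {frag_of (u \<oplus>\<^bsub>U\<^esub> u', v) - frag_of (u, v) - frag_of (u', v) | u u' v.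
        u \<in> carrier U \<and> u' \<in> carrier U \<and> v \<in> carrier V}
     \<union> {frag_of (u, v \<oplus>\<^bsub>V\<^esub> v') - frag_of (u, v) - frag_of (u, v') | u v v'.
        u \<in> carrier U \<and> v \<in> carrier V \<and> v' \<in> carrier V}
     \<union> {frag_of (rsmult U u s, v) - frag_of (u, s \<odot>\<^bsub>V\<^esub> v) | u s v.
        u \<in> carrier U \<and> s \<in> carrier S \<and> v \<in> carrier V}"

lemma F_comm_group: "comm_group F"
  by (simp add: tensor_free_def abelian_free_Abelian_group)

sublocale F: comm_group F
  by (rule F_comm_group)

lemma F_simps [simp]:
  "c \<in> carrier F \<longleftrightarrow> Poly_Mapping.keys c \<subseteq> carrier U \<times> carrier V"
  "c \<otimes>\<^bsub>F\<^esub> d = c + d" "\<one>\<^bsub>F\<^esub> = 0"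
  "Poly_Mapping.keys c \<subseteq> carrier U \<times> carrier V \<Longrightarrow> inv\<^bsub>F\<^esub> c = - c"
  by (simp_all add: tensor_free_def)

lemma keys_minus_subset:
  assumes "Poly_Mapping.keys c \<subseteq> X" "Poly_Mapping.keys d \<subseteq> X"
  shows "Poly_Mapping.keys (c - d :: 'b \<Rightarrow>\<^sub>0 int) \<subseteq> X"
  using assms keys_diff[of c d] by blast

lemma relators_closed: "relators \<subseteq> carrier F"
proof -
  have frag: "frag_of (u, v) \<in> carrier F" if "u \<in> carrier U" "v \<in> carrier V" for u v
    using that by simp
  have diff: "c - d \<in> carrier F" if "c \<in> carrier F" "d \<in> carrier F" for c d
    using that keys_minus_subset by simp
  show ?thesis
    by (intro Un_least subsetI; elim CollectE exE conjE; hypsubst;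
        intro diff frag U.M.a_closed V.M.a_closed U.rsmult_closed V.smult_closed; assumption)
qed

lemma N_subgroup: "subgroup N F"
  unfolding tensor_relations_def by (rule F.generate_is_subgroup[OF relators_closed])

lemma N_normal: "N \<lhd> F"
  by (rule F.normal_iff_subgroup[THEN iffD2, OF N_subgroup])

lemma TG_abelian_group: "abelian_group TG"
proof (rule comm_group_abelian_groupI)
  show "comm_group (add_monoid TG)"
    unfolding add_monoid_tensor_group by (rule F.abelian_FactGroup[OF N_subgroup])
qed

sublocale TG: abelian_group TG
  by (rule TG_abelian_group)

abbreviation "cl c \<equiv> N #>\<^bsub>F\<^esub> c"

lemma carrier_TG: "carrier TG = cl ` carrier F"
  by (auto simp: tensor_group_def Let_def FactGroup_def RCOSETS_def)

lemma cl_add: "\<lbrakk>c \<in> carrier F; d \<in> carrier F\<rbrakk> \<Longrightarrow> cl c \<oplus>\<^bsub>TG\<^esub> cl d = cl (c + d)"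
  using normal.rcos_sum[OF N_normal, of c d] by (simp add: tensor_group_def Let_def FactGroup_def)

lemma cl_hom: "cl \<in> hom F (add_monoid TG)"
  by (rule homI) (use cl_add carrier_TG in auto)

lemma el_closed: "\<lbrakk>u \<in> carrier U; v \<in> carrier V\<rbrakk> \<Longrightarrow> el u v \<in> carrier TG"
  by (auto simp: elem_tensor_def carrier_TG)

lemma carrier_F_generate: "carrier F = generate F (frag_of ` (carrier U \<times> carrier V))"
proof
  show "carrier F \<subseteq> generate F (frag_of ` (carrier U \<times> carrier V))"
  proof
    fix c assume "c \<in> carrier F"
    then have "Poly_Mapping.keys c \<subseteq> carrier U \<times> carrier V" by simp
    then have "c \<in> carrier F \<and> c \<in> generate F (frag_of ` (carrier U \<times> carrier V))"
    proof (induction rule: frag_induction)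
      case zero
      then show ?case using generate.one[of F] by simp
    next
      case (one p)
      then show ?case by (auto intro: generate.incl)
    next
      case (diff a b)
      have "inv\<^bsub>F\<^esub> b \<in> generate F (frag_of ` (carrier U \<times> carrier V))"
        by (rule F.generate_m_inv_closed) (use diff in auto)
      then have "a \<otimes>\<^bsub>F\<^esub> inv\<^bsub>F\<^esub> b \<in> generate F (frag_of ` (carrier U \<times> carrier V))"
        by (intro generate.eng) (use diff in auto)
      then show ?case using diff keys_minus_subset[of a _ b] by auto
    qed
    then show "c \<in> generate F (frag_of ` (carrier U \<times> carrier V))" ..
  qed
  show "generate F (frag_of ` (carrier U \<times> carrier V)) \<subseteq> carrier F"
    by (rule F.generate_incl) auto
qed

text \<open>The basis generates the free abelian group, and the projection to cosets is a
  homomorphism; hence pure tensors generate additively.\<close>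

lemma carrier_TG_generate:
  "carrier TG = generate (add_monoid TG) {el u v | u v. u \<in> carrier U \<and> v \<in> carrier V}"
proof -
  interpret group_hom F "add_monoid TG" cl
    using cl_hom by unfold_locales auto
  have "carrier TG = cl ` generate F (frag_of ` (carrier U \<times> carrier V))"
    using carrier_F_generate carrier_TG by simp
  also have "\<dots> = generate (add_monoid TG) (cl ` frag_of ` (carrier U \<times> carrier V))"
    by (rule generate_img[symmetric]) auto
  also have "cl ` frag_of ` (carrier U \<times> carrier V) = {el u v | u v. u \<in> carrier U \<and> v \<in> carrier V}"
    by (auto simp: elem_tensor_def)
  finally show ?thesis .
qed

text \<open>Homomorphisms that agree on a generating set agree. This is the device that reduces
  later identities between maps on a tensor product to pure tensors.\<close>

lemma tensor_hom_eq:
  assumes "abelian_group W" and h: "h \<in> hom (add_monoid TG) (add_monoid W)"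
    and k: "k \<in> hom (add_monoid TG) (add_monoid W)"
    and eq: "\<And>u v. \<lbrakk>u \<in> carrier U; v \<in> carrier V\<rbrakk> \<Longrightarrow> h (el u v) = k (el u v)"
    and Z: "Z \<in> carrier TG"
  shows "h Z = k Z"
proof -
  interpret W: abelian_group W by fact
  interpret h: group_hom "add_monoid TG" "add_monoid W" h
    using h by unfold_locales auto
  interpret k: group_hom "add_monoid TG" "add_monoid W" k
    using k by unfold_locales auto
  define E where "E = {el u v | u v. u \<in> carrier U \<and> v \<in> carrier V}"
  have E: "E \<subseteq> carrier TG"
    by (auto simp: E_def el_closed)
  have "Z \<in> generate (add_monoid TG) E"
    using Z carrier_TG_generate by (simp add: E_def)
  then show ?thesis
  proof induction
    case one
    then show ?case using h.hom_one k.hom_one by simp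
  next
    case (incl z)
    then show ?case using eq by (auto simp: E_def)
  next
    case (inv z)
    then have "h z = k z" using eq by (auto simp: E_def)
    then show ?case using h.hom_inv[of z] k.hom_inv[of z] inv E by auto
  next
    case (eng y z)
    then have "y \<in> carrier TG" "z \<in> carrier TG"
      using TG.add.generate_in_carrier[OF E] by simp_all
    then show ?case using eng h.hom_mult[of y z] k.hom_mult[of y z] by simp
  qed
qed

section \<open>Additive maps induced by balanced maps\<close>

context
  fixes W :: "('w, 'n) ring_scheme" and f :: "'u \<Rightarrow> 'v \<Rightarrow> 'w"
  assumes W: "abelian_group W" and bal: "balanced S U V W f"
begin

interpretation W: abelian_group W by (rule W)

lemma balancedD:
  "\<lbrakk>u \<in> carrier U; v \<in> carrier V\<rbrakk> \<Longrightarrow> f u v \<in> carrier W"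
  "\<lbrakk>u \<in> carrier U; u' \<in> carrier U; v \<in> carrier V\<rbrakk> \<Longrightarrow> f (u \<oplus>\<^bsub>U\<^esub> u') v = f u v \<oplus>\<^bsub>W\<^esub> f u' v"
  "\<lbrakk>u \<in> carrier U; v \<in> carrier V; v' \<in> carrier V\<rbrakk> \<Longrightarrow> f u (v \<oplus>\<^bsub>V\<^esub> v') = f u v \<oplus>\<^bsub>W\<^esub> f u v'"
  "\<lbrakk>u \<in> carrier U; s \<in> carrier S; v \<in> carrier V\<rbrakk> \<Longrightarrow> f (rsmult U u s) v = f u (s \<odot>\<^bsub>V\<^esub> v)"
  using bal by (simp_all add: balanced_def)

definition "free_lift c = (\<Oplus>\<^bsub>W\<^esub>p\<in>Poly_Mapping.keys c.
    [Poly_Mapping.lookup c p] \<cdot>\<^bsub>W\<^esub> f (fst p) (snd p))"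

lemma free_lift_hom: "free_lift \<in> hom F (add_monoid W)"
  and free_lift_frag_of:
    "\<lbrakk>u \<in> carrier U; v \<in> carrier V\<rbrakk> \<Longrightarrow> free_lift (frag_of (u, v)) = f u v"
proof -
  have "(\<lambda>p. f (fst p) (snd p)) \<in> carrier U \<times> carrier V \<rightarrow> carrier W"
    by (auto simp: balancedD)
  note * = W.hom_free_Abelian_group_finsum[OF this]
  show "free_lift \<in> hom F (add_monoid W)"
    using *(1) by (simp add: free_lift_def[abs_def] tensor_free_def)
  show "\<lbrakk>u \<in> carrier U; v \<in> carrier V\<rbrakk> \<Longrightarrow> free_lift (frag_of (u, v)) = f u v"
    using *(2)[of "(u, v)"] by (simp add: free_lift_def)
qed

lemma free_lift_diff:
  assumes "c \<in> carrier F" "d \<in> carrier F"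
  shows "free_lift (c - d) = free_lift c \<ominus>\<^bsub>W\<^esub> free_lift d"
proof -
  interpret group_hom F "add_monoid W" free_lift
    using free_lift_hom by unfold_locales auto
  have "free_lift (c \<otimes>\<^bsub>F\<^esub> inv\<^bsub>F\<^esub> d) = free_lift c \<oplus>\<^bsub>W\<^esub> inv\<^bsub>add_monoid W\<^esub> free_lift d"
    using assms hom_mult[of c "- d"] hom_inv[of d] by simp
  then show ?thesis using assms by (simp add: a_minus_def a_inv_def)
qed

text \<open>The kernel of \<open>free_lift\<close> is a subgroup, so only the generators have to be
  checked; on each family one balancing condition makes the value cancel.\<close>

lemma free_lift_relations: "n \<in> N \<Longrightarrow> free_lift n = \<zero>\<^bsub>W\<^esub>"
proof -
  interpret group_hom F "add_monoid W" free_lift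
    using free_lift_hom by unfold_locales auto
  have cancel: "a \<oplus>\<^bsub>W\<^esub> b \<ominus>\<^bsub>W\<^esub> a \<ominus>\<^bsub>W\<^esub> b = \<zero>\<^bsub>W\<^esub>" if "a \<in> carrier W" "b \<in> carrier W" for a b
    using that W.add.m_comm[of a b] by (simp add: a_minus_def W.a_assoc W.r_neg)
  have frag: "frag_of (u, v) \<in> carrier F" if "u \<in> carrier U" "v \<in> carrier V" for u v
    using that by simp
  have diff: "c - d \<in> carrier F" if "c \<in> carrier F" "d \<in> carrier F" for c d
    using that keys_minus_subset by simp
  have *: "free_lift r = \<zero>\<^bsub>W\<^esub>" if "r \<in> relators" for r
    using that
  proof (elim UnE CollectE exE conjE, goal_cases)
    case (1 u u' v)
    then show ?case
      by (simp add: free_lift_diff frag diff free_lift_frag_of balancedD cancel del: F_simps(1))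
  next
    case (2 u v v')
    then show ?case
      by (simp add: free_lift_diff frag diff free_lift_frag_of balancedD cancel del: F_simps(1))
  next
    case (3 u s v)
    then show ?case
      by (simp add: free_lift_diff frag free_lift_frag_of balancedD U.rsmult_closed
          V.smult_closed W.r_neg a_minus_def del: F_simps(1))
  qed
  have "relators \<subseteq> kernel F (add_monoid W) free_lift"
  proof
    fix r assume r: "r \<in> relators"
    then show "r \<in> kernel F (add_monoid W) free_lift"
      using *[OF r] subsetD[OF relators_closed r] by (simp only: kernel_def) simp
  qed
  then have "N \<subseteq> kernel F (add_monoid W) free_lift"
    unfolding tensor_relations_def by (rule F.generate_subgroup_incl[OF _ subgroup_kernel])
  then show "n \<in> N \<Longrightarrow> free_lift n = \<zero>\<^bsub>W\<^esub>"
    by (auto simp: kernel_def)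
qed

text \<open>\<open>tensor_lift\<close> takes \<open>the_elem\<close> of the image of a coset, which
  is meaningful only if that image is a singleton. The value is constant because relations go to
  zero, and the coset contains its representative.\<close>

lemma tensor_lift_cl:
  assumes c: "c \<in> carrier F"
  shows "tensor_lift W f (cl c) = free_lift c"
proof -
  have "free_lift ` cl c = {free_lift c}"
  proof -
    have "free_lift z = free_lift c" if z: "z \<in> cl c" for z
    proof -
      obtain n where n: "n \<in> N" "z = n + c" using z unfolding r_coset_def by auto
      then have "n \<in> carrier F" using subgroup.subset[OF N_subgroup] by blast
      then have "free_lift z = free_lift n \<oplus>\<^bsub>W\<^esub> free_lift c"
        using n c hom_mult[OF free_lift_hom, of n c] by simp
      then show ?thesis
        using free_lift_relations[OF n(1)] hom_in_carrier[OF free_lift_hom c] by simp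
    qed
    moreover have "c \<in> cl c" using F.rcos_self[OF c N_subgroup] .
    ultimately show ?thesis by blast
  qed
  then show ?thesis by (simp add: tensor_lift_def free_lift_def[abs_def])
qed

lemma tensor_lift_hom: "tensor_lift W f \<in> hom (add_monoid TG) (add_monoid W)"
proof (rule homI)
  fix X assume "X \<in> carrier (add_monoid TG)"
  then obtain c where c: "c \<in> carrier F" "X = cl c" by (auto simp: carrier_TG)
  then show "tensor_lift W f X \<in> carrier (add_monoid W)"
    using hom_in_carrier[OF free_lift_hom] tensor_lift_cl by metis
  fix Y assume "Y \<in> carrier (add_monoid TG)"
  then obtain d where d: "d \<in> carrier F" "Y = cl d" by (auto simp: carrier_TG)
  show "tensor_lift W f (X \<otimes>\<^bsub>add_monoid TG\<^esub> Y)
      = tensor_lift W f X \<otimes>\<^bsub>add_monoid W\<^esub> tensor_lift W f Y"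
    using c d hom_mult[OF free_lift_hom c(1) d(1)] F.m_closed[OF c(1) d(1)]
    by (simp only: F_simps(2) monoid.simps partial_object.simps cl_add tensor_lift_cl)
qed

lemma tensor_lift_elem:
  "\<lbrakk>u \<in> carrier U; v \<in> carrier V\<rbrakk> \<Longrightarrow> tensor_lift W f (el u v) = f u v"
  by (simp add: elem_tensor_def tensor_lift_cl free_lift_frag_of)

text \<open>This is the form in which it is later decided whether the maps of a Morita context hit
  the identity.\<close>

lemma tensor_lift_image:
  "tensor_lift W f ` carrier TG
    = generate (add_monoid W) {f u v | u v. u \<in> carrier U \<and> v \<in> carrier V}"
proof -
  interpret group_hom "add_monoid TG" "add_monoid W" "tensor_lift W f"
    using tensor_lift_hom by unfold_locales auto
  have "tensor_lift W f ` carrier TG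
    = generate (add_monoid W) (tensor_lift W f ` {el u v | u v. u \<in> carrier U \<and> v \<in> carrier V})"
    by (subst carrier_TG_generate, rule generate_img[symmetric]) (auto simp: el_closed)
  also have "tensor_lift W f ` {el u v | u v. u \<in> carrier U \<and> v \<in> carrier V}
      = {f u v | u v. u \<in> carrier U \<and> v \<in> carrier V}"
  proof (intro subset_antisym subsetI)
    fix w assume "w \<in> {f u v | u v. u \<in> carrier U \<and> v \<in> carrier V}"
    then obtain u v where "u \<in> carrier U" "v \<in> carrier V" "w = tensor_lift W f (el u v)"
      using tensor_lift_elem by auto
    then show "w \<in> tensor_lift W f ` {el u v | u v. u \<in> carrier U \<and> v \<in> carrier V}"
      by blast
  qed (use tensor_lift_elem in blast)
  finally show ?thesis .
qed

end

text \<open>Each required equation is one generator of \<open>tensor_relations\<close>: formal sums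
  whose difference is a generator have the same coset.\<close>

lemma balanced_elem_tensor: "balanced S U V TG el"
proof -
  have cl_eq: "cl c = cl d" if "c - d \<in> relators" "c \<in> carrier F" "d \<in> carrier F" for c d
  proof (rule F.repr_independence[OF _ that(3) N_subgroup, symmetric])
    have "c - d \<in> N" using that(1) unfolding tensor_relations_def by (rule generate.incl)
    then show "c \<in> cl d" unfolding r_coset_def by (auto intro!: bexI[of _ "c - d"])
  qed
  have plus: "Poly_Mapping.keys (c + d) \<subseteq> carrier U \<times> carrier V"
    if "c \<in> carrier F" "d \<in> carrier F" for c d :: "'u \<times> 'v \<Rightarrow>\<^sub>0 int"
    using F.m_closed[OF that] by simp
  have frag: "frag_of (u, v) \<in> carrier F" if "u \<in> carrier U" "v \<in> carrier V" for u v
    using that by simp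
  show ?thesis
    unfolding balanced_def
  proof (intro conjI ballI)
    fix u u' v assume uv: "u \<in> carrier U" "u' \<in> carrier U" "v \<in> carrier V"
    have "cl (frag_of (u \<oplus>\<^bsub>U\<^esub> u', v)) = cl (frag_of (u, v) + frag_of (u', v))"
      by (rule cl_eq) (use uv plus[OF frag frag] in \<open>auto simp: diff_diff_eq[symmetric]\<close>)
    then show "el (u \<oplus>\<^bsub>U\<^esub> u') v = el u v \<oplus>\<^bsub>TG\<^esub> el u' v"
      using uv by (simp only: elem_tensor_def cl_add frag)
  next
    fix u v v' assume uv: "u \<in> carrier U" "v \<in> carrier V" "v' \<in> carrier V"
    have "cl (frag_of (u, v \<oplus>\<^bsub>V\<^esub> v')) = cl (frag_of (u, v) + frag_of (u, v'))"
      by (rule cl_eq) (use uv plus[OF frag frag] in \<open>auto simp: diff_diff_eq[symmetric]\<close>)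
    then show "el u (v \<oplus>\<^bsub>V\<^esub> v') = el u v \<oplus>\<^bsub>TG\<^esub> el u v'"
      using uv by (simp only: elem_tensor_def cl_add frag)
  next
    fix u s v assume "u \<in> carrier U" "s \<in> carrier S" "v \<in> carrier V"
    then show "el (rsmult U u s) v = el u (s \<odot>\<^bsub>V\<^esub> v)"
      unfolding elem_tensor_def
      by (intro cl_eq) (auto simp: U.rsmult_closed V.smult_closed)
  qed (rule el_closed)
qed

lemma balanced_smult:
  "r \<in> carrier R \<Longrightarrow> balanced S U V TG (\<lambda>u v. el (r \<odot>\<^bsub>U\<^esub> u) v)"
  using balanced_elem_tensor
  by (auto simp: balanced_def U.smult_closed U.smult_r_distr U.smult_rsmult[symmetric])

lemma balanced_rsmult:
  "t \<in> carrier T \<Longrightarrow> balanced S U V TG (\<lambda>u v. el u (rsmult V v t))"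
  using balanced_elem_tensor
  by (auto simp: balanced_def V.rsmult_closed V.rsmult_l_distr V.smult_rsmult)

lemma smult_tensor_hom:
  "r \<in> carrier R \<Longrightarrow> smult (tensor S U V) r \<in> hom (add_monoid TG) (add_monoid TG)"
  using tensor_lift_hom[OF TG_abelian_group balanced_smult] by (simp add: tensor_def Let_def)

lemma smult_tensor_elem:
  "\<lbrakk>r \<in> carrier R; u \<in> carrier U; v \<in> carrier V\<rbrakk> \<Longrightarrow>
    smult (tensor S U V) r (el u v) = el (r \<odot>\<^bsub>U\<^esub> u) v"
  using tensor_lift_elem[OF TG_abelian_group balanced_smult] by (simp add: tensor_def Let_def)

lemma rsmult_tensor_hom:
  "t \<in> carrier T \<Longrightarrow> (\<lambda>Z. rsmult (tensor S U V) Z t) \<in> hom (add_monoid TG) (add_monoid TG)"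
  using tensor_lift_hom[OF TG_abelian_group balanced_rsmult] by (simp add: tensor_def Let_def)

lemma rsmult_tensor_elem:
  "\<lbrakk>t \<in> carrier T; u \<in> carrier U; v \<in> carrier V\<rbrakk> \<Longrightarrow>
    rsmult (tensor S U V) (el u v) t = el u (rsmult V v t)"
  using tensor_lift_elem[OF TG_abelian_group balanced_rsmult] by (simp add: tensor_def Let_def)

end

section \<open>Morita contexts given by balanced maps\<close>

lemma (in ring) mult_left_hom: "r \<in> carrier R \<Longrightarrow> (\<lambda>z. r \<otimes> z) \<in> hom (add_monoid R) (add_monoid R)"
  by (rule homI) (simp_all add: r_distr)

lemma (in ring) mult_right_hom: "r \<in> carrier R \<Longrightarrow> (\<lambda>z. z \<otimes> r) \<in> hom (add_monoid R) (add_monoid R)"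
  by (rule homI) (simp_all add: l_distr)

text \<open>Both sides of either linearity law are additive in the tensor, so it suffices to compare
  them on pure tensors.\<close>

lemma tensor_lift_bimodule_hom:
  assumes "tensor_product R S R U V" and bal: "balanced S U V R f"
    and l: "\<And>r u v. \<lbrakk>r \<in> carrier R; u \<in> carrier U; v \<in> carrier V\<rbrakk> \<Longrightarrow> f (r \<odot>\<^bsub>U\<^esub> u) v = r \<otimes>\<^bsub>R\<^esub> f u v"
    and r: "\<And>r u v. \<lbrakk>r \<in> carrier R; u \<in> carrier U; v \<in> carrier V\<rbrakk> \<Longrightarrow> f u (rsmult V v r) = f u v \<otimes>\<^bsub>R\<^esub> r"
  shows "tensor_lift R f \<in> bimodule_hom R R (tensor S U V) (regular_bimodule R)"
proof -
  interpret tensor_product R S R U V by fact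
  let ?\<mu> = "tensor_lift R f"
  have R: "ring R" by (rule U.R.ring_axioms)
  have ab: "abelian_group R" by (rule U.R.abelian_group_axioms)
  note hom = tensor_lift_hom[OF ab bal] and elem = tensor_lift_elem[OF ab bal]
  have "?\<mu> (smult (tensor S U V) a Z) = a \<otimes>\<^bsub>R\<^esub> ?\<mu> Z" if a: "a \<in> carrier R" and Z: "Z \<in> carrier TG" for a Z
  proof -
    have "(?\<mu> \<circ> smult (tensor S U V) a) Z = ((\<lambda>z. a \<otimes>\<^bsub>R\<^esub> z) \<circ> ?\<mu>) Z"
    proof (rule tensor_hom_eq[OF ab _ _ _ Z])
      show "?\<mu> \<circ> smult (tensor S U V) a \<in> hom (add_monoid TG) (add_monoid R)"
        by (rule Group.hom_compose[OF smult_tensor_hom[OF a] hom])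
      show "(\<lambda>z. a \<otimes>\<^bsub>R\<^esub> z) \<circ> ?\<mu> \<in> hom (add_monoid TG) (add_monoid R)"
        by (rule Group.hom_compose[OF hom ring.mult_left_hom[OF R a]])
    qed (simp add: a l elem smult_tensor_elem U.smult_closed)
    then show ?thesis by simp
  qed
  moreover have "?\<mu> (rsmult (tensor S U V) Z a) = ?\<mu> Z \<otimes>\<^bsub>R\<^esub> a" if a: "a \<in> carrier R" and Z: "Z \<in> carrier TG" for a Z
  proof -
    have "(?\<mu> \<circ> (\<lambda>Z. rsmult (tensor S U V) Z a)) Z = ((\<lambda>z. z \<otimes>\<^bsub>R\<^esub> a) \<circ> ?\<mu>) Z"
    proof (rule tensor_hom_eq[OF ab _ _ _ Z])
      show "?\<mu> \<circ> (\<lambda>Z. rsmult (tensor S U V) Z a) \<in> hom (add_monoid TG) (add_monoid R)"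
        by (rule Group.hom_compose[OF rsmult_tensor_hom[OF a] hom])
      show "(\<lambda>z. z \<otimes>\<^bsub>R\<^esub> a) \<circ> ?\<mu> \<in> hom (add_monoid TG) (add_monoid R)"
        by (rule Group.hom_compose[OF hom ring.mult_right_hom[OF R a]])
    qed (simp add: a r elem rsmult_tensor_elem V.rsmult_closed)
    then show ?thesis by simp
  qed
  ultimately show ?thesis
    using hom by (auto simp: bimodule_hom_def regular_bimodule_def hom_def)
qed

lemma morita_context_tensor_lift:
  assumes U: "bimodule R S U" and V: "bimodule S R V"
    and f: "balanced S U V R f" and g: "balanced R V U S g"
    and "\<And>r u v. \<lbrakk>r \<in> carrier R; u \<in> carrier U; v \<in> carrier V\<rbrakk> \<Longrightarrow> f (r \<odot>\<^bsub>U\<^esub> u) v = r \<otimes>\<^bsub>R\<^esub> f u v"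
    and "\<And>r u v. \<lbrakk>r \<in> carrier R; u \<in> carrier U; v \<in> carrier V\<rbrakk> \<Longrightarrow> f u (rsmult V v r) = f u v \<otimes>\<^bsub>R\<^esub> r"
    and "\<And>s v u. \<lbrakk>s \<in> carrier S; v \<in> carrier V; u \<in> carrier U\<rbrakk> \<Longrightarrow> g (s \<odot>\<^bsub>V\<^esub> v) u = s \<otimes>\<^bsub>S\<^esub> g v u"
    and "\<And>s v u. \<lbrakk>s \<in> carrier S; v \<in> carrier V; u \<in> carrier U\<rbrakk> \<Longrightarrow> g v (rsmult U u s) = g v u \<otimes>\<^bsub>S\<^esub> s"
    and "\<And>u v u'. \<lbrakk>u \<in> carrier U; v \<in> carrier V; u' \<in> carrier U\<rbrakk> \<Longrightarrow> rsmult U u (g v u') = f u v \<odot>\<^bsub>U\<^esub> u'"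
    and "\<And>v u v'. \<lbrakk>v \<in> carrier V; u \<in> carrier U; v' \<in> carrier V\<rbrakk> \<Longrightarrow> rsmult V v (f u v') = g v u \<odot>\<^bsub>V\<^esub> v'"
  shows "morita_context R S U V (tensor_lift R f) (tensor_lift S g)"
proof -
  interpret UV: tensor_product R S R U V using U V by (rule tensor_product.intro)
  interpret VU: tensor_product S R S V U using V U by (rule tensor_product.intro)
  show ?thesis
    by (intro morita_context.intro U V morita_context_axioms.intro
        tensor_lift_bimodule_hom UV.tensor_product_axioms VU.tensor_product_axioms)
      (simp_all add: assms UV.tensor_lift_elem[OF UV.U.R.abelian_group_axioms f]
        VU.tensor_lift_elem[OF UV.U.S.abelian_group_axioms g])
qed

text \<open>The axioms are symmetric in the two bimodules, so facts proved for \<open>\<mu>\<close>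
  transfer to \<open>\<nu>\<close>.\<close>

lemma (in morita_context) swap: "morita_context S R V U \<nu> \<mu>"
  by (intro morita_context.intro morita_context_axioms.intro)
    (use U.bimodule_axioms V.bimodule_axioms mu_hom nu_hom compat_U compat_V in simp_all)

text \<open>If \<open>\<mu> W = 1\<close>, then \<open>Z \<mapsto> \<mu> Z \<sqdot> W\<close> is the identity: it suffices to check this on
  \<open>u \<otimes> v\<close>, where \<open>\<mu> (u \<otimes> v) \<sqdot> W = (u \<otimes> v) \<sqdot> \<mu> W\<close> because both sides are additive in \<open>W\<close>.\<close>

lemma (in morita_context) mu_inj_on:
  assumes surj: "\<one>\<^bsub>R\<^esub> \<in> \<mu> ` carrier (tensor S U V)"
  shows "inj_on \<mu> (carrier (tensor S U V))"
proof -
  interpret UV: tensor_product R S R U V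
    using U.bimodule_axioms V.bimodule_axioms by (rule tensor_product.intro)
  interpret VU: tensor_product S R S V U
    using U.bimodule_axioms V.bimodule_axioms by (simp add: tensor_product.intro)
  let ?el = "elem_tensor S U V" and ?sm = "smult (tensor S U V)" and ?T = "add_monoid (tensor_group S U V)"
  note ab = UV.TG_abelian_group
  have mu: "\<mu> \<in> hom ?T (add_monoid R)"
    using mu_hom by (auto simp: bimodule_hom_def regular_bimodule_def hom_def)
  have nu_closed: "\<nu> Z \<in> carrier S" if "Z \<in> carrier (tensor R V U)" for Z
    using nu_hom that by (auto simp: bimodule_hom_def regular_bimodule_def)
  have mu_closed: "\<mu> Z \<in> carrier R" if "Z \<in> carrier UV.TG" for Z
    using hom_in_carrier[OF mu] that by simp
  note bal = UV.balancedD[OF ab UV.balanced_elem_tensor]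
  \<comment> \<open>Additivity in the scalar makes the map from \<open>Z\<close> to
    \<open>?sm (\<mu> Z) W\<close> additive, so that it can be compared with the identity on pure
    tensors.\<close>
  have sm_add: "?sm (r \<oplus>\<^bsub>R\<^esub> r') Z = ?sm r Z \<oplus>\<^bsub>UV.TG\<^esub> ?sm r' Z"
    if r: "r \<in> carrier R" "r' \<in> carrier R" and Z: "Z \<in> carrier UV.TG" for r r' Z
  proof -
    have "?sm (r \<oplus>\<^bsub>R\<^esub> r') Z = (\<lambda>Z. ?sm r Z \<oplus>\<^bsub>UV.TG\<^esub> ?sm r' Z) Z"
    proof (rule UV.tensor_hom_eq[OF ab _ _ _ Z])
      show "?sm (r \<oplus>\<^bsub>R\<^esub> r') \<in> hom ?T ?T"
        using r by (intro UV.smult_tensor_hom) simp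
      show "(\<lambda>Z. ?sm r Z \<oplus>\<^bsub>UV.TG\<^esub> ?sm r' Z) \<in> hom ?T ?T"
      proof (rule homI)
        fix X assume X: "X \<in> carrier ?T"
        note sm = hom_in_carrier[OF UV.smult_tensor_hom, simplified]
        show "?sm r X \<oplus>\<^bsub>UV.TG\<^esub> ?sm r' X \<in> carrier ?T"
          using r X by (simp add: sm)
        fix Y assume Y: "Y \<in> carrier ?T"
        show "?sm r (X \<otimes>\<^bsub>?T\<^esub> Y) \<oplus>\<^bsub>UV.TG\<^esub> ?sm r' (X \<otimes>\<^bsub>?T\<^esub> Y)
            = (?sm r X \<oplus>\<^bsub>UV.TG\<^esub> ?sm r' X) \<otimes>\<^bsub>?T\<^esub> (?sm r Y \<oplus>\<^bsub>UV.TG\<^esub> ?sm r' Y)"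
          using r X Y hom_mult[OF UV.smult_tensor_hom[OF r(1)], of X Y]
            hom_mult[OF UV.smult_tensor_hom[OF r(2)], of X Y]
          by (simp add: sm UV.TG.add.m_ac)
      qed
      fix u v assume "u \<in> carrier U" "v \<in> carrier V"
      then show "?sm (r \<oplus>\<^bsub>R\<^esub> r') (?el u v) = ?sm r (?el u v) \<oplus>\<^bsub>UV.TG\<^esub> ?sm r' (?el u v)"
        using r by (simp add: UV.smult_tensor_elem U.smult_l_distr U.smult_closed bal)
    qed
    then show ?thesis .
  qed
  have key: "?sm (\<mu> (?el u v)) W = ?el u (rsmult V v (\<mu> W))"
    if u: "u \<in> carrier U" and v: "v \<in> carrier V" and W: "W \<in> carrier UV.TG" for u v W
  proof (rule UV.tensor_hom_eq[OF ab _ _ _ W, of "?sm (\<mu> (?el u v))" "\<lambda>W. ?el u (rsmult V v (\<mu> W))"])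
    show "?sm (\<mu> (?el u v)) \<in> hom ?T ?T"
      using u v by (intro UV.smult_tensor_hom mu_closed UV.el_closed)
    show "(\<lambda>W. ?el u (rsmult V v (\<mu> W))) \<in> hom ?T ?T"
      using u v hom_mult[OF mu] by (intro homI) (simp_all add: UV.el_closed V.rsmult_closed mu_closed V.rsmult_r_distr bal)
    fix u' v' assume u': "u' \<in> carrier U" and v': "v' \<in> carrier V"
    have nu: "\<nu> (elem_tensor R V U v u') \<in> carrier S"
      using v u' by (intro nu_closed) (simp add: VU.el_closed)
    have "?sm (\<mu> (?el u v)) (?el u' v') = ?el (\<mu> (?el u v) \<odot>\<^bsub>U\<^esub> u') v'"
      using u v u' v' by (intro UV.smult_tensor_elem mu_closed UV.el_closed)
    also have "\<dots> = ?el (rsmult U u (\<nu> (elem_tensor R V U v u'))) v'"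
      using compat_U[OF u v u'] by simp
    also have "\<dots> = ?el u (\<nu> (elem_tensor R V U v u') \<odot>\<^bsub>V\<^esub> v')"
      using u v v' nu by (intro bal)
    also have "\<dots> = ?el u (rsmult V v (\<mu> (?el u' v')))"
      using compat_V[OF v u' v'] by simp
    finally show "?sm (\<mu> (?el u v)) (?el u' v') = ?el u (rsmult V v (\<mu> (?el u' v')))" .
  qed
  obtain W where W: "W \<in> carrier UV.TG" "\<mu> W = \<one>\<^bsub>R\<^esub>"
    using surj by auto
  have id: "?sm (\<mu> Z) W = Z" if Z: "Z \<in> carrier UV.TG" for Z
  proof (rule UV.tensor_hom_eq[OF ab _ _ _ Z, of "\<lambda>Z. ?sm (\<mu> Z) W" "\<lambda>Z. Z"])
    show "(\<lambda>Z. ?sm (\<mu> Z) W) \<in> hom ?T ?T"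
      using W hom_mult[OF mu] hom_in_carrier[OF UV.smult_tensor_hom, of _ W]
      by (intro homI) (simp_all add: mu_closed sm_add)
    show "(\<lambda>Z. Z) \<in> hom ?T ?T"
      by (rule homI) simp_all
  qed (simp add: key W V.rsmult_one)
  show ?thesis
    by (rule inj_on_inverseI[of _ "\<lambda>r. ?sm r W"]) (simp add: id)
qed

text \<open>If \<open>\<mu> W\<close> is the identity, left linearity exhibits every
  \<open>r\<close> as the value of \<open>\<mu>\<close> at \<open>r\<close> acting on
  \<open>W\<close>.\<close>

lemma (in morita_context) mu_surj:
  assumes surj: "\<one>\<^bsub>R\<^esub> \<in> \<mu> ` carrier (tensor S U V)"
  shows "\<mu> ` carrier (tensor S U V) = carrier R"
proof
  interpret UV: tensor_product R S R U V
    using U.bimodule_axioms V.bimodule_axioms by (rule tensor_product.intro)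
  show "\<mu> ` carrier (tensor S U V) \<subseteq> carrier R"
    using mu_hom by (auto simp: bimodule_hom_def regular_bimodule_def)
  show "carrier R \<subseteq> \<mu> ` carrier (tensor S U V)"
  proof
    fix r assume r: "r \<in> carrier R"
    obtain W where W: "W \<in> carrier UV.TG" "\<mu> W = \<one>\<^bsub>R\<^esub>"
      using surj by auto
    have "\<mu> (smult (tensor S U V) r W) = r"
      using mu_hom r W by (simp add: bimodule_hom_def regular_bimodule_def)
    moreover have "smult (tensor S U V) r W \<in> carrier UV.TG"
      using hom_in_carrier[OF UV.smult_tensor_hom[OF r]] W by simp
    ultimately show "r \<in> \<mu> ` carrier (tensor S U V)"
      by (metis image_eqI tensor_simps(1))
  qed
qed

lemma (in morita_context) strict_iff:
  "strict_morita_context R S U V \<mu> \<nu> \<longleftrightarrow>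
    \<one>\<^bsub>R\<^esub> \<in> \<mu> ` carrier (tensor S U V) \<and> \<one>\<^bsub>S\<^esub> \<in> \<nu> ` carrier (tensor R V U)"
proof -
  note swap_inj = morita_context.mu_inj_on[OF swap] and swap_surj = morita_context.mu_surj[OF swap]
  have "bij_betw \<mu> (carrier (tensor S U V)) (carrier R) \<longleftrightarrow> \<one>\<^bsub>R\<^esub> \<in> \<mu> ` carrier (tensor S U V)"
    using mu_inj_on mu_surj U.R.one_closed unfolding bij_betw_def by blast
  moreover have "bij_betw \<nu> (carrier (tensor R V U)) (carrier S) \<longleftrightarrow> \<one>\<^bsub>S\<^esub> \<in> \<nu> ` carrier (tensor R V U)"
    using swap_inj swap_surj U.S.one_closed unfolding bij_betw_def by blast
  moreover have "strict_morita_context R S U V \<mu> \<nu> \<longleftrightarrow>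
      bij_betw \<mu> (carrier (tensor S U V)) (carrier R) \<and> bij_betw \<nu> (carrier (tensor R V U)) (carrier S)"
    using morita_context_axioms
    by (simp add: strict_morita_context_def strict_morita_context_axioms_def)
  ultimately show ?thesis by simp
qed

section \<open>Groupoids\<close>

context groupoid
begin

lemma obj_simps [simp]: "y \<in> objs G \<Longrightarrow> y \<in> mor G" "y \<in> objs G \<Longrightarrow> src G y = y" "y \<in> objs G \<Longrightarrow> tgt G y = y"
  by (auto simp: objs_def)

declare src_obj [simp] tgt_obj [simp] cmp_mor [simp] src_cmp [simp] tgt_cmp [simp]
  cmp_src [simp] cmp_tgt [simp]

lemma is_inverse_unique:
  assumes g: "g \<in> mor G" and h: "is_inverse G g h" and k: "is_inverse G g k"
  shows "h = k"
proof -
  have "h = cmp G h (cmp G g k)"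
    using h k unfolding is_inverse_def by (metis cmp_src)
  also have "\<dots> = cmp G (cmp G h g) k"
    using g h k cmp_assoc[of h g k] by (simp add: is_inverse_def)
  also have "\<dots> = k"
    using h k unfolding is_inverse_def by (metis cmp_tgt)
  finally show ?thesis .
qed

lemma is_inverse_ginv: "g \<in> mor G \<Longrightarrow> is_inverse G g (ginv G g)"
  unfolding ginv_def using invertible is_inverse_unique by (metis theI)

lemma ginv_eqI: "\<lbrakk>g \<in> mor G; is_inverse G g h\<rbrakk> \<Longrightarrow> ginv G g = h"
  using is_inverse_ginv is_inverse_unique by blast

lemma ginv_simps [simp]:
  assumes "g \<in> mor G"
  shows "ginv G g \<in> mor G" "src G (ginv G g) = tgt G g" "tgt G (ginv G g) = src G g"
    "cmp G (ginv G g) g = src G g" "cmp G g (ginv G g) = tgt G g"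
  using is_inverse_ginv[OF assms] by (simp_all add: is_inverse_def)

lemma ginv_ginv [simp]: "g \<in> mor G \<Longrightarrow> ginv G (ginv G g) = g"
  by (rule ginv_eqI) (simp_all add: is_inverse_def)

lemma ginv_obj [simp]: "y \<in> objs G \<Longrightarrow> ginv G y = y"
  using cmp_src[of y] by (intro ginv_eqI) (simp_all add: is_inverse_def)

lemma cmp_ginv_cancel [simp]:
  "\<lbrakk>g \<in> mor G; h \<in> mor G; src G g = tgt G h\<rbrakk> \<Longrightarrow> cmp G (ginv G g) (cmp G g h) = h"
  "\<lbrakk>g \<in> mor G; h \<in> mor G; tgt G g = tgt G h\<rbrakk> \<Longrightarrow> cmp G g (cmp G (ginv G g) h) = h"
  by (simp_all add: cmp_assoc[symmetric])

lemma cmp_ginv_cancel_right [simp]: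
  "\<lbrakk>g \<in> mor G; h \<in> mor G; src G g = tgt G h\<rbrakk> \<Longrightarrow> cmp G (cmp G g h) (ginv G h) = g"
  "\<lbrakk>g \<in> mor G; h \<in> mor G; src G g = src G h\<rbrakk> \<Longrightarrow> cmp G (cmp G g (ginv G h)) h = g"
  by (simp_all add: cmp_assoc) (metis cmp_src)+

lemma ginv_cmp [simp]:
  "\<lbrakk>g \<in> mor G; h \<in> mor G; src G g = tgt G h\<rbrakk> \<Longrightarrow> ginv G (cmp G g h) = cmp G (ginv G h) (ginv G g)"
  by (rule ginv_eqI) (simp_all add: is_inverse_def cmp_assoc)

text \<open>Translations are bijections between the sets of morphisms with a prescribed target, or
  source; these two bijections reindex the sums in the trace and in the product of the skew
  ring.\<close>

lemma cmp_left_bij: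
  assumes "g \<in> mor G"
  shows "bij_betw (cmp G g) {h \<in> mor G. tgt G h = src G g} {k \<in> mor G. tgt G k = tgt G g}"
  by (rule bij_betw_byWitness[of _ "cmp G (ginv G g)"]) (use assms in auto)

lemma cmp_right_bij:
  assumes "g \<in> mor G"
  shows "bij_betw (\<lambda>h. cmp G h g) {h \<in> mor G. src G h = tgt G g} {k \<in> mor G. src G k = src G g}"
  by (rule bij_betw_byWitness[of _ "\<lambda>k. cmp G k (ginv G g)"]) (use assms in auto)

lemma ginv_bij: "bij_betw (ginv G) (mor G) (mor G)"
  by (rule bij_betw_byWitness[of _ "ginv G"]) auto

lemma isotropy_simps [simp]:
  "mor (isotropy G x) = hom_set G x x" "src (isotropy G x) = src G"
  "tgt (isotropy G x) = tgt G" "cmp (isotropy G x) = cmp G"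
  by (simp_all add: isotropy_def)

lemma objs_isotropy [simp]: "x \<in> objs G \<Longrightarrow> objs (isotropy G x) = {x}"
  unfolding objs_def[of "isotropy G x"] isotropy_simps hom_set_def using obj_simps[of x] by auto

lemma groupoid_isotropy: "x \<in> objs G \<Longrightarrow> groupoid (isotropy G x)"
proof -
  assume x: "x \<in> objs G"
  note unfolds = objs_isotropy[OF x] isotropy_simps hom_set_def mem_Collect_eq
  show ?thesis
  proof (intro groupoid.intro small_category.intro groupoid_axioms.intro; unfold unfolds)
    fix g assume g: "g \<in> mor G \<and> src G g = x \<and> tgt G g = x"
    then show "cmp G g (src G g) = g" "cmp G (tgt G g) g = g" "src G g \<in> {x}" "tgt G g \<in> {x}"
      using cmp_src[of g] cmp_tgt[of g] by auto
    have "is_inverse (isotropy G x) g (ginv G g)"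
      using g by (simp add: is_inverse_def hom_set_def)
    then show "\<exists>h. is_inverse (isotropy G x) g h" ..
  qed (auto simp: cmp_assoc)
qed

text \<open>\<open>ginv\<close> is a definite description in each groupoid separately, so agreement
  of the two inverses comes from uniqueness inside the isotropy group.\<close>

lemma ginv_isotropy:
  assumes "x \<in> objs G" "g \<in> hom_set G x x"
  shows "ginv (isotropy G x) g = ginv G g"
  using assms
  by (intro groupoid.ginv_eqI[OF groupoid_isotropy]) (simp_all add: is_inverse_def hom_set_def)

end

section \<open>Unital partial actions\<close>

lemma is_identity_unique: "\<lbrakk>is_identity J e; is_identity J f\<rbrakk> \<Longrightarrow> e = f"
  unfolding is_identity_def by metis

lemma one_of_eqI: "is_identity J e \<Longrightarrow> one_of J = e"
  unfolding one_of_def using is_identity_unique by blast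

lemma subrng_sum:
  assumes "subrng A" "\<And>i. i \<in> I \<Longrightarrow> f i \<in> A"
  shows "sum f I \<in> A"
  using assms(2) by (induction I rule: infinite_finite_induct) (use assms(1) in \<open>auto simp: subrng_def\<close>)

text \<open>The common setting of both contexts: it is instantiated with the whole groupoid acting
  on \<open>A\<close> and with the isotropy group acting on \<open>D x\<close>. That the identities
  are central in \<open>A\<close> and that \<open>A\<close> is unital is derived.\<close>

locale unital_partial_action = partial_action +
  assumes finite_mor: "finite (mor G)"
    and unital: "g \<in> mor G \<Longrightarrow> rng_unital (D g)"
    and direct_sum: "finite_direct_sum A (objs G) D"
begin

sublocale groupoid G
  by (rule groupoid)

abbreviation "e g \<equiv> one_of (D g)"
abbreviation "P \<equiv> pull G D \<alpha>"

lemma finite_objs [simp]: "finite (objs G)"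
  using finite_mor by (rule finite_subset[rotated]) auto

lemma A_closed [simp]:
  "0 \<in> A" "\<lbrakk>a \<in> A; b \<in> A\<rbrakk> \<Longrightarrow> a + b \<in> A" "\<lbrakk>a \<in> A; b \<in> A\<rbrakk> \<Longrightarrow> a * b \<in> A" "a \<in> A \<Longrightarrow> - a \<in> A"
  using rng by (simp_all add: subrng_def)

lemma A_sum [simp]: "(\<And>i. i \<in> I \<Longrightarrow> f i \<in> A) \<Longrightarrow> sum f I \<in> A"
  using rng by (rule subrng_sum)

section \<open>The identities of the ideals as central idempotents\<close>

lemma D_tgt: "\<lbrakk>g \<in> mor G; a \<in> D g\<rbrakk> \<Longrightarrow> a \<in> D (tgt G g)"
  using ideal_mor unfolding rng_ideal_def by blast

lemma D_A: "\<lbrakk>g \<in> mor G; a \<in> D g\<rbrakk> \<Longrightarrow> a \<in> A"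
  using ideal_tgt[of g] D_tgt unfolding rng_ideal_def by blast

lemma is_identity_e: "g \<in> mor G \<Longrightarrow> is_identity (D g) (e g)"
  using unital one_of_eqI by (metis rng_unital_def)

lemma e_D [simp]: "g \<in> mor G \<Longrightarrow> e g \<in> D g"
  using is_identity_e by (simp add: is_identity_def)

lemma e_A [simp]: "g \<in> mor G \<Longrightarrow> e g \<in> A"
  using D_A by simp

lemma D_e: "\<lbrakk>g \<in> mor G; a \<in> D g\<rbrakk> \<Longrightarrow> a * e g = a" "\<lbrakk>g \<in> mor G; a \<in> D g\<rbrakk> \<Longrightarrow> e g * a = a"
  using is_identity_e by (simp_all add: is_identity_def)

text \<open>An ideal of an ideal need not be an ideal of the ring. The identity of
  \<open>D g\<close> repairs this: \<open>a * b = (a * e g) * b\<close>, and \<open>a * e g\<close>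
  already lies in \<open>D (tgt G g)\<close>, in which \<open>D g\<close> is an ideal.\<close>

lemma D_ideal:
  assumes g: "g \<in> mor G" and a: "a \<in> A" and b: "b \<in> D g"
  shows "a * b \<in> D g" "b * a \<in> D g"
proof -
  have t: "a * e g \<in> D (tgt G g)" "e g * a \<in> D (tgt G g)"
    using ideal_tgt[OF g] D_tgt[OF g e_D[OF g]] a by (auto simp: rng_ideal_def)
  have "a * b = (a * e g) * b" "b * a = b * (e g * a)"
    using D_e[OF g b] by (metis mult.assoc)+
  then show "a * b \<in> D g" "b * a \<in> D g"
    using ideal_mor[OF g] t b by (auto simp: rng_ideal_def)
qed

text \<open>Both \<open>e g * a\<close> and \<open>a * e g\<close> lie in \<open>D g\<close>, where
  \<open>e g\<close> is neutral; hence both equal \<open>e g * a * e g\<close>.\<close>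

lemma e_central: "\<lbrakk>g \<in> mor G; a \<in> A\<rbrakk> \<Longrightarrow> e g * a = a * e g"
  using D_ideal[of g a "e g"] D_e[of g "a * e g"] D_e[of g "e g * a"] by (simp add: mult.assoc)

lemma e_idem: "g \<in> mor G \<Longrightarrow> e g * e g = e g"
  by (simp add: D_e)

lemma D_iff: "g \<in> mor G \<Longrightarrow> a \<in> D g \<longleftrightarrow> a \<in> A \<and> a * e g = a"
  using D_A D_e D_ideal e_D by metis

lemma e_tgt: "g \<in> mor G \<Longrightarrow> e g * e (tgt G g) = e g" "g \<in> mor G \<Longrightarrow> e (tgt G g) * e g = e g"
  using D_tgt D_e e_D by (metis tgt_obj obj_simps(1))+

lemma D_obj_Int:
  assumes y: "y \<in> objs G" and z: "z \<in> objs G" and "y \<noteq> z" and c: "c \<in> D y" "c \<in> D z"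
  shows "c = 0"
proof -
  have zero: "0 \<in> D w" if "w \<in> objs G" for w
    using that by (simp add: D_iff)
  \<comment> \<open>An element of two summands has two decompositions: it can be placed in
    coordinate \<open>y\<close> or in coordinate \<open>z\<close>. Uniqueness then forces it to be
    zero.\<close>
  define f where "f w = (\<lambda>v\<in>objs G. if v = w then c else 0)" for w
  have f: "f w \<in> (\<Pi>\<^sub>E v\<in>objs G. D v)" "(\<Sum>v\<in>objs G. f w v) = c" if "w = y \<or> w = z" for w
    using that y z c zero by (auto simp: f_def)
  have "c \<in> A" using D_A[of y] y c by simp
  then have "\<exists>!f. f \<in> (\<Pi>\<^sub>E v\<in>objs G. D v) \<and> c = (\<Sum>v\<in>objs G. f v)"
    using direct_sum by (simp add: finite_direct_sum_def)
  then have "f y = f z" using f[of y] f[of z] by (metis (no_types, lifting))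
  then have "f y y = f z y" by simp
  then show ?thesis using \<open>y \<noteq> z\<close> y by (simp add: f_def)
qed

lemma e_orth:
  assumes "g \<in> mor G" "h \<in> mor G" "tgt G g \<noteq> tgt G h"
  shows "e g * e h = 0"
proof (rule D_obj_Int[of "tgt G g" "tgt G h"])
  show "e g * e h \<in> D (tgt G g)" "e g * e h \<in> D (tgt G h)"
    using assms D_tgt[of g "e g"] D_tgt[of h "e h"] by (simp_all add: D_ideal)
qed (use assms in auto)

lemma orth:
  assumes "g \<in> mor G" "h \<in> mor G" "tgt G g \<noteq> tgt G h" "a \<in> D g" "b \<in> D h"
  shows "a * b = 0"
proof -
  have "a * b = (a * e g) * (e h * b)"
    using assms by (simp add: D_e)
  also have "\<dots> = a * (e g * e h) * b"
    by (simp add: mult.assoc)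
  finally show ?thesis using e_orth assms by simp
qed

text \<open>Multiplication by \<open>e z\<close> annihilates the summands other than
  \<open>D z\<close>, so it projects onto the component at \<open>z\<close>.\<close>

lemma sum_e:
  assumes a: "a \<in> A"
  shows "(\<Sum>y\<in>objs G. a * e y) = a"
proof -
  obtain f where f: "f \<in> (\<Pi>\<^sub>E y\<in>objs G. D y)" "a = (\<Sum>y\<in>objs G. f y)"
    using direct_sum a by (auto simp: finite_direct_sum_def)
  have fD: "f y \<in> D y" if "y \<in> objs G" for y using f(1) that by auto
  have "a * e z = f z" if z: "z \<in> objs G" for z
  proof -
    have "f y * e z = 0" if "y \<in> objs G" "y \<noteq> z" for y
      using that z by (intro orth[of y z] fD e_D) simp_all
    then have *: "f y * e z = (if y = z then f z else 0)" if "y \<in> objs G" for y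
      using that z fD D_e by simp
    have "a * e z = (\<Sum>y\<in>objs G. f y * e z)" by (simp add: f(2) sum_distrib_right)
    also have "\<dots> = (\<Sum>y\<in>objs G. if y = z then f z else 0)"
      by (rule sum.cong) (simp_all add: *)
    finally show ?thesis using z by simp
  qed
  then show ?thesis using f(2) by simp
qed

lemma sum_e_identity: "is_identity A (\<Sum>y\<in>objs G. e y)"
  using sum_e e_central
  by (simp add: is_identity_def sum_distrib_left sum_distrib_right cong: sum.cong)

lemma one_A: "one_of A = (\<Sum>y\<in>objs G. e y)"
  by (rule one_of_eqI[OF sum_e_identity])

lemma one_simps [simp]: "one_of A \<in> A" "a \<in> A \<Longrightarrow> one_of A * a = a" "a \<in> A \<Longrightarrow> a * one_of A = a"
  using sum_e_identity by (simp_all add: one_A is_identity_def)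

lemma alpha_simps:
  assumes "g \<in> mor G" "a \<in> D (ginv G g)"
  shows "b \<in> D (ginv G g) \<Longrightarrow> \<alpha> g (a + b) = \<alpha> g a + \<alpha> g b"
    "b \<in> D (ginv G g) \<Longrightarrow> \<alpha> g (a * b) = \<alpha> g a * \<alpha> g b" "\<alpha> g a \<in> D g"
  using iso[OF assms(1)] assms by (auto simp: rng_iso_def bij_betw_def)

lemma alpha_ginv:
  assumes g: "g \<in> mor G" and a: "a \<in> D (ginv G g)"
  shows "\<alpha> (ginv G g) (\<alpha> g a) = a"
proof -
  have s: "a \<in> D (src G g)" using D_tgt[of "ginv G g" a] g a by simp
  have "\<alpha> g a \<in> D (ginv G (ginv G g))" using g a alpha_simps(3) by simp
  from extends[OF _ g _ a this] have "\<alpha> (src G g) a = \<alpha> (ginv G g) (\<alpha> g a)"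
    using g by simp
  then show ?thesis using act_obj[of "src G g" a] g s by simp
qed

lemma alpha_e: "g \<in> mor G \<Longrightarrow> \<alpha> g (e (ginv G g)) = e g"
proof -
  assume g: "g \<in> mor G"
  have "is_identity (D g) (\<alpha> g (e (ginv G g)))"
    unfolding is_identity_def
  proof (intro conjI ballI)
    show "\<alpha> g (e (ginv G g)) \<in> D g" using g by (intro alpha_simps) auto
    fix a assume "a \<in> D g"
    then obtain b where b: "b \<in> D (ginv G g)" "a = \<alpha> g b"
      using iso[OF g] unfolding rng_iso_def bij_betw_def by blast
    then show "\<alpha> g (e (ginv G g)) * a = a" "a * \<alpha> g (e (ginv G g)) = a"
      using alpha_simps(2)[OF g, symmetric] g D_e by simp_all
  qed
  then show ?thesis by (simp add: one_of_eqI)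
qed

section \<open>Extension of the partial maps to total maps on the ring\<close>

lemma P_def: "P g a = \<alpha> g (a * e (ginv G g))"
  by (simp add: pull_def)

lemma P_D: "\<lbrakk>g \<in> mor G; a \<in> A\<rbrakk> \<Longrightarrow> P g a \<in> D g"
  by (simp add: P_def alpha_simps D_ideal)

lemma P_A [simp]: "\<lbrakk>g \<in> mor G; a \<in> A\<rbrakk> \<Longrightarrow> P g a \<in> A"
  using P_D D_A by blast

lemma P_alpha: "\<lbrakk>g \<in> mor G; a \<in> D (ginv G g)\<rbrakk> \<Longrightarrow> P g a = \<alpha> g a"
  by (simp add: P_def D_e)

lemma P_add: "\<lbrakk>g \<in> mor G; a \<in> A; b \<in> A\<rbrakk> \<Longrightarrow> P g (a + b) = P g a + P g b"
  by (simp add: P_def distrib_right alpha_simps D_ideal)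

text \<open>The identity of the domain is a central idempotent, so cutting down to the domain is
  multiplicative.\<close>

lemma P_mult: "\<lbrakk>g \<in> mor G; a \<in> A; b \<in> A\<rbrakk> \<Longrightarrow> P g (a * b) = P g a * P g b"
proof -
  assume g: "g \<in> mor G" and a: "a \<in> A" and b: "b \<in> A"
  have "a * b * e (ginv G g) = (a * e (ginv G g)) * (b * e (ginv G g))"
    using g b e_central[of "ginv G g" "b * e (ginv G g)"] by (simp add: mult.assoc e_idem)
  then show ?thesis using g a b by (simp add: P_def alpha_simps D_ideal)
qed

lemma P_zero [simp]: "g \<in> mor G \<Longrightarrow> P g 0 = 0"
  using P_add[of g 0 0] by simp

lemma P_minus: "\<lbrakk>g \<in> mor G; a \<in> A\<rbrakk> \<Longrightarrow> P g (- a) = - P g a"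
  using P_add[of g a "- a"] by (simp add: eq_neg_iff_add_eq_0 add.commute)

lemma P_sum: "\<lbrakk>g \<in> mor G; \<And>i. i \<in> I \<Longrightarrow> f i \<in> A\<rbrakk> \<Longrightarrow> P g (\<Sum>i\<in>I. f i) = (\<Sum>i\<in>I. P g (f i))"
  by (induction I rule: infinite_finite_induct) (simp_all add: P_add)

lemma P_e [simp]: "\<lbrakk>g \<in> mor G; a \<in> A\<rbrakk> \<Longrightarrow> P g a * e g = P g a" "\<lbrakk>g \<in> mor G; a \<in> A\<rbrakk> \<Longrightarrow> e g * P g a = P g a"
  using D_e P_D by blast+

lemma P_e_ginv [simp]:
  "\<lbrakk>g \<in> mor G; a \<in> A\<rbrakk> \<Longrightarrow> P g (a * e (ginv G g)) = P g a"
  "\<lbrakk>g \<in> mor G; a \<in> A\<rbrakk> \<Longrightarrow> P g (e (ginv G g) * a) = P g a"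
  using e_central[of "ginv G g" a] by (simp_all add: P_def mult.assoc e_idem)

lemma P_one: "g \<in> mor G \<Longrightarrow> P g (one_of A) = e g" and P_e_ginv_one: "g \<in> mor G \<Longrightarrow> P g (e (ginv G g)) = e g"
  by (simp_all add: P_def alpha_e e_idem)

lemma P_obj: "\<lbrakk>y \<in> objs G; a \<in> A\<rbrakk> \<Longrightarrow> P y a = a * e y"
  using D_ideal[of y a "e y"] by (simp add: P_def act_obj)

lemma P_ginv: "\<lbrakk>g \<in> mor G; a \<in> A\<rbrakk> \<Longrightarrow> P (ginv G g) (P g a) = a * e (ginv G g)"
  using P_alpha[of "ginv G g" "P g a"] P_D[of g a] by (simp add: P_def alpha_ginv D_ideal)

lemma P_ginv': "\<lbrakk>g \<in> mor G; a \<in> A\<rbrakk> \<Longrightarrow> P g (P (ginv G g) a) = a * e g"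
  using P_ginv[of "ginv G g" a] by simp

lemma P_P_orth:
  assumes "g \<in> mor G" "h \<in> mor G" "src G h \<noteq> tgt G g" "a \<in> A"
  shows "P h (P g a) = 0"
proof -
  have "P g a * e (ginv G h) = 0"
    using assms by (intro orth[of g "ginv G h"] P_D e_D) auto
  then have "P h (P g a * e (ginv G h)) = 0" using assms(2) by simp
  then show ?thesis using assms by simp
qed

text \<open>\<open>extends\<close> applies only where the composite of the two maps is defined.
  Arguments are therefore multiplied by an element \<open>w\<close> whose image under
  \<open>P g\<close> is \<open>p\<close>, the identity of \<open>D g \<inter> D (ginv G h)\<close>;
  multiplicativity then splits the contribution of \<open>w\<close> off as
  \<open>P h (e g)\<close>.\<close>

lemma P_P_aux:
  assumes g: "g \<in> mor G" and h: "h \<in> mor G" and s: "src G h = tgt G g" and a: "a \<in> A"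
  shows "P h (P g a) = P (cmp G h g) a * P h (e g)"
    and "P h (e g) * e (cmp G h g) = P h (e g)"
proof -
  define p where "p = e g * e (ginv G h)"
  define w where "w = P (ginv G g) p"
  have p: "p \<in> D g" "p \<in> D (ginv G h)" "p \<in> A"
    using D_ideal[OF g e_A[of "ginv G h"] e_D[OF g]] D_ideal[of "ginv G h" "e g" "e (ginv G h)"] g h
    by (simp_all add: p_def)
  have w: "w \<in> D (ginv G g)" "P g w = p" "w \<in> A"
    using g p P_D[of "ginv G g" p] P_ginv'[OF g, of p] by (simp_all add: w_def D_e)
  \<comment> \<open>Used twice: with \<open>one_of A\<close> it evaluates
    \<open>P (cmp G h g)\<close> at \<open>w\<close>, with the given element it yields the
    composition law.\<close>
  have *: "a * w \<in> D (ginv G (cmp G h g)) \<and> P (cmp G h g) (a * w) = P h (P g (a * w))" if a: "a \<in> A" for a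
  proof -
    have aw: "a * w \<in> D (ginv G g)" "a * w \<in> A" using D_ideal[OF _ a w(1)] g a w by simp_all
    have eq: "\<alpha> g (a * w) = P g a * p" using P_alpha[OF g aw(1)] P_mult[OF g a w(3)] w(2) by simp
    have pin: "P g a * p \<in> D (ginv G h)" using D_ideal[of "ginv G h" "P g a" p] g h a p by simp
    have "a * w \<in> D (ginv G (cmp G h g)) \<and> \<alpha> (cmp G h g) (a * w) = \<alpha> h (\<alpha> g (a * w))"
      using extends[OF h g s aw(1)] eq pin by simp
    then show ?thesis
      using P_alpha[of "cmp G h g" "a * w"] P_alpha[OF g aw(1)] P_alpha[OF h, of "P g a * p"] g h s eq pin by simp
  qed
  have "w \<in> D (ginv G (cmp G h g))" and Pw: "P (cmp G h g) w = P h p"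
    using *[of "one_of A"] w by simp_all
  have Php: "P h p = P h (e g)" using g h by (simp add: p_def)
  have "P h (P g a) = P h (P g a * p)"
    using g h a P_e(1)[OF g a] P_e_ginv(1)[OF h, of "P g a"]
    by (simp add: p_def mult.assoc[symmetric])
  also have "\<dots> = P h (P g (a * w))" using P_mult[OF g a w(3)] w(2) by simp
  also have "\<dots> = P (cmp G h g) (a * w)" using *[OF a] by simp
  also have "\<dots> = P (cmp G h g) a * P (cmp G h g) w" using P_mult g h s a w by simp
  finally show "P h (P g a) = P (cmp G h g) a * P h (e g)" using Pw Php by simp
  show "P h (e g) * e (cmp G h g) = P h (e g)"
    using Pw Php P_e(1)[of "cmp G h g" w] g h s w by simp
qed

text \<open>The standard identity \<open>\<alpha> h (D g \<inter> D (h\<inverse>)) = D h \<inter> D (hg)\<close> in terms of identities.\<close>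

lemma P_e_cmp:
  assumes g: "g \<in> mor G" and h: "h \<in> mor G" and s: "src G h = tgt G g"
  shows "P h (e g) = e h * e (cmp G h g)"
proof -
  let ?q = "e h * e (cmp G h g)"
  \<comment> \<open>This is the second part of \<open>P_P_aux\<close> for \<open>cmp G h g\<close>
    followed by \<open>ginv G h\<close>, whose composite is \<open>g\<close>. Transported by
    \<open>P h\<close> it says that \<open>?q\<close> absorbs \<open>P h (e g)\<close>; the opposite
    absorption is the same fact for \<open>g\<close> followed by \<open>h\<close>.\<close>
  have "P (ginv G h) (e (cmp G h g)) * e g = P (ginv G h) (e (cmp G h g))"
    using P_P_aux(2)[of "cmp G h g" "ginv G h" 0] g h s by simp
  then have "P h (P (ginv G h) (e (cmp G h g))) * P h (e g) = P h (P (ginv G h) (e (cmp G h g)))"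
    using P_mult[OF h, of "P (ginv G h) (e (cmp G h g))" "e g"] g h s by simp
  then have "?q * P h (e g) = ?q"
    using P_ginv'[OF h, of "e (cmp G h g)"] e_central[of h "e (cmp G h g)"] g h s by simp
  moreover have "?q * P h (e g) = P h (e g)"
    using P_P_aux(2)[OF g h s A_closed(1)] g h s e_central[of "cmp G h g" "P h (e g)"]
    by (simp add: mult.assoc)
  ultimately show ?thesis by simp
qed

text \<open>The identity in \<open>P_e_cmp\<close> evaluates the correction term of
  \<open>P_P_aux\<close>. What remains of partiality is the factor \<open>e h\<close>; together with
  \<open>P_P_orth\<close> this evaluates every double translate.\<close>

lemma P_P:
  assumes "g \<in> mor G" "h \<in> mor G" "src G h = tgt G g" "a \<in> A"
  shows "P h (P g a) = e h * P (cmp G h g) a"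
proof -
  have "P h (P g a) = (P (cmp G h g) a * e h) * e (cmp G h g)"
    using P_P_aux(1)[OF assms] P_e_cmp[OF assms(1-3)] by (simp add: mult.assoc)
  also have "P (cmp G h g) a * e h = e h * P (cmp G h g) a"
    using assms by (simp add: e_central)
  finally show ?thesis using assms by (simp add: mult.assoc)
qed

end

context unital_partial_action
begin

lemma sum_cmp_left:
  "g \<in> mor G \<Longrightarrow> (\<Sum>h\<in>{h\<in>mor G. tgt G h = src G g}. \<phi> h)
    = (\<Sum>m\<in>{m\<in>mor G. tgt G m = tgt G g}. \<phi> (cmp G (ginv G g) m))"
  using sum.reindex_bij_betw[OF cmp_left_bij[of "ginv G g"], of \<phi>] by simp

lemma sum_cmp_right:
  "g \<in> mor G \<Longrightarrow> (\<Sum>h\<in>{h\<in>mor G. src G h = src G g}. \<phi> h)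
    = (\<Sum>m\<in>{m\<in>mor G. src G m = tgt G g}. \<phi> (cmp G m g))"
  using sum.reindex_bij_betw[OF cmp_right_bij[of g], of \<phi>] by simp

lemma sum_restrict:
  assumes "\<And>g. \<lbrakk>g \<in> mor G; \<not> Q g\<rbrakk> \<Longrightarrow> \<phi> g = 0"
  shows "(\<Sum>g\<in>mor G. \<phi> g) = (\<Sum>g\<in>{g\<in>mor G. Q g}. \<phi> g)"
  by (rule sum.mono_neutral_right) (use assms finite_mor in auto)

lemma D_closed:
  assumes "g \<in> mor G"
  shows "0 \<in> D g" "\<lbrakk>a \<in> D g; b \<in> D g\<rbrakk> \<Longrightarrow> a + b \<in> D g" "a \<in> D g \<Longrightarrow> - a \<in> D g"
  using ideal_mor[OF assms] by (simp_all add: rng_ideal_def)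

lemma D_sum: "\<lbrakk>g \<in> mor G; \<And>i. i \<in> I \<Longrightarrow> f i \<in> D g\<rbrakk> \<Longrightarrow> sum f I \<in> D g"
  by (induction I rule: infinite_finite_induct) (auto simp: D_closed)

lemma P_e_mult: "\<lbrakk>g \<in> mor G; a \<in> A\<rbrakk> \<Longrightarrow> P g a * (e g * c) = P g a * c"
  by (simp add: mult.assoc[symmetric])

lemma P_D_cmp:
  assumes "g \<in> mor G" "h \<in> mor G" "src G g = tgt G h" "b \<in> D h"
  shows "P g b \<in> D (cmp G g h)"
proof -
  have b: "b \<in> A" using D_A assms by blast
  have "P g (P h (P (ginv G h) b)) \<in> D (cmp G g h)"
    using assms b P_P[of h g "P (ginv G h) b"] D_ideal(1)[OF _ _ P_D, of "cmp G g h" "e g" "P (ginv G h) b"]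
    by simp
  then show ?thesis using assms b by (simp add: P_ginv' D_e)
qed

text \<open>On the domain of \<open>\<alpha> k\<close> the factor \<open>e g\<close> of
  \<open>P_P\<close> disappears: expanding \<open>w\<close> as \<open>P (ginv G k) (P k w)\<close>
  and applying \<open>P_P\<close> twice shows that \<open>e g\<close> already fixes
  \<open>P (cmp G g k) w\<close>.\<close>

lemma P_cmp_e:
  assumes g: "g \<in> mor G" and k: "k \<in> mor G" and s: "src G g = tgt G k"
    and w: "w \<in> D (ginv G k)"
  shows "P g (P k w) = P (cmp G g k) w"
proof -
  have A: "w \<in> A" using D_A[of "ginv G k"] w k by simp
  have cm: "cmp G g k \<in> mor G" using g k s by simp
  let ?X = "P (cmp G g k) w"
  have "?X = P (cmp G g k) (P (ginv G k) (P k w))"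
    using A k w by (simp add: P_ginv D_e)
  also have "\<dots> = e (cmp G g k) * P g (P k w)"
    using g k s A P_P[of "ginv G k" "cmp G g k" "P k w"] by simp
  also have "\<dots> = e (cmp G g k) * (e g * ?X)"
    using g k s A by (simp add: P_P)
  also have "\<dots> = (e (cmp G g k) * e g) * ?X"
    by (simp add: mult.assoc)
  also have "e (cmp G g k) * e g = e g * e (cmp G g k)"
    using g k s by (intro e_central) simp_all
  also have "e g * e (cmp G g k) * ?X = e g * ?X"
    using P_e(2)[OF cm A] by (simp add: mult.assoc)
  finally have "?X = e g * ?X" .
  then show ?thesis by (rule trans[OF P_P[OF k g s A] sym])
qed

subsection \<open>The ring of invariants and the trace\<close>

abbreviation "R \<equiv> fixed_ring G A D \<alpha>"
abbreviation "S \<equiv> skew_ring G D \<alpha>"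
abbreviation "U \<equiv> fixed_skew_bimodule G A D \<alpha>"
abbreviation "V \<equiv> skew_fixed_bimodule G A D \<alpha>"
abbreviation "tr \<equiv> trace G D \<alpha>"

lemma R_simps [simp]:
  "mult R = (*)" "one R = one_of A" "zero R = 0" "add R = (+)"
  by (simp_all add: fixed_ring_def)

lemma R_iff: "a \<in> carrier R \<longleftrightarrow> a \<in> A \<and> (\<forall>g\<in>mor G. P g a = a * e g)"
  by (simp add: fixed_ring_def)

lemma R_A [simp]: "a \<in> carrier R \<Longrightarrow> a \<in> A"
  and R_P: "\<lbrakk>a \<in> carrier R; g \<in> mor G\<rbrakk> \<Longrightarrow> P g a = a * e g"
  by (simp_all add: R_iff)

lemma P_R_left: "\<lbrakk>g \<in> mor G; a \<in> carrier R; b \<in> A\<rbrakk> \<Longrightarrow> P g (a * b) = a * P g b"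
  by (simp add: P_mult R_P mult.assoc)

lemma P_R_right:
  assumes "g \<in> mor G" "a \<in> carrier R" "b \<in> A"
  shows "P g (b * a) = P g b * a"
proof -
  have "P g (b * a) = P g b * (e g * a)"
    using assms by (simp add: P_mult R_P e_central)
  then show ?thesis using assms by (simp add: mult.assoc[symmetric])
qed

lemma R_closed:
  "0 \<in> carrier R" "one_of A \<in> carrier R"
  "\<lbrakk>a \<in> carrier R; b \<in> carrier R\<rbrakk> \<Longrightarrow> a + b \<in> carrier R"
  "\<lbrakk>a \<in> carrier R; b \<in> carrier R\<rbrakk> \<Longrightarrow> a * b \<in> carrier R"
  "a \<in> carrier R \<Longrightarrow> - a \<in> carrier R"
proof -
  show "0 \<in> carrier R" "one_of A \<in> carrier R"
    by (simp_all add: R_iff P_one)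
  show "a + b \<in> carrier R" if "a \<in> carrier R" "b \<in> carrier R"
    using that by (simp add: R_iff P_add distrib_right)
  show "- a \<in> carrier R" if "a \<in> carrier R"
    using that by (simp add: R_iff P_minus)
  show "a * b \<in> carrier R" if "a \<in> carrier R" "b \<in> carrier R"
    using that by (simp add: R_iff[of "a * b"] P_R_left R_P[of b] mult.assoc)
qed

lemma ring_R: "ring R"
proof (rule ringI)
  show "abelian_group R"
  proof (rule abelian_groupI)
    fix a assume "a \<in> carrier R"
    then show "\<exists>b\<in>carrier R. b \<oplus>\<^bsub>R\<^esub> a = \<zero>\<^bsub>R\<^esub>"
      by (intro bexI[of _ "- a"]) (simp_all add: R_closed)
  qed (simp_all add: R_closed add_ac)
  show "monoid R"
    by (rule monoidI) (simp_all add: R_closed mult.assoc)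
qed (simp_all add: distrib_left distrib_right)

lemma tr_eq: "tr a = (\<Sum>g\<in>mor G. P g a)"
  by (simp add: trace_def)

lemma tr_add: "\<lbrakk>a \<in> A; b \<in> A\<rbrakk> \<Longrightarrow> tr (a + b) = tr a + tr b"
  by (simp add: tr_eq P_add sum.distrib)

lemma tr_sum: "(\<And>i. i \<in> I \<Longrightarrow> f i \<in> A) \<Longrightarrow> tr (\<Sum>i\<in>I. f i) = (\<Sum>i\<in>I. tr (f i))"
  by (simp add: tr_eq P_sum sum.swap[of _ I])

lemma tr_R_left: "\<lbrakk>a \<in> carrier R; b \<in> A\<rbrakk> \<Longrightarrow> tr (a * b) = a * tr b"
  by (simp add: tr_eq P_R_left sum_distrib_left)

lemma tr_R_right: "\<lbrakk>a \<in> carrier R; b \<in> A\<rbrakk> \<Longrightarrow> tr (b * a) = tr b * a"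
  by (simp add: tr_eq P_R_right sum_distrib_right)

text \<open>Left translation by \<open>h\<close> carries the morphisms with target
  \<open>src G h\<close> onto those with target \<open>tgt G h\<close>. The remaining terms of
  \<open>P h (tr a)\<close> vanish by non-composability, those of \<open>tr a * e h\<close> by
  orthogonality.\<close>

lemma tr_R: assumes a: "a \<in> A" shows "tr a \<in> carrier R"
proof -
  have "P h (tr a) = tr a * e h" if h: "h \<in> mor G" for h
  proof -
    have "P h (tr a) = (\<Sum>g\<in>mor G. P h (P g a))"
      using h a by (simp add: tr_eq P_sum)
    also have "\<dots> = (\<Sum>g\<in>{g\<in>mor G. tgt G g = src G h}. P h (P g a))"
      using h a by (intro sum_restrict) (metis P_P_orth)
    also have "\<dots> = (\<Sum>g\<in>{g\<in>mor G. tgt G g = src G h}. e h * P (cmp G h g) a)"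
      using h a by (intro sum.cong) (auto simp: P_P)
    also have "\<dots> = (\<Sum>m\<in>{m\<in>mor G. tgt G m = tgt G h}. e h * P m a)"
      using sum.reindex_bij_betw[OF cmp_left_bij[OF h], of "\<lambda>m. e h * P m a"] by simp
    also have "\<dots> = (\<Sum>m\<in>mor G. e h * P m a)"
      using h a orth[OF h _ _ e_D P_D] by (intro sum_restrict[symmetric]) (metis)
    also have "\<dots> = tr a * e h"
      using h a by (simp add: tr_eq sum_distrib_right e_central)
    finally show ?thesis .
  qed
  then show ?thesis using a by (simp add: R_iff tr_eq)
qed

text \<open>Right translation by \<open>k\<close> merely reindexes the sum, since morphisms whose
  source is not \<open>src G k\<close> kill \<open>w\<close>. This invariance makes the trace form
  balanced over the skew ring.\<close>

lemma tr_P: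
  assumes k: "k \<in> mor G" and w: "w \<in> D (ginv G k)"
  shows "tr (P k w) = tr w"
proof -
  have A: "w \<in> A" using D_A[of "ginv G k"] w k by simp
  have "tr (P k w) = (\<Sum>g\<in>{g\<in>mor G. src G g = tgt G k}. P g (P k w))"
    unfolding tr_eq using k A by (intro sum_restrict) (metis P_P_orth)
  also have "\<dots> = (\<Sum>g\<in>{g\<in>mor G. src G g = tgt G k}. P (cmp G g k) w)"
    using k w by (intro sum.cong) (auto simp: P_cmp_e)
  also have "\<dots> = (\<Sum>m\<in>{m\<in>mor G. src G m = src G k}. P m w)"
    by (rule sum_cmp_right[OF k, symmetric])
  also have "\<dots> = tr w"
    unfolding tr_eq
  proof (rule sum_restrict[symmetric])
    fix m assume m: "m \<in> mor G" "src G m \<noteq> src G k"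
    have "P m (P (ginv G k) (P k w)) = 0"
      using m k A by (intro P_P_orth) simp_all
    then show "P m w = 0" using k A w by (simp add: P_ginv D_e)
  qed
  finally show ?thesis .
qed

subsection \<open>The partial skew groupoid ring\<close>

lemma S_simps [simp]:
  "one S = (\<lambda>y. if y \<in> objs G then e y else 0)" "zero S = (\<lambda>g. 0)" "add S = (\<lambda>f f' g. f g + f' g)"
  by (simp_all add: skew_ring_def)

lemma S_iff: "f \<in> carrier S \<longleftrightarrow> (\<forall>g\<in>mor G. f g \<in> D g) \<and> (\<forall>g. g \<notin> mor G \<longrightarrow> f g = 0)"
  by (simp add: skew_ring_def)

lemma S_D: "\<lbrakk>f \<in> carrier S; g \<in> mor G\<rbrakk> \<Longrightarrow> f g \<in> D g"
  and S_zero: "\<lbrakk>f \<in> carrier S; g \<notin> mor G\<rbrakk> \<Longrightarrow> f g = 0"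
  by (simp_all add: S_iff)

lemma S_A [simp]: "f \<in> carrier S \<Longrightarrow> f g \<in> A"
  using S_D[of f g] D_A[of g "f g"] S_zero[of f g] by (cases "g \<in> mor G") simp_all

lemma S_eqI:
  assumes "f \<in> carrier S" "f' \<in> carrier S" "\<And>k. k \<in> mor G \<Longrightarrow> f k = f' k"
  shows "f = f'"
proof
  fix k show "f k = f' k" using assms by (cases "k \<in> mor G") (simp_all add: S_zero)
qed

abbreviation "fib k \<equiv> {g \<in> mor G. tgt G g = tgt G k}"

text \<open>A factorisation of \<open>k\<close> is determined by its left factor, which ranges over
  all morphisms with the target of \<open>k\<close>. The convolution thus becomes a sum over one
  morphism.\<close>

lemma S_mult:
  assumes k: "k \<in> mor G"
  shows "(f \<otimes>\<^bsub>S\<^esub> f') k = (\<Sum>g\<in>fib k. f g * P g (f' (cmp G (ginv G g) k)))"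
proof -
  have "(f \<otimes>\<^bsub>S\<^esub> f') k
      = (\<Sum>(g, h)\<in>{(g, h) \<in> mor G \<times> mor G. src G g = tgt G h \<and> cmp G g h = k}. f g * P g (f' h))"
    by (simp add: skew_ring_def)
  also have "\<dots> = (\<Sum>g\<in>fib k. f g * P g (f' (cmp G (ginv G g) k)))"
    by (rule sum.reindex_bij_witness[of _ "\<lambda>g. (g, cmp G (ginv G g) k)" fst]) (use k in auto)
  finally show ?thesis .
qed

lemma S_mult_outside: "k \<notin> mor G \<Longrightarrow> (f \<otimes>\<^bsub>S\<^esub> f') k = 0"
  by (auto simp: skew_ring_def intro!: sum.neutral)

lemma S_mult_closed:
  assumes f: "f \<in> carrier S" and f': "f' \<in> carrier S"
  shows "f \<otimes>\<^bsub>S\<^esub> f' \<in> carrier S"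
  unfolding S_iff
proof (intro conjI ballI allI impI)
  fix k assume k: "k \<in> mor G"
  have "f g * P g (f' (cmp G (ginv G g) k)) \<in> D k" if "g \<in> fib k" for g
    using that k P_D_cmp[of g "cmp G (ginv G g) k" "f' (cmp G (ginv G g) k)"] S_D[OF f']
    by (intro D_ideal S_A f) simp_all
  then show "(f \<otimes>\<^bsub>S\<^esub> f') k \<in> D k"
    unfolding S_mult[OF k] by (rule D_sum[OF k])
qed (rule S_mult_outside)

lemma S_closed:
  "\<zero>\<^bsub>S\<^esub> \<in> carrier S" "\<one>\<^bsub>S\<^esub> \<in> carrier S"
  "\<lbrakk>f \<in> carrier S; f' \<in> carrier S\<rbrakk> \<Longrightarrow> f \<oplus>\<^bsub>S\<^esub> f' \<in> carrier S"
  "f \<in> carrier S \<Longrightarrow> (\<lambda>g. - f g) \<in> carrier S"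
  by (auto simp: S_iff D_closed)

text \<open>Both sides are sums over \<open>g\<close> and \<open>m\<close> with target
  \<open>tgt G k\<close>, where \<open>g\<close> is the first factor and \<open>m\<close> the
  product of the first two. The composition law leaves an extra \<open>e g\<close>, which the
  preceding factor, a value of \<open>P g\<close>, absorbs.\<close>

lemma S_mult_assoc:
  assumes f: "f \<in> carrier S" and f': "f' \<in> carrier S" and f'': "f'' \<in> carrier S"
  shows "(f \<otimes>\<^bsub>S\<^esub> f') \<otimes>\<^bsub>S\<^esub> f'' = f \<otimes>\<^bsub>S\<^esub> (f' \<otimes>\<^bsub>S\<^esub> f'')"
proof (rule S_eqI)
  fix k assume k: "k \<in> mor G"
  let ?X = "\<lambda>g m. f g * P g (f' (cmp G (ginv G g) m)) * P m (f'' (cmp G (ginv G m) k))"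
  have "((f \<otimes>\<^bsub>S\<^esub> f') \<otimes>\<^bsub>S\<^esub> f'') k = (\<Sum>m\<in>fib k. \<Sum>g\<in>fib k. ?X g m)"
    unfolding S_mult[OF k] by (rule sum.cong) (auto simp: S_mult sum_distrib_right)
  also have "\<dots> = (\<Sum>g\<in>fib k. \<Sum>m\<in>fib k. ?X g m)"
    by (rule sum.swap)
  also have "\<dots> = (f \<otimes>\<^bsub>S\<^esub> (f' \<otimes>\<^bsub>S\<^esub> f'')) k"
    unfolding S_mult[OF k]
  proof (rule sum.cong[OF refl])
    fix g assume "g \<in> fib k"
    then have g: "g \<in> mor G" "tgt G g = tgt G k" by auto
    let ?l = "cmp G (ginv G g) k"
    have l: "?l \<in> mor G" "tgt G ?l = src G g" using g k by simp_all
    have "f g * P g ((f' \<otimes>\<^bsub>S\<^esub> f'') ?l)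
        = f g * (\<Sum>h\<in>{h\<in>mor G. tgt G h = src G g}. P g (f' h * P h (f'' (cmp G (ginv G h) ?l))))"
      unfolding S_mult[OF l(1)] l(2) using g f' f'' by (subst P_sum) auto
    also have "\<dots> = f g * (\<Sum>m\<in>fib g. P g (f' (cmp G (ginv G g) m)
        * P (cmp G (ginv G g) m) (f'' (cmp G (ginv G (cmp G (ginv G g) m)) ?l))))"
      by (simp only: sum_cmp_left[OF g(1)])
    also have "\<dots> = (\<Sum>m\<in>fib k. ?X g m)"
      unfolding sum_distrib_left g(2)
    proof (rule sum.cong[OF refl])
      fix m assume "m \<in> fib k"
      then have m: "m \<in> mor G" "tgt G m = tgt G k" by auto
      have "cmp G (ginv G (cmp G (ginv G g) m)) ?l = cmp G (ginv G m) k"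
        using g m k by (simp add: cmp_assoc)
      moreover have "P g (P (cmp G (ginv G g) m) c) = e g * P m c" if "c \<in> A" for c
        using g m that by (simp add: P_P)
      ultimately show "f g * P g (f' (cmp G (ginv G g) m)
          * P (cmp G (ginv G g) m) (f'' (cmp G (ginv G (cmp G (ginv G g) m)) ?l))) = ?X g m"
        using g m f' f'' by (simp add: P_mult P_e_mult mult.assoc)
    qed
    finally show "(\<Sum>m\<in>fib k. ?X g m) = f g * P g ((f' \<otimes>\<^bsub>S\<^esub> f'') ?l)" by simp
  qed
  finally show "((f \<otimes>\<^bsub>S\<^esub> f') \<otimes>\<^bsub>S\<^esub> f'') k = (f \<otimes>\<^bsub>S\<^esub> (f' \<otimes>\<^bsub>S\<^esub> f'')) k" .
qed (intro S_mult_closed f f' f'')+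

lemma S_mult_one:
  assumes f: "f \<in> carrier S"
  shows "\<one>\<^bsub>S\<^esub> \<otimes>\<^bsub>S\<^esub> f = f" "f \<otimes>\<^bsub>S\<^esub> \<one>\<^bsub>S\<^esub> = f"
proof -
  show "\<one>\<^bsub>S\<^esub> \<otimes>\<^bsub>S\<^esub> f = f"
  proof (rule S_eqI[OF S_mult_closed[OF S_closed(2) f] f])
    fix k assume k: "k \<in> mor G"
    have "(\<one>\<^bsub>S\<^esub> \<otimes>\<^bsub>S\<^esub> f) k = (\<Sum>g\<in>fib k. if g = tgt G k then f k else 0)"
      unfolding S_mult[OF k]
    proof (rule sum.cong[OF refl])
      fix g assume g: "g \<in> fib k"
      have *: "g \<in> objs G \<Longrightarrow> g = tgt G k" using g by auto
      have "e (tgt G k) * (f k * e (tgt G k)) = f k"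
        using D_tgt[OF k S_D[OF f k]] k by (simp add: D_e)
      then have "\<one>\<^bsub>S\<^esub> (tgt G k) * P (tgt G k) (f (cmp G (ginv G (tgt G k)) k)) = f k"
        using k P_obj[of "tgt G k" "f k"] S_A[OF f] by simp
      moreover have "g \<notin> objs G" if "g \<noteq> tgt G k" using * that by blast
      then have "\<one>\<^bsub>S\<^esub> g = 0" if "g \<noteq> tgt G k" using that by simp
      ultimately show "\<one>\<^bsub>S\<^esub> g * P g (f (cmp G (ginv G g) k)) = (if g = tgt G k then f k else 0)"
        by (cases "g = tgt G k") (simp_all del: S_simps)
    qed
    also have "\<dots> = f k"
      using k finite_mor by (subst sum.delta) auto
    finally show "(\<one>\<^bsub>S\<^esub> \<otimes>\<^bsub>S\<^esub> f) k = f k" .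
  qed
  show "f \<otimes>\<^bsub>S\<^esub> \<one>\<^bsub>S\<^esub> = f"
  proof (rule S_eqI[OF S_mult_closed[OF f S_closed(2)] f])
    fix k assume k: "k \<in> mor G"
    have "(f \<otimes>\<^bsub>S\<^esub> \<one>\<^bsub>S\<^esub>) k = (\<Sum>g\<in>fib k. if g = k then f k else 0)"
      unfolding S_mult[OF k]
    proof (rule sum.cong[OF refl])
      fix g assume "g \<in> fib k"
      then have g: "g \<in> mor G" "tgt G g = tgt G k" by auto
      have *: "g = k" if "cmp G (ginv G g) k \<in> objs G"
      proof -
        have "tgt G (cmp G (ginv G g) k) = src G g" using g k by simp
        then have "cmp G (ginv G g) k = src G g" using obj_simps(3)[OF that] by (rule trans[OF sym, rotated])
        then have "cmp G g (cmp G (ginv G g) k) = g" using g by simp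
        then show ?thesis using g k by simp
      qed
      have "P k (e (src G k)) = e k"
        using P_mult[OF k, of "e (src G k)" "e (ginv G k)"] e_tgt(2)[of "ginv G k"] P_e_ginv_one[OF k] k P_e_ginv(1)[OF k, of "e (src G k)"]
        by simp
      then have "f k * P k (\<one>\<^bsub>S\<^esub> (cmp G (ginv G k) k)) = f k"
        using k D_e(1)[OF k S_D[OF f k]] by simp
      moreover have "\<one>\<^bsub>S\<^esub> (cmp G (ginv G g) k) = 0" if "g \<noteq> k" using * that by auto
      ultimately show "f g * P g (\<one>\<^bsub>S\<^esub> (cmp G (ginv G g) k)) = (if g = k then f k else 0)"
        using g by (cases "g = k") (simp_all del: S_simps)
    qed
    also have "\<dots> = f k"
      using k finite_mor by (subst sum.delta) auto
    finally show "(f \<otimes>\<^bsub>S\<^esub> \<one>\<^bsub>S\<^esub>) k = f k" .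
  qed
qed

lemma S_distrib:
  assumes f: "f \<in> carrier S" and f': "f' \<in> carrier S" and f'': "f'' \<in> carrier S"
  shows "(f \<oplus>\<^bsub>S\<^esub> f') \<otimes>\<^bsub>S\<^esub> f'' = f \<otimes>\<^bsub>S\<^esub> f'' \<oplus>\<^bsub>S\<^esub> f' \<otimes>\<^bsub>S\<^esub> f''"
    "f'' \<otimes>\<^bsub>S\<^esub> (f \<oplus>\<^bsub>S\<^esub> f') = f'' \<otimes>\<^bsub>S\<^esub> f \<oplus>\<^bsub>S\<^esub> f'' \<otimes>\<^bsub>S\<^esub> f'"
proof -
  show "(f \<oplus>\<^bsub>S\<^esub> f') \<otimes>\<^bsub>S\<^esub> f'' = f \<otimes>\<^bsub>S\<^esub> f'' \<oplus>\<^bsub>S\<^esub> f' \<otimes>\<^bsub>S\<^esub> f''"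
  proof (rule S_eqI)
    fix k assume k: "k \<in> mor G"
    show "((f \<oplus>\<^bsub>S\<^esub> f') \<otimes>\<^bsub>S\<^esub> f'') k = (f \<otimes>\<^bsub>S\<^esub> f'' \<oplus>\<^bsub>S\<^esub> f' \<otimes>\<^bsub>S\<^esub> f'') k"
      using k by (simp add: S_mult distrib_right sum.distrib)
  qed (intro S_closed S_mult_closed f f' f'')+
  show "f'' \<otimes>\<^bsub>S\<^esub> (f \<oplus>\<^bsub>S\<^esub> f') = f'' \<otimes>\<^bsub>S\<^esub> f \<oplus>\<^bsub>S\<^esub> f'' \<otimes>\<^bsub>S\<^esub> f'"
  proof (rule S_eqI)
    fix k assume k: "k \<in> mor G"
    show "(f'' \<otimes>\<^bsub>S\<^esub> (f \<oplus>\<^bsub>S\<^esub> f')) k = (f'' \<otimes>\<^bsub>S\<^esub> f \<oplus>\<^bsub>S\<^esub> f'' \<otimes>\<^bsub>S\<^esub> f') k"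
      using k f f' by (simp add: S_mult P_add distrib_left sum.distrib)
  qed (intro S_closed S_mult_closed f f' f'')+
qed

lemma ring_S: "ring S"
proof (rule ringI)
  show "abelian_group S"
  proof (rule abelian_groupI)
    fix f assume "f \<in> carrier S"
    then show "\<exists>f'\<in>carrier S. f' \<oplus>\<^bsub>S\<^esub> f = \<zero>\<^bsub>S\<^esub>"
      by (intro bexI[of _ "\<lambda>g. - f g"]) (simp_all add: S_closed)
  qed (use S_closed in \<open>simp_all add: add_ac\<close>)
  show "monoid S"
    by (rule monoidI) (use S_closed S_mult_closed S_mult_assoc S_mult_one in \<open>simp_all\<close>)
qed (rule S_distrib; assumption)+

end

context unital_partial_action
begin

subsection \<open>The bimodules and the Morita context\<close>

lemma U_simps [simp]:
  "carrier U = A" "zero U = 0" "add U = (+)" "smult U = (*)"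
  "rsmult U = (\<lambda>b f. \<Sum>g\<in>mor G. \<alpha> (ginv G g) (b * f g))"
  by (simp_all add: fixed_skew_bimodule_def)

lemma V_simps [simp]:
  "carrier V = A" "zero V = 0" "add V = (+)" "rsmult V = (*)"
  "smult V = (\<lambda>f b. \<Sum>g\<in>mor G. f g * P g b)"
  by (simp_all add: skew_fixed_bimodule_def)

lemma abelian_group_A: "carrier M = A \<Longrightarrow> zero M = 0 \<Longrightarrow> add M = (+) \<Longrightarrow> abelian_group M"
proof (rule abelian_groupI)
  fix a assume "carrier M = A" "zero M = 0" "add M = (+)" "a \<in> carrier M"
  then show "\<exists>b\<in>carrier M. b \<oplus>\<^bsub>M\<^esub> a = \<zero>\<^bsub>M\<^esub>"
    by (intro bexI[of _ "- a"]) simp_all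
qed (simp_all add: add_ac)

text \<open>The product \<open>b * f g\<close> lies in \<open>D g\<close>, the domain of
  \<open>\<alpha> (ginv G g)\<close>. Hence the raw map of the definition can be replaced by the
  total one, which is additive on all of \<open>A\<close>.\<close>

lemma rsmult_U:
  assumes "b \<in> A" "f \<in> carrier S"
  shows "(\<Sum>g\<in>mor G. \<alpha> (ginv G g) (b * f g)) = (\<Sum>g\<in>mor G. P (ginv G g) (b * f g))"
  by (rule sum.cong) (use assms D_ideal S_D in \<open>simp_all add: P_alpha\<close>)

text \<open>Composable pairs are indexed by the left factor \<open>g\<close> and the product
  \<open>k\<close>, which share their target. Exchanging the sums and substituting
  \<open>cmp G g h\<close> for \<open>k\<close> gives the iterated action.\<close>

lemma smult_V_assoc:
  assumes f: "f \<in> carrier S" and f': "f' \<in> carrier S" and b: "b \<in> A"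
  shows "(\<Sum>k\<in>mor G. (f \<otimes>\<^bsub>S\<^esub> f') k * P k b) = (\<Sum>g\<in>mor G. f g * P g (\<Sum>h\<in>mor G. f' h * P h b))"
proof -
  let ?X = "\<lambda>g k. f g * P g (f' (cmp G (ginv G g) k)) * P k b"
  have "(\<Sum>k\<in>mor G. (f \<otimes>\<^bsub>S\<^esub> f') k * P k b) = (\<Sum>k\<in>mor G. \<Sum>g\<in>fib k. ?X g k)"
    by (rule sum.cong) (simp_all add: S_mult sum_distrib_right)
  also have "\<dots> = (\<Sum>k\<in>mor G. \<Sum>g\<in>mor G. if tgt G g = tgt G k then ?X g k else 0)"
    using finite_mor by (simp add: sum.inter_filter)
  also have "\<dots> = (\<Sum>g\<in>mor G. \<Sum>k\<in>mor G. if tgt G k = tgt G g then ?X g k else 0)"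
    by (subst sum.swap) (simp only: eq_commute)
  also have "\<dots> = (\<Sum>g\<in>mor G. \<Sum>k\<in>fib g. ?X g k)"
    using finite_mor by (simp add: sum.inter_filter)
  also have "\<dots> = (\<Sum>g\<in>mor G. f g * P g (\<Sum>h\<in>mor G. f' h * P h b))"
  proof (rule sum.cong[OF refl])
    fix g assume g: "g \<in> mor G"
    have "P g (\<Sum>h\<in>mor G. f' h * P h b) = (\<Sum>h\<in>mor G. P g (f' h) * P g (P h b))"
      using g f' b by (simp add: P_sum P_mult)
    also have "\<dots> = (\<Sum>h\<in>{h\<in>mor G. tgt G h = src G g}. P g (f' h) * P g (P h b))"
      using g b P_P_orth[of _ g b] by (intro sum_restrict) auto
    also have "\<dots> = (\<Sum>h\<in>{h\<in>mor G. tgt G h = src G g}. P g (f' h) * P (cmp G g h) b)"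
      using g f' b by (intro sum.cong) (auto simp: P_P P_e_mult)
    also have "\<dots> = (\<Sum>k\<in>fib g. P g (f' (cmp G (ginv G g) k)) * P k b)"
      unfolding sum_cmp_left[OF g] using g by (intro sum.cong) auto
    finally show "(\<Sum>k\<in>fib g. ?X g k) = f g * P g (\<Sum>h\<in>mor G. f' h * P h b)"
      by (simp add: sum_distrib_left mult.assoc)
  qed
  finally show ?thesis .
qed

lemma rsmult_U_assoc:
  assumes f: "f \<in> carrier S" and f': "f' \<in> carrier S" and b: "b \<in> A"
  shows "(\<Sum>k\<in>mor G. P (ginv G k) (b * (f \<otimes>\<^bsub>S\<^esub> f') k))
    = (\<Sum>h\<in>mor G. P (ginv G h) ((\<Sum>g\<in>mor G. P (ginv G g) (b * f g)) * f' h))"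
proof -
  let ?X = "\<lambda>g k. P (ginv G k) (b * (f g * P g (f' (cmp G (ginv G g) k))))"
  have "(\<Sum>k\<in>mor G. P (ginv G k) (b * (f \<otimes>\<^bsub>S\<^esub> f') k)) = (\<Sum>k\<in>mor G. \<Sum>g\<in>fib k. ?X g k)"
  proof (rule sum.cong[OF refl])
    fix k assume k: "k \<in> mor G"
    show "P (ginv G k) (b * (f \<otimes>\<^bsub>S\<^esub> f') k) = (\<Sum>g\<in>fib k. ?X g k)"
      unfolding S_mult[OF k] sum_distrib_left using k b f f' by (intro P_sum) auto
  qed
  also have "\<dots> = (\<Sum>k\<in>mor G. \<Sum>g\<in>mor G. if tgt G g = tgt G k then ?X g k else 0)"
    using finite_mor by (simp add: sum.inter_filter)
  also have "\<dots> = (\<Sum>g\<in>mor G. \<Sum>k\<in>mor G. if tgt G k = tgt G g then ?X g k else 0)"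
    by (subst sum.swap) (simp only: eq_commute)
  also have "\<dots> = (\<Sum>g\<in>mor G. \<Sum>k\<in>fib g. ?X g k)"
    using finite_mor by (simp add: sum.inter_filter)
  also have "\<dots> = (\<Sum>g\<in>mor G. \<Sum>h\<in>mor G. P (ginv G h) (P (ginv G g) (b * f g) * f' h))"
  proof (rule sum.cong[OF refl])
    fix g assume g: "g \<in> mor G"
    have "(\<Sum>h\<in>mor G. P (ginv G h) (P (ginv G g) (b * f g) * f' h))
        = (\<Sum>h\<in>mor G. P (ginv G h) (P (ginv G g) (b * f g)) * P (ginv G h) (f' h))"
      using g b f f' by (simp add: P_mult)
    also have "\<dots> = (\<Sum>h\<in>{h\<in>mor G. tgt G h = src G g}.
        P (ginv G h) (P (ginv G g) (b * f g)) * P (ginv G h) (f' h))"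
      using g b f P_P_orth[of "ginv G g" "ginv G _" "b * f g"] by (intro sum_restrict) auto
    also have "\<dots> = (\<Sum>h\<in>{h\<in>mor G. tgt G h = src G g}. ?X g (cmp G g h))"
    proof (rule sum.cong[OF refl])
      fix h assume "h \<in> {h\<in>mor G. tgt G h = src G g}"
      then have h: "h \<in> mor G" "tgt G h = src G g" by auto
      let ?k = "cmp G (ginv G h) (ginv G g)"
      have k: "?k \<in> mor G" using g h by simp
      have bf: "b * f g \<in> A" using b f by simp
      have "P (ginv G h) (P (ginv G g) (b * f g)) * P (ginv G h) (f' h)
          = e (ginv G h) * (P ?k (b * f g) * P (ginv G h) (f' h))"
        using g h bf by (simp add: P_P mult.assoc)
      \<comment> \<open>Two idempotents are traded: \<open>e (ginv G h)\<close> is absorbed by the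
        second factor, and \<open>e ?k\<close>, already contained in the first, is inserted so that
        the composition law for \<open>?k\<close> and \<open>g\<close> can be read
        backwards.\<close>
      also have "\<dots> = P ?k (b * f g) * (e (ginv G h) * P (ginv G h) (f' h))"
        using e_central[of "ginv G h" "P ?k (b * f g)"] k h bf by (simp add: mult.assoc[symmetric])
      also have "\<dots> = P ?k (b * f g) * (e ?k * P (ginv G h) (f' h))"
        using h f' k bf by (simp add: P_e_mult)
      also have "e ?k * P (ginv G h) (f' h) = P ?k (P g (f' h))"
        using g h f' P_P[of g ?k "f' h"] by simp
      finally show "P (ginv G h) (P (ginv G g) (b * f g)) * P (ginv G h) (f' h) = ?X g (cmp G g h)"
        using g h k b f f' by (simp add: P_mult mult.assoc)
    qed
    also have "\<dots> = (\<Sum>k\<in>fib g. ?X g k)"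
      unfolding sum_cmp_left[OF g] using g by (intro sum.cong) auto
    finally show "(\<Sum>k\<in>fib g. ?X g k)
        = (\<Sum>h\<in>mor G. P (ginv G h) (P (ginv G g) (b * f g) * f' h))" by simp
  qed
  also have "\<dots> = (\<Sum>h\<in>mor G. \<Sum>g\<in>mor G. P (ginv G h) (P (ginv G g) (b * f g) * f' h))"
    by (rule sum.swap)
  also have "\<dots> = (\<Sum>h\<in>mor G. P (ginv G h) ((\<Sum>g\<in>mor G. P (ginv G g) (b * f g)) * f' h))"
    using b f f' by (intro sum.cong) (simp_all add: sum_distrib_right P_sum)
  finally show ?thesis .
qed

lemma S_one_sum: "(\<Sum>g\<in>mor G. \<phi> g (\<one>\<^bsub>S\<^esub> g)) = (\<Sum>y\<in>objs G. \<phi> y (e y))"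
  if "\<And>g. g \<in> mor G \<Longrightarrow> \<phi> g 0 = 0"
  by (rule sum.mono_neutral_cong_right) (use finite_mor that in auto)

lemma S_add_apply: "(f \<oplus>\<^bsub>S\<^esub> f') g = f g + f' g"
  by simp

lemma left_module_U: "left_module R U"
  by (intro left_module.intro left_module_axioms.intro ring_R abelian_group_A)
    (simp_all add: distrib_left distrib_right mult.assoc)

lemma left_module_V: "left_module S V"
proof (intro left_module.intro left_module_axioms.intro ring_S abelian_group_A)
  fix f f' b b' assume f: "f \<in> carrier S" and f': "f' \<in> carrier S" and b: "b \<in> carrier V" and b': "b' \<in> carrier V"
  show "f \<odot>\<^bsub>V\<^esub> b \<in> carrier V" using f b by simp
  show "(f \<oplus>\<^bsub>S\<^esub> f') \<odot>\<^bsub>V\<^esub> b = f \<odot>\<^bsub>V\<^esub> b \<oplus>\<^bsub>V\<^esub> f' \<odot>\<^bsub>V\<^esub> b"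
    by (simp add: distrib_right sum.distrib)
  show "f \<odot>\<^bsub>V\<^esub> (b \<oplus>\<^bsub>V\<^esub> b') = f \<odot>\<^bsub>V\<^esub> b \<oplus>\<^bsub>V\<^esub> f \<odot>\<^bsub>V\<^esub> b'"
    using b b' by (simp add: P_add distrib_left sum.distrib)
  show "(f \<otimes>\<^bsub>S\<^esub> f') \<odot>\<^bsub>V\<^esub> b = f \<odot>\<^bsub>V\<^esub> (f' \<odot>\<^bsub>V\<^esub> b)"
    using smult_V_assoc[OF f f', of b] b by simp
next
  fix b assume b: "b \<in> carrier V"
  have "\<one>\<^bsub>S\<^esub> \<odot>\<^bsub>V\<^esub> b = (\<Sum>y\<in>objs G. e y * P y b)"
    using S_one_sum[of "\<lambda>g c. c * P g b"] by simp
  also have "\<dots> = (\<Sum>y\<in>objs G. b * e y)"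
    using b by (intro sum.cong) (simp_all add: P_obj[symmetric])
  also have "\<dots> = b" using b by (simp add: sum_e)
  finally show "\<one>\<^bsub>S\<^esub> \<odot>\<^bsub>V\<^esub> b = b" .
qed simp_all

lemma bimodule_U: "bimodule R S U"
proof (intro bimodule.intro bimodule_axioms.intro left_module_U ring_S)
  note S_simps [simp del]
  have closed: "(\<Sum>g\<in>mor G. P (ginv G g) (b * f g)) \<in> A" if "b \<in> A" "f \<in> carrier S" for b f
    using that by simp
  fix f f' b b' assume f: "f \<in> carrier S" and f': "f' \<in> carrier S" and b: "b \<in> carrier U" and b': "b' \<in> carrier U"
  show "rsmult U b f \<in> carrier U" using f b by (simp add: rsmult_U)
  show "rsmult U (b \<oplus>\<^bsub>U\<^esub> b') f = rsmult U b f \<oplus>\<^bsub>U\<^esub> rsmult U b' f"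
    using f b b' by (simp add: rsmult_U) (simp add: distrib_right P_add sum.distrib)
  show "rsmult U b (f \<oplus>\<^bsub>S\<^esub> f') = rsmult U b f \<oplus>\<^bsub>U\<^esub> rsmult U b f'"
    using f f' S_closed(3)[OF f f'] b
    by (simp add: rsmult_U) (simp add: S_add_apply distrib_left P_add sum.distrib)
  show "rsmult U b (f \<otimes>\<^bsub>S\<^esub> f') = rsmult U (rsmult U b f) f'"
    using f f' b closed[of b f] rsmult_U_assoc[OF f f'] by (simp add: rsmult_U S_mult_closed)
next
  fix f b a assume f: "f \<in> carrier S" and b: "b \<in> carrier U" and a: "a \<in> carrier R"
  show "rsmult U (a \<odot>\<^bsub>U\<^esub> b) f = a \<odot>\<^bsub>U\<^esub> rsmult U b f"
    using a f b by (simp add: rsmult_U) (simp add: mult.assoc P_R_left sum_distrib_left)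
next
  fix b assume b: "b \<in> carrier U"
  have "rsmult U b \<one>\<^bsub>S\<^esub> = (\<Sum>g\<in>mor G. P (ginv G g) (b * \<one>\<^bsub>S\<^esub> g))"
    using rsmult_U[of b "\<one>\<^bsub>S\<^esub>"] b S_closed(2) by simp
  also have "\<dots> = (\<Sum>y\<in>objs G. P (ginv G y) (b * e y))"
    by (rule S_one_sum) simp
  also have "\<dots> = b" using b by (simp add: P_obj mult.assoc e_idem sum_e)
  finally show "rsmult U b \<one>\<^bsub>S\<^esub> = b" .
qed

lemma bimodule_V: "bimodule S R V"
proof (intro bimodule.intro bimodule_axioms.intro left_module_V ring_R)
  fix f b a assume "f \<in> carrier S" and b: "b \<in> carrier V" and a: "a \<in> carrier R"
  show "rsmult V (f \<odot>\<^bsub>V\<^esub> b) a = f \<odot>\<^bsub>V\<^esub> rsmult V b a"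
    using a b by (simp add: P_R_right sum_distrib_right mult.assoc)
qed (simp_all add: distrib_left distrib_right mult.assoc)

abbreviation "gam \<equiv> \<lambda>a b. tr (a * b)"
abbreviation "gam' \<equiv> \<lambda>a b g. if g \<in> mor G then a * P g b else 0"

lemma gam'_S: "\<lbrakk>a \<in> A; b \<in> A\<rbrakk> \<Longrightarrow> gam' a b \<in> carrier S"
  by (simp add: S_iff D_ideal P_D)

text \<open>It holds term by term: since \<open>P (ginv G g)\<close> sends \<open>P g c\<close> back
  to \<open>c\<close> up to an idempotent, the summand of one side is the translate along
  \<open>ginv G g\<close> of the summand of the other, and the trace does not see
  translates.\<close>

lemma balanced_gam: "balanced S U V R gam"
proof -
  have "tr ((\<Sum>g\<in>mor G. P (ginv G g) (b * f g)) * c) = tr (b * (\<Sum>g\<in>mor G. f g * P g c))"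
    if b: "b \<in> A" and f: "f \<in> carrier S" and c: "c \<in> A" for b f c
  proof -
    have "tr ((\<Sum>g\<in>mor G. P (ginv G g) (b * f g)) * c) = (\<Sum>g\<in>mor G. tr (P (ginv G g) (b * f g) * c))"
      using b f c by (simp add: sum_distrib_right tr_sum)
    also have "\<dots> = (\<Sum>g\<in>mor G. tr (b * (f g * P g c)))"
    proof (rule sum.cong[OF refl])
      fix g assume g: "g \<in> mor G"
      let ?z = "b * (f g * P g c)"
      have "?z \<in> D g"
        using D_ideal(1)[OF g b D_ideal(2)[OF g _ S_D[OF f g]]] g c by simp
      then have "tr (P (ginv G g) ?z) = tr ?z"
        using tr_P[of "ginv G g" ?z] g by simp
      moreover have "P (ginv G g) ?z = P (ginv G g) (b * f g) * c"
      proof -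
        have "P (ginv G g) ?z = P (ginv G g) (b * f g) * (c * e (ginv G g))"
          using g b f c P_mult[of "ginv G g" "b * f g" "P g c"] by (simp add: P_ginv mult.assoc)
        also have "c * e (ginv G g) = e (ginv G g) * c"
          using g c by (simp add: e_central)
        finally show ?thesis using g b f by (simp add: P_e_mult)
      qed
      ultimately show "tr (P (ginv G g) (b * f g) * c) = tr ?z" by simp
    qed
    also have "\<dots> = tr (b * (\<Sum>g\<in>mor G. f g * P g c))"
      using b f c by (simp add: sum_distrib_left tr_sum)
    finally show ?thesis .
  qed
  then show ?thesis
    unfolding balanced_def by (simp add: tr_R distrib_left distrib_right tr_add rsmult_U)
qed

lemma balanced_gam': "balanced R V U S gam'"
  unfolding balanced_def
  by (auto simp: gam'_S distrib_left distrib_right P_add fun_eq_iff P_R_left mult.assoc)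

lemma gam'_smult:
  assumes f: "f \<in> carrier S" and a: "a \<in> A" and b: "b \<in> A"
  shows "gam' (\<Sum>g\<in>mor G. f g * P g a) b = f \<otimes>\<^bsub>S\<^esub> gam' a b"
proof (rule S_eqI)
  show "gam' (\<Sum>g\<in>mor G. f g * P g a) b \<in> carrier S"
    using f a b by (intro gam'_S) simp_all
  show "f \<otimes>\<^bsub>S\<^esub> gam' a b \<in> carrier S"
    using f a b by (intro S_mult_closed gam'_S)
  fix k assume k: "k \<in> mor G"
  have "gam' (\<Sum>g\<in>mor G. f g * P g a) b k = (\<Sum>g\<in>mor G. f g * P g a * P k b)"
    using k by (simp add: sum_distrib_right)
  also have "\<dots> = (\<Sum>g\<in>fib k. f g * P g a * P k b)"
    using k f a b by (intro sum_restrict) (simp add: mult.assoc orth P_D)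
  also have "\<dots> = (f \<otimes>\<^bsub>S\<^esub> gam' a b) k"
    unfolding S_mult[OF k]
  proof (rule sum.cong[OF refl])
    fix g assume "g \<in> fib k"
    then have g: "g \<in> mor G" "tgt G g = tgt G k" by auto
    have "P g (P (cmp G (ginv G g) k) b) = e g * P k b"
      using P_P[of "cmp G (ginv G g) k" g b] g k b by simp
    then show "f g * P g a * P k b = f g * P g (gam' a b (cmp G (ginv G g) k))"
      using g k a b by (simp add: P_mult P_e_mult mult.assoc)
  qed
  finally show "gam' (\<Sum>g\<in>mor G. f g * P g a) b k = (f \<otimes>\<^bsub>S\<^esub> gam' a b) k" .
qed

lemma gam'_rsmult:
  assumes f: "f \<in> carrier S" and a: "a \<in> A" and b: "b \<in> A"
  shows "gam' a (\<Sum>g\<in>mor G. P (ginv G g) (b * f g)) = gam' a b \<otimes>\<^bsub>S\<^esub> f"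
proof (rule S_eqI)
  show "gam' a (\<Sum>g\<in>mor G. P (ginv G g) (b * f g)) \<in> carrier S"
    using f a b by (intro gam'_S) simp_all
  show "gam' a b \<otimes>\<^bsub>S\<^esub> f \<in> carrier S"
    using f a b by (intro S_mult_closed gam'_S)
  fix k assume k: "k \<in> mor G"
  have "gam' a (\<Sum>g\<in>mor G. P (ginv G g) (b * f g)) k = a * (\<Sum>g\<in>mor G. P k (P (ginv G g) (b * f g)))"
    using k b f by (simp add: P_sum)
  also have "(\<Sum>g\<in>mor G. P k (P (ginv G g) (b * f g)))
      = (\<Sum>g\<in>{g\<in>mor G. src G g = src G k}. P k (P (ginv G g) (b * f g)))"
    using k b f by (intro sum_restrict P_P_orth) simp_all
  \<comment> \<open>Substitution of \<open>cmp G k (ginv G g)\<close> for \<open>m\<close>. Since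
    \<open>b * f g\<close> lies in \<open>D g\<close>, composing the two maps leaves no idempotent
    factor behind.\<close>
  also have "\<dots> = (\<Sum>m\<in>fib k. P m (b * f (cmp G (ginv G m) k)))"
  proof (rule sum.reindex_bij_witness[of _ "\<lambda>m. cmp G (ginv G m) k" "\<lambda>g. cmp G k (ginv G g)"])
    fix g assume "g \<in> {g\<in>mor G. src G g = src G k}"
    then have g: "g \<in> mor G" "src G g = src G k" by auto
    show "cmp G (ginv G (cmp G k (ginv G g))) k = g"
      using g k by (simp add: cmp_assoc) (metis cmp_src)
    show "cmp G k (ginv G g) \<in> fib k" using g k by simp
    have "b * f g \<in> D (ginv G (ginv G g))"
      using D_ideal(1)[OF g(1) b S_D[OF f g(1)]] g by simp
    then have "P k (P (ginv G g) (b * f g)) = P (cmp G k (ginv G g)) (b * f g)"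
      using g k by (intro P_cmp_e) simp_all
    moreover have "cmp G (ginv G (cmp G k (ginv G g))) k = g" by fact
    ultimately show "P (cmp G k (ginv G g)) (b * f (cmp G (ginv G (cmp G k (ginv G g))) k))
        = P k (P (ginv G g) (b * f g))" by simp
  next
    fix m assume m: "m \<in> fib k"
    then show "cmp G k (ginv G (cmp G (ginv G m) k)) = m"
      using k by (simp add: cmp_assoc[symmetric]) (metis cmp_tgt)
    show "cmp G (ginv G m) k \<in> {g\<in>mor G. src G g = src G k}" using m k by simp
  qed
  also have "a * \<dots> = (gam' a b \<otimes>\<^bsub>S\<^esub> f) k"
    unfolding S_mult[OF k] sum_distrib_left
    using b f by (intro sum.cong) (auto simp: P_mult mult.assoc)
  finally show "gam' a (\<Sum>g\<in>mor G. P (ginv G g) (b * f g)) k = (gam' a b \<otimes>\<^bsub>S\<^esub> f) k" .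
qed

lemma morita_context: "morita_context R S U V (Gamma_map G A D \<alpha>) (Gamma_map' G D \<alpha>)"
  unfolding Gamma_map_def Gamma_map'_def
proof (rule morita_context_tensor_lift[OF bimodule_U bimodule_V balanced_gam balanced_gam'])
  fix r u v assume "r \<in> carrier R" "u \<in> carrier U" "v \<in> carrier V"
  then show "gam (r \<odot>\<^bsub>U\<^esub> u) v = r \<otimes>\<^bsub>R\<^esub> gam u v" "gam u (rsmult V v r) = gam u v \<otimes>\<^bsub>R\<^esub> r"
    by (simp_all add: tr_R_left tr_R_right mult.assoc) (simp add: tr_R_right mult.assoc[symmetric])
next
  fix s v u assume "s \<in> carrier S" "v \<in> carrier V" "u \<in> carrier U"
  then have *: "s \<in> carrier S" "v \<in> A" "u \<in> A" by simp_all
  show "gam' (s \<odot>\<^bsub>V\<^esub> v) u = s \<otimes>\<^bsub>S\<^esub> gam' v u"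
    using gam'_smult[OF *] by (simp only: V_simps)
  show "gam' v (rsmult U u s) = gam' v u \<otimes>\<^bsub>S\<^esub> s"
    using gam'_rsmult[OF *] by (simp only: U_simps rsmult_U[OF *(3,1)])
next
  fix u v u' assume uv: "u \<in> carrier U" "v \<in> carrier V" "u' \<in> carrier U"
  have "rsmult U u (gam' v u') = (\<Sum>g\<in>mor G. P (ginv G g) (u * (v * P g u')))"
    using rsmult_U[OF _ gam'_S, of u v u'] uv by simp
  also have "\<dots> = (\<Sum>g\<in>mor G. P (ginv G g) (u * v) * u')"
  proof (rule sum.cong[OF refl])
    fix g assume g: "g \<in> mor G"
    have "P (ginv G g) (u * (v * P g u')) = P (ginv G g) (u * v) * (u' * e (ginv G g))"
      using P_mult[of "ginv G g" "u * v" "P g u'"] uv g by (simp add: P_ginv mult.assoc)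
    also have "u' * e (ginv G g) = e (ginv G g) * u'"
      using uv g by (simp add: e_central)
    finally show "P (ginv G g) (u * (v * P g u')) = P (ginv G g) (u * v) * u'"
      using uv g by (simp add: P_e_mult)
  qed
  also have "\<dots> = tr (u * v) * u'"
    using sum.reindex_bij_betw[OF ginv_bij, of "\<lambda>g. P g (u * v)"]
    by (simp add: tr_eq sum_distrib_right[symmetric])
  finally show "rsmult U u (gam' v u') = gam u v \<odot>\<^bsub>U\<^esub> u'" by simp
next
  fix v u v' assume "v \<in> carrier V" "u \<in> carrier U" "v' \<in> carrier V"
  then show "rsmult V v (gam u v') = gam' v u \<odot>\<^bsub>V\<^esub> v'"
    by (simp add: tr_eq sum_distrib_left P_mult mult.assoc)
qed

lemma tr_zero: "tr 0 = 0"
  by (simp add: tr_eq)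

text \<open>For the trace the generated subgroup collapses to the image of \<open>tr\<close>: that
  image is closed under sums and negatives, and \<open>a * one_of A\<close> is \<open>a\<close>.
  Values of \<open>gam'\<close> have to be added up, so there the condition keeps the generated
  subgroup.\<close>

theorem strict_iff:
  "strict_morita_context R S U V (Gamma_map G A D \<alpha>) (Gamma_map' G D \<alpha>) \<longleftrightarrow>
    (\<exists>a\<in>A. tr a = one_of A) \<and> \<one>\<^bsub>S\<^esub> \<in> generate (add_monoid S) {gam' a b | a b. a \<in> A \<and> b \<in> A}"
proof -
  interpret UV: tensor_product R S R U V using bimodule_U bimodule_V by (rule tensor_product.intro)
  interpret VU: tensor_product S R S V U using bimodule_V bimodule_U by (rule tensor_product.intro)
  have abR: "abelian_group R" and abS: "abelian_group S"
    using ring_R ring_S ring.is_abelian_group by auto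
  have "generate (add_monoid R) {gam u v | u v. u \<in> A \<and> v \<in> A} = tr ` A"
  proof
    have tr: "tr ` A = {gam u v | u v. u \<in> A \<and> v \<in> A}"
    proof (intro subset_antisym subsetI)
      fix r assume "r \<in> tr ` A"
      then obtain a where "a \<in> A" "r = tr (a * one_of A)" by auto
      then show "r \<in> {gam u v | u v. u \<in> A \<and> v \<in> A}" using one_simps(1) by blast
    qed auto
    show "tr ` A \<subseteq> generate (add_monoid R) {gam u v | u v. u \<in> A \<and> v \<in> A}"
      unfolding tr by (auto intro: generate.incl)
    have inv: "inv\<^bsub>add_monoid R\<^esub> tr a = tr (- a)" if a: "a \<in> A" for a
    proof -
      have "tr (- a) + tr a = 0" using a tr_add[of "- a" a] by (simp add: tr_zero)
      then show ?thesis
        using abelian_group.minus_equality[OF abR, of "tr (- a)" "tr a"] a by (simp add: tr_R a_inv_def)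
    qed
    show "generate (add_monoid R) {gam u v | u v. u \<in> A \<and> v \<in> A} \<subseteq> tr ` A"
      unfolding tr[symmetric]
    proof
      fix r assume "r \<in> generate (add_monoid R) (tr ` A)"
      then show "r \<in> tr ` A"
      proof induction
        case one
        have "0 \<in> tr ` A" using tr_zero A_closed(1) by (metis image_eqI)
        then show ?case by simp
      next
        case (inv h)
        then show ?case using \<open>\<And>a. a \<in> A \<Longrightarrow> inv\<^bsub>add_monoid R\<^esub> tr a = tr (- a)\<close> by auto
      next
        case (eng h h')
        then show ?case by (auto simp: tr_add[symmetric])
      qed auto
    qed
  qed
  then have "Gamma_map G A D \<alpha> ` carrier (tensor S U V) = tr ` A"
    using UV.tensor_lift_image[OF abR balanced_gam] by (simp only: Gamma_map_def tensor_simps U_simps V_simps)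
  moreover have "Gamma_map' G D \<alpha> ` carrier (tensor R V U) = generate (add_monoid S) {gam' a b | a b. a \<in> A \<and> b \<in> A}"
    using VU.tensor_lift_image[OF abS balanced_gam'] by (simp only: Gamma_map'_def tensor_simps U_simps V_simps)
  moreover have "\<one>\<^bsub>R\<^esub> \<in> tr ` A \<longleftrightarrow> (\<exists>a\<in>A. tr a = one_of A)"
    by (simp only: R_simps image_iff) (simp only: eq_commute)
  ultimately show ?thesis
    using morita_context.strict_iff[OF morita_context] by (simp only:)
qed

end

section \<open>Globality along a transversal\<close>

lemma hom_generate:
  assumes "group G" "group H" "h \<in> hom G H" "K \<subseteq> carrier G" "L \<subseteq> carrier H"
    and "h ` K \<subseteq> generate H L" "z \<in> generate G K"
  shows "h z \<in> generate H L"
proof -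
  interpret group_hom G H h
    using assms by (simp add: group_hom_def group_hom_axioms_def)
  have "h ` generate G K = generate H (h ` K)"
    using generate_img assms by simp
  also have "\<dots> \<subseteq> generate H L"
    using assms H.generate_is_subgroup by (intro H.generate_subgroup_incl) auto
  finally show ?thesis using assms by blast
qed

section \<open>Reduction of morphisms to the isotropy group\<close>

locale transversal_groupoid = groupoid +
  fixes x \<tau>
  assumes x_obj [simp]: "x \<in> objs G" and tau: "transversal G x \<tau>"
begin

abbreviation "K \<equiv> hom_set G x x"
abbreviation "H \<equiv> isotropy G x"
abbreviation "red \<equiv> to_isotropy G \<tau>"

lemma tau_simps [simp]:
  "y \<in> objs G \<Longrightarrow> \<tau> y \<in> mor G" "y \<in> objs G \<Longrightarrow> src G (\<tau> y) = x" "y \<in> objs G \<Longrightarrow> tgt G (\<tau> y) = y"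
  "\<tau> x = x"
  using tau by (auto simp: transversal_def hom_set_def)

lemma K_iff: "h \<in> K \<longleftrightarrow> h \<in> mor G \<and> src G h = x \<and> tgt G h = x"
  by (auto simp: hom_set_def)

lemma red_simps [simp]:
  assumes "g \<in> mor G"
  shows "red g \<in> mor G" "src G (red g) = x" "tgt G (red g) = x" "red g \<in> K"
  using assms by (simp_all add: to_isotropy_def K_iff)

lemma tau_red: "g \<in> mor G \<Longrightarrow> cmp G (\<tau> (tgt G g)) (red g) = cmp G g (\<tau> (src G g))"
  by (simp add: to_isotropy_def cmp_assoc)

text \<open>The reduction of \<open>g\<close> is the only loop at \<open>x\<close> that closes the
  square formed by \<open>g\<close> and the two transversal morphisms.\<close>

lemma red_eqI:
  assumes "g \<in> mor G" "h \<in> K" "cmp G (\<tau> (tgt G g)) h = cmp G g (\<tau> (src G g))"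
  shows "red g = h"
  using assms(3)[symmetric] assms(1,2) by (simp add: to_isotropy_def cmp_assoc K_iff)

lemma red_obj: "y \<in> objs G \<Longrightarrow> red y = x"
  using cmp_src[of "\<tau> y"] cmp_tgt[of "\<tau> y"] by (intro red_eqI) (simp_all add: K_iff)

text \<open>For a loop, reduction is conjugation by a transversal morphism, which preserves and
  reflects identities.\<close>

lemma red_eq_x_iff:
  assumes "g \<in> mor G" "src G g = tgt G g"
  shows "red g = x \<longleftrightarrow> g \<in> objs G"
proof
  assume "red g = x"
  then have "\<tau> (tgt G g) = cmp G g (\<tau> (src G g))"
    using tau_red[OF assms(1)] cmp_src[of "\<tau> (tgt G g)"] assms by simp
  then have "cmp G (\<tau> (tgt G g)) (ginv G (\<tau> (tgt G g))) = cmp G (cmp G g (\<tau> (tgt G g))) (ginv G (\<tau> (tgt G g)))"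
    using assms by simp
  then have "tgt G g = g" using assms by (simp del: ginv_cmp)
  then show "g \<in> objs G" using tgt_obj[OF assms(1)] by simp
qed (rule red_obj)

lemma red_tau: "y \<in> objs G \<Longrightarrow> red (\<tau> y) = x"
  using cmp_src[of "\<tau> y"] by (intro red_eqI) (simp_all add: K_iff)

lemma red_ginv_tau: "y \<in> objs G \<Longrightarrow> red (ginv G (\<tau> y)) = x"
  using cmp_src[of x] by (intro red_eqI) (simp_all add: K_iff)

lemma red_ginv: "g \<in> mor G \<Longrightarrow> red (ginv G g) = ginv G (red g)"
  by (simp add: to_isotropy_def cmp_assoc)

lemma red_cmp:
  assumes g: "g \<in> mor G" and h: "h \<in> mor G" and s: "src G g = tgt G h"
  shows "red (cmp G g h) = cmp G (red g) (red h)"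
proof (rule red_eqI)
  have "cmp G (\<tau> (tgt G g)) (cmp G (red g) (red h)) = cmp G (cmp G (\<tau> (tgt G g)) (red g)) (red h)"
    by (rule cmp_assoc[symmetric]) (use assms in simp_all)
  also have "\<dots> = cmp G g (cmp G (\<tau> (tgt G h)) (red h))"
    using assms by (simp add: tau_red cmp_assoc)
  also have "\<dots> = cmp G (cmp G g h) (\<tau> (src G h))"
    using assms by (simp add: tau_red cmp_assoc)
  finally show "cmp G (\<tau> (tgt G (cmp G g h))) (cmp G (red g) (red h)) = cmp G (cmp G g h) (\<tau> (src G (cmp G g h)))"
    using assms by simp
qed (use assms in \<open>simp_all add: K_iff\<close>)

end

locale global_partial_action = unital_partial_action G A D \<alpha> + transversal_groupoid G x \<tau>
  for G :: "('g, 'z) category_scheme" and A :: "'a::ring set" and D \<alpha> x \<tau> +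
  assumes global: "transversal_global G x \<tau> D"
begin

lemma D_tau [simp]: "y \<in> objs G \<Longrightarrow> D (\<tau> y) = D y" "y \<in> objs G \<Longrightarrow> D (ginv G (\<tau> y)) = D x"
  using global by (simp_all add: transversal_global_def)

lemma finite_K: "finite K"
  using finite_mor by (rule finite_subset[rotated]) (auto simp: K_iff)

lemma unital_partial_action_isotropy: "unital_partial_action H (D x) D \<alpha>"
proof (intro unital_partial_action.intro partial_action.intro unital_partial_action_axioms.intro)
  show "groupoid H" by (rule groupoid_isotropy[OF x_obj])
  have mult: "a * b \<in> D x" if "a \<in> D x" "b \<in> D x" for a b
    using that D_A[of x] D_ideal(1)[of x a b] by simp
  show "subrng (D x)"
    using mult D_closed[of x] by (simp add: subrng_def)
  show "rng_ideal (D (tgt H g)) (D x)" if "g \<in> mor H" for g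
    using that mult D_closed[of x] by (simp add: rng_ideal_def K_iff)
  show "finite (mor H)" using finite_K by simp
  show "rng_unital (D g)" if "g \<in> mor H" for g
    using that unital by (simp add: K_iff)
  show "rng_ideal (D g) (D (tgt H g))" if "g \<in> mor H" for g
    using that ideal_mor[of g] by (simp add: K_iff)
  show "rng_iso (\<alpha> g) (D (ginv H g)) (D g)" if "g \<in> mor H" for g
    using that iso[of g] ginv_isotropy[of x g] by (simp add: K_iff)
  show "\<alpha> y a = a" if "y \<in> objs H" "a \<in> D y" for y a
    using that act_obj[of x a] by simp
  show "a \<in> D (ginv H (cmp H g h)) \<and> \<alpha> (cmp H g h) a = \<alpha> g (\<alpha> h a)"
    if "g \<in> mor H" "h \<in> mor H" "src H g = tgt H h" "a \<in> D (ginv H h)" "\<alpha> h a \<in> D (ginv H g)" for g h a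
  proof -
    have "cmp G g h \<in> K" using that by (simp add: K_iff)
    then show ?thesis
      using that extends[of g h a] ginv_isotropy[OF x_obj] by (simp add: K_iff del: ginv_cmp)
  qed
  have "\<exists>!f. f \<in> (\<Pi>\<^sub>E y\<in>{x}. D y) \<and> a = (\<Sum>y\<in>{x}. f y)" if "a \<in> D x" for a
  proof (rule ex1I[of _ "\<lambda>y\<in>{x}. a"])
    fix f assume "f \<in> (\<Pi>\<^sub>E y\<in>{x}. D y) \<and> a = (\<Sum>y\<in>{x}. f y)"
    then show "f = (\<lambda>y\<in>{x}. a)" by (auto simp: fun_eq_iff PiE_def extensional_def)
  qed (use that in auto)
  then show "finite_direct_sum (D x) (objs H) D"
    by (simp add: finite_direct_sum_def)
qed

text \<open>Everything proved for the groupoid, in particular the criterion for strictness, is now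
  available for the second context under the prefix \<open>H\<close>.\<close>

sublocale H: unital_partial_action H "D x" D \<alpha>
  by (rule unital_partial_action_isotropy)

lemma H_P: "h \<in> K \<Longrightarrow> H.P h a = P h a"
  by (simp add: pull_def ginv_isotropy)

lemma H_tr: "H.tr a = (\<Sum>h\<in>K. P h a)"
  by (simp add: H.tr_eq H_P)

lemma e_tau [simp]: "y \<in> objs G \<Longrightarrow> e (\<tau> y) = e y" "y \<in> objs G \<Longrightarrow> e (ginv G (\<tau> y)) = e x"
  by simp_all

lemma P_tau_e: "y \<in> objs G \<Longrightarrow> P (\<tau> y) (e x) = e y"
  using P_e_ginv_one[of "\<tau> y"] by simp

text \<open>The domain ideal \<open>D (ginv G g)\<close> is contained in \<open>D (src G g)\<close>,
  so \<open>P g\<close> sees only the component at the source.\<close>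

lemma P_src: 
  assumes g: "g \<in> mor G" and a: "a \<in> A"
  shows "P g (a * e (src G g)) = P g a"
proof -
  have "P g (a * e (src G g)) = P g (a * (e (src G g) * e (ginv G g)))"
    using P_e_ginv(1)[of g "a * e (src G g)"] g a by (simp add: mult.assoc)
  then show ?thesis using e_tgt(2)[of "ginv G g"] g a by simp
qed

lemma P_src_D: "\<lbrakk>g \<in> mor G; y \<in> objs G; a \<in> D y; src G g \<noteq> y\<rbrakk> \<Longrightarrow> P g a = 0"
  using P_P_orth[of y g a] P_obj[of y a] D_A[of y a] D_e(1)[of y a] by simp

lemma P_tgt:
  assumes "g \<in> mor G" "a \<in> A"
  shows "e (tgt G g) * P g a = P g a" "P g a * e (tgt G g) = P g a"
  using D_e[of "tgt G g" "P g a"] D_tgt P_D assms by simp_all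

text \<open>The factor left by \<open>P_P\<close> is \<open>e (\<tau> y)\<close>; by globality it
  equals \<open>e y\<close>, which fixes every value at a morphism with target
  \<open>y\<close>.\<close>

lemma P_tau_P:
  assumes "y \<in> objs G" "h \<in> mor G" "tgt G h = x" "a \<in> A"
  shows "P (\<tau> y) (P h a) = P (cmp G (\<tau> y) h) a"
  using assms P_P[of h "\<tau> y" a] P_tgt[of "cmp G (\<tau> y) h" a] by simp

text \<open>By globality \<open>\<alpha> (ginv G (\<tau> y))\<close> is defined on all of
  \<open>D y\<close>. Passing to the component at \<open>y\<close> therefore makes
  \<open>P_cmp_e\<close> applicable.\<close>

lemma P_P_tau_inv:
  assumes "y \<in> objs G" "h \<in> mor G" "src G h = x" "a \<in> A"
  shows "P h (P (ginv G (\<tau> y)) a) = P (cmp G h (ginv G (\<tau> y))) a"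
proof -
  have "P (ginv G (\<tau> y)) a = P (ginv G (\<tau> y)) (a * e y)"
    using P_src[of "ginv G (\<tau> y)" a] assms by simp
  moreover have "P h (P (ginv G (\<tau> y)) (a * e y)) = P (cmp G h (ginv G (\<tau> y))) (a * e y)"
    using assms D_ideal(1)[of y a "e y"] by (intro P_cmp_e) simp_all
  ultimately show ?thesis
    using P_src[of "cmp G h (ginv G (\<tau> y))" a] assms by simp
qed

text \<open>Both directions use the decompositions \<open>g = \<tau> y h\<close> of the morphisms out of \<open>x\<close> and
  \<open>g = h (\<tau> y)\<inverse>\<close> of the morphisms into \<open>x\<close>.\<close>

lemma trace_one_iff: "(\<exists>a\<in>A. tr a = one_of A) \<longleftrightarrow> (\<exists>b\<in>D x. H.tr b = e x)"
proof
  assume "\<exists>b\<in>D x. H.tr b = e x"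
  then obtain b where b: "b \<in> D x" "H.tr b = e x" by blast
  have bA: "b \<in> A" using D_A[of x] b by simp
  have "tr b = (\<Sum>g\<in>{g\<in>mor G. src G g = x}. P g b)"
    unfolding tr_eq using b by (intro sum_restrict P_src_D) simp_all
  also have "\<dots> = (\<Sum>(y, h)\<in>objs G \<times> K. P (cmp G (\<tau> y) h) b)"
    by (rule sum.reindex_bij_witness[of _ "\<lambda>(y, h). cmp G (\<tau> y) h"
          "\<lambda>g. (tgt G g, cmp G (ginv G (\<tau> (tgt G g))) g)"]) (auto simp: K_iff)
  also have "\<dots> = (\<Sum>y\<in>objs G. \<Sum>h\<in>K. P (\<tau> y) (P h b))"
    unfolding sum.cartesian_product[symmetric] using bA
    by (intro sum.cong refl) (simp add: P_tau_P K_iff)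
  also have "\<dots> = (\<Sum>y\<in>objs G. P (\<tau> y) (H.tr b))"
    unfolding H_tr using bA by (intro sum.cong refl P_sum[symmetric]) (simp_all add: K_iff)
  also have "\<dots> = (\<Sum>y\<in>objs G. P (\<tau> y) (e x))"
    by (simp only: b(2))
  also have "\<dots> = one_of A"
    by (simp add: one_A P_tau_e)
  finally show "\<exists>a\<in>A. tr a = one_of A" using bA by blast
next
  assume "\<exists>a\<in>A. tr a = one_of A"
  then obtain a where a: "a \<in> A" "tr a = one_of A" by blast
  define b where "b = (\<Sum>y\<in>objs G. P (ginv G (\<tau> y)) a)"
  have "P (ginv G (\<tau> y)) a \<in> D x" if "y \<in> objs G" for y
    using P_D[of "ginv G (\<tau> y)" a] that a by simp
  then have b: "b \<in> D x" unfolding b_def by (intro D_sum) simp_all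
  have "H.tr b = (\<Sum>h\<in>K. \<Sum>y\<in>objs G. P (cmp G h (ginv G (\<tau> y))) a)"
    unfolding H_tr b_def using a by (intro sum.cong) (simp_all add: P_sum P_P_tau_inv K_iff)
  also have "\<dots> = (\<Sum>(h, y)\<in>K \<times> objs G. P (cmp G h (ginv G (\<tau> y))) a)"
    by (simp add: sum.cartesian_product)
  also have "\<dots> = (\<Sum>g\<in>{g\<in>mor G. tgt G g = x}. P g a)"
    by (rule sum.reindex_bij_witness[of _ "\<lambda>g. (cmp G g (\<tau> (src G g)), src G g)"
          "\<lambda>(h, y). cmp G h (ginv G (\<tau> y))"]) (auto simp: K_iff)
  also have "\<dots> = (\<Sum>g\<in>{g\<in>mor G. tgt G g = x}. P g a * e x)"
    using a by (intro sum.cong) (auto simp: P_tgt)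
  also have "\<dots> = (\<Sum>g\<in>mor G. P g a * e x)"
    using a orth[of _ x "P _ a" "e x"] by (intro sum_restrict[symmetric]) (simp add: P_D)
  also have "\<dots> = e x"
    using a(2) by (simp add: sum_distrib_right[symmetric] tr_eq)
  finally show "\<exists>b\<in>D x. H.tr b = e x" using b by blast
qed

text \<open>Forgetting coefficients outside the group is additive, and it sends values of
  \<open>gam'\<close> to values of \<open>H.gam'\<close>, because on loops at \<open>x\<close> only
  the components of the arguments at \<open>x\<close> matter.\<close>

lemma skew_one_restrict:
  assumes "\<one>\<^bsub>S\<^esub> \<in> generate (add_monoid S) {gam' a b | a b. a \<in> A \<and> b \<in> A}"
  shows "\<one>\<^bsub>H.S\<^esub> \<in> generate (add_monoid H.S) {H.gam' a b | a b. a \<in> D x \<and> b \<in> D x}"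
proof -
  define \<rho> where "\<rho> f = (\<lambda>h. if h \<in> K then f h else 0)" for f :: "'g \<Rightarrow> 'a"
  have "\<rho> \<one>\<^bsub>S\<^esub> \<in> generate (add_monoid H.S) {H.gam' a b | a b. a \<in> D x \<and> b \<in> D x}"
  proof (rule hom_generate[OF _ _ _ _ _ _ assms])
    show "group (add_monoid S)" "group (add_monoid H.S)"
      using ring_S H.ring_S ring.is_abelian_group abelian_group.a_group by blast+
    show "\<rho> \<in> hom (add_monoid S) (add_monoid H.S)"
      by (rule homI) (auto simp: \<rho>_def H.S_iff S_iff K_iff)
    show "{gam' a b | a b. a \<in> A \<and> b \<in> A} \<subseteq> carrier (add_monoid S)"
      using gam'_S by auto
    show "{H.gam' a b | a b. a \<in> D x \<and> b \<in> D x} \<subseteq> carrier (add_monoid H.S)"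
      using H.gam'_S by auto
    have "\<rho> (gam' a b) = H.gam' (a * e x) (b * e x)" if a: "a \<in> A" and b: "b \<in> A" for a b
    proof
      fix h
      have "a * P h b = a * e x * P h (b * e x)" if "h \<in> K"
        using that a b P_src[of h b] P_tgt[of h b] by (simp add: K_iff mult.assoc)
      then show "\<rho> (gam' a b) h = H.gam' (a * e x) (b * e x) h"
        by (simp add: \<rho>_def H_P) (simp add: K_iff)
    qed
    moreover have "a * e x \<in> D x" if "a \<in> A" for a
      using that D_ideal(1)[of x a "e x"] by simp
    ultimately have "\<rho> (gam' a b) \<in> {H.gam' a b | a b. a \<in> D x \<and> b \<in> D x}" if "a \<in> A" "b \<in> A" for a b
      using that by blast
    then show "\<rho> ` {gam' a b | a b. a \<in> A \<and> b \<in> A} \<subseteq> generate (add_monoid H.S) {H.gam' a b | a b. a \<in> D x \<and> b \<in> D x}"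
      by (auto intro!: generate.incl)
  qed
  moreover have "\<rho> \<one>\<^bsub>S\<^esub> = \<one>\<^bsub>H.S\<^esub>"
    by (auto simp: \<rho>_def fun_eq_iff K_iff)
  ultimately show ?thesis by simp
qed

text \<open>Globality gives that \<open>P g\<close> sends \<open>e (\<tau> y)\<close> to
  \<open>e g\<close>, and that \<open>P\<close> of the composite sends
  \<open>e (ginv G (\<tau> y))\<close> to the identity of the composite. By \<open>P_e_cmp\<close>
  each of the two identities then absorbs the other.\<close>

lemma e_cmp_tau:
  assumes g: "g \<in> mor G" and y: "y = src G g"
  shows "e (cmp G g (\<tau> y)) = e g"
proof -
  have yo: "y \<in> objs G" using g y by simp
  let ?k = "cmp G g (\<tau> y)"
  have k: "?k \<in> mor G" "src G ?k = x" using g y by simp_all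
  have 1: "P g (e (\<tau> y)) = e g"
    using P_src[OF g one_simps(1)] g y by (simp add: P_one)
  have 2: "P ?k (e (ginv G (\<tau> y))) = e ?k"
    using P_src[OF k(1) one_simps(1)] k(2) yo P_one[OF k(1)] by simp
  have "e ?k = e ?k * e (cmp G ?k (ginv G (\<tau> y)))"
    by (rule trans[OF 2[symmetric] P_e_cmp]) (use k g y in simp_all)
  also have "\<dots> = e ?k * e g"
    using g y by simp
  also have "\<dots> = e g * e ?k"
    by (rule e_central) (use k g in simp_all)
  also have "\<dots> = e g"
    by (rule trans[OF P_e_cmp[symmetric] 1]) (use g y in simp_all)
  finally show ?thesis .
qed

lemma generate_S_sum:
  assumes L: "L \<subseteq> carrier S" and "\<And>i. i \<in> I \<Longrightarrow> \<phi> i \<in> generate (add_monoid S) L"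
  shows "(\<lambda>g. \<Sum>i\<in>I. \<phi> i g) \<in> generate (add_monoid S) L"
  using assms(2)
proof (induction I rule: infinite_finite_induct)
  case (insert i I)
  then have "\<phi> i \<otimes>\<^bsub>add_monoid S\<^esub> (\<lambda>g. \<Sum>i\<in>I. \<phi> i g) \<in> generate (add_monoid S) L"
    by (intro generate.eng) simp_all
  then show ?case using insert by simp
qed (use generate.one[of "add_monoid S" L] in simp_all)

text \<open>\<open>\<Lambda>\<close> gives a loop \<open>g\<close> at \<open>y\<close> the
  coefficient of its reduction, moved to \<open>y\<close> by \<open>\<tau> y\<close>, and gives zero
  to morphisms between different objects. Being additive, it only has to be evaluated at the values
  of \<open>H.gam'\<close> and at the identity.\<close>

lemma skew_one_extend:
  assumes "\<one>\<^bsub>H.S\<^esub> \<in> generate (add_monoid H.S) {H.gam' a b | a b. a \<in> D x \<and> b \<in> D x}"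
  shows "\<one>\<^bsub>S\<^esub> \<in> generate (add_monoid S) {gam' a b | a b. a \<in> A \<and> b \<in> A}"
proof -
  define \<Lambda> where "\<Lambda> f = (\<lambda>g. if g \<in> mor G \<and> src G g = tgt G g then P (\<tau> (tgt G g)) (f (red g)) else 0)"
    for f :: "'g \<Rightarrow> 'a"
  let ?L = "{gam' a b | a b. a \<in> A \<and> b \<in> A}"
  have L: "?L \<subseteq> carrier S" using gam'_S by auto
  have Dx: "b \<in> A" if "b \<in> D x" for b using that D_A[of x] by simp
  have fA: "f h \<in> A" if "f \<in> carrier H.S" for f h using H.S_A[OF that, of h] Dx by simp
  have "\<Lambda> \<one>\<^bsub>H.S\<^esub> \<in> generate (add_monoid S) ?L"
  proof (rule hom_generate[OF _ _ _ _ _ _ assms])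
    show "group (add_monoid S)" "group (add_monoid H.S)"
      using ring_S H.ring_S ring.is_abelian_group abelian_group.a_group by blast+
    show "\<Lambda> \<in> hom (add_monoid H.S) (add_monoid S)"
    proof (rule homI)
      fix f assume f: "f \<in> carrier (add_monoid H.S)"
      have "P (\<tau> (tgt G g)) (f (red g)) \<in> D g" if g: "g \<in> mor G" "src G g = tgt G g" for g
      proof -
        have "f (red g) \<in> D (red g)" using H.S_D[of f "red g"] f g by simp
        \<comment> \<open>The square of \<open>tau_red\<close> identifies this ideal with the one of
          \<open>g\<close> composed with a transversal morphism, which is \<open>D g\<close> by
          \<open>e_cmp_tau\<close>.\<close>
        then have "P (\<tau> (tgt G g)) (f (red g)) \<in> D (cmp G (\<tau> (tgt G g)) (red g))"
          using g by (intro P_D_cmp) simp_all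
        then show ?thesis
          using g e_cmp_tau[of g "src G g"] D_iff[of g] D_iff[of "cmp G g (\<tau> (src G g))"] by (simp add: tau_red)
      qed
      then show "\<Lambda> f \<in> carrier (add_monoid S)"
        by (simp add: \<Lambda>_def S_iff D_closed)
      fix f' assume f': "f' \<in> carrier (add_monoid H.S)"
      show "\<Lambda> (f \<otimes>\<^bsub>add_monoid H.S\<^esub> f') = \<Lambda> f \<otimes>\<^bsub>add_monoid S\<^esub> \<Lambda> f'"
        using f f' fA by (auto simp: \<Lambda>_def P_add fun_eq_iff)
    qed
    show "{H.gam' a b | a b. a \<in> D x \<and> b \<in> D x} \<subseteq> carrier (add_monoid H.S)"
      using H.gam'_S by auto
    show "?L \<subseteq> carrier (add_monoid S)" using L by simp
    have \<Lambda>_gam': "\<Lambda> (H.gam' a b) = (\<lambda>g. \<Sum>y\<in>objs G. gam' (P (\<tau> y) a) (P (\<tau> y) b) g)"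
      if a: "a \<in> D x" and b: "b \<in> D x" for a b
    proof
      fix g
      show "\<Lambda> (H.gam' a b) g = (\<Sum>y\<in>objs G. gam' (P (\<tau> y) a) (P (\<tau> y) b) g)"
      proof (cases "g \<in> mor G")
        case g: True
        let ?X = "\<lambda>y. P (\<tau> y) a * P g (P (\<tau> y) b)"
        \<comment> \<open>The left factor lies in \<open>D y\<close> and the right one in
          \<open>D g\<close>, so \<open>y\<close> must be the target of \<open>g\<close>; and
          \<open>P g\<close> kills what does not live at its source. Hence there are no cross terms,
          and only loops keep a coefficient.\<close>
        have X0: "?X y = 0" if "y \<in> objs G" "y \<noteq> src G g \<or> y \<noteq> tgt G g" for y
        proof (cases "y = src G g")
          case True
          have "P (\<tau> y) a \<in> D y" using P_D[of "\<tau> y" a] that(1) a Dx by simp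
          moreover have "P g (P (\<tau> y) b) \<in> D g" using P_D[of g "P (\<tau> y) b"] that(1) g b Dx by simp
          ultimately show ?thesis using True that g by (intro orth[of y g]) simp_all
        next
          case False
          then show ?thesis using that g b Dx P_P_orth[of "\<tau> y" g b] by simp
        qed
        have "(\<Sum>y\<in>objs G. ?X y) = (\<Sum>y\<in>objs G. if y = tgt G g then (if src G g = tgt G g then ?X y else 0) else 0)"
          using X0 by (intro sum.cong) auto
        also have "\<dots> = (if src G g = tgt G g then ?X (tgt G g) else 0)"
          using g by simp
        also have "\<dots> = \<Lambda> (H.gam' a b) g"
        proof (cases "src G g = tgt G g")
          case s: True
          let ?y = "tgt G g"
          \<comment> \<open>Both translates of \<open>b\<close> belong to the same morphism, since
            \<open>g\<close> after \<open>\<tau> ?y\<close> is \<open>\<tau> ?y\<close> after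
            \<open>red g\<close>.\<close>
          have "P g (P (\<tau> ?y) b) = P (cmp G g (\<tau> ?y)) b"
            using g s b by (intro P_cmp_e) simp_all
          moreover have "P (\<tau> ?y) (P (red g) b) = P (cmp G g (\<tau> ?y)) b"
            using g s b Dx tau_red[OF g] by (simp add: P_tau_P)
          ultimately show ?thesis
            using g s a b Dx by (simp add: \<Lambda>_def H_P P_mult)
        qed (simp add: \<Lambda>_def)
        finally show ?thesis using g by simp
      qed (simp add: \<Lambda>_def)
    qed
    have "\<Lambda> (H.gam' a b) \<in> generate (add_monoid S) ?L" if a: "a \<in> D x" and b: "b \<in> D x" for a b
      unfolding \<Lambda>_gam'[OF a b]
    proof (rule generate_S_sum[OF L])
      fix y assume "y \<in> objs G"
      then have "P (\<tau> y) a \<in> A" "P (\<tau> y) b \<in> A" using Dx a b by simp_all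
      then show "gam' (P (\<tau> y) a) (P (\<tau> y) b) \<in> generate (add_monoid S) ?L"
        by (intro generate.incl) blast
    qed
    then show "\<Lambda> ` {H.gam' a b | a b. a \<in> D x \<and> b \<in> D x} \<subseteq> generate (add_monoid S) ?L"
      by auto
  qed
  moreover have "\<Lambda> \<one>\<^bsub>H.S\<^esub> = \<one>\<^bsub>S\<^esub>"
  proof
    fix g
    show "\<Lambda> \<one>\<^bsub>H.S\<^esub> g = \<one>\<^bsub>S\<^esub> g"
    proof (cases "g \<in> mor G \<and> src G g = tgt G g")
      case True
      \<comment> \<open>A loop reduces to \<open>x\<close> exactly when it is an identity, so the
        coefficient \<open>e x\<close> is moved precisely to the objects, where it becomes
        \<open>e y\<close>.\<close>
      then show ?thesis
        using red_eq_x_iff[of g] P_e_ginv_one[of "\<tau> (tgt G g)"] by (auto simp: \<Lambda>_def)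
    next
      case False
      then have "g \<notin> objs G" by auto
      then show ?thesis unfolding \<Lambda>_def if_not_P[OF False] by simp
    qed
  qed
  ultimately show ?thesis by simp
qed

theorem strict_iff_isotropy:
  "strict_morita_context R S U V (Gamma_map G A D \<alpha>) (Gamma_map' G D \<alpha>) \<longleftrightarrow>
    strict_morita_context H.R H.S H.U H.V (Gamma_map H (D x) D \<alpha>) (Gamma_map' H D \<alpha>)"
  unfolding strict_iff H.strict_iff trace_one_iff
  using skew_one_restrict skew_one_extend by blast

end

section \<open>Lifted partial actions\<close>

lemma rng_iso_identity:
  assumes f: "rng_iso f I L" and u: "is_identity I u"
  shows "is_identity L (f u)"
proof -
  have im: "L = f ` I" and mult: "\<And>a b. \<lbrakk>a \<in> I; b \<in> I\<rbrakk> \<Longrightarrow> f (a * b) = f a * f b"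
    using f by (auto simp: rng_iso_def bij_betw_def)
  show ?thesis
    using u by (auto simp: is_identity_def im mult[symmetric])
qed

locale global_lifting =
  transversal_groupoid G x \<tau> + lifting_datum G x \<tau> A J \<gamma>
  for G :: "('g, 'z) category_scheme" and x \<tau> and A :: "'a::ring set" and J \<gamma> +
  assumes rng_A: "subrng A"
    and global: "transversal_global G x \<tau> (lifted_ideal G \<tau> J \<gamma>)"
begin

abbreviation "B \<equiv> lifted_ideal G \<tau> J \<gamma>"
abbreviation "\<beta> \<equiv> lifted_map G \<tau> J \<gamma>"
abbreviation "c y \<equiv> \<gamma> (\<tau> y)"

sublocale K: partial_action H "J x" J \<gamma>
  using action by (simp add: partial_group_action_def)

lemma tau_iso: "y \<in> objs G \<Longrightarrow> rng_iso (c y) (J (ginv G (\<tau> y))) (J (\<tau> y))"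
  by (rule iso_transversal)

lemma c_inj: "y \<in> objs G \<Longrightarrow> inj_on (c y) (J (ginv G (\<tau> y)))"
  using tau_iso[of y] unfolding rng_iso_def bij_betw_def by blast

lemma c_image: "y \<in> objs G \<Longrightarrow> c y ` J (ginv G (\<tau> y)) = J (\<tau> y)"
  using tau_iso[of y] unfolding rng_iso_def bij_betw_def by blast

lemma gamma_iso: "h \<in> K \<Longrightarrow> rng_iso (\<gamma> h) (J (ginv G h)) (J h)"
  using K.iso[of h] ginv_isotropy[OF x_obj] by simp

lemma gamma_x: "b \<in> J x \<Longrightarrow> \<gamma> x b = b"
  using base(2) by simp

lemma J_K_subset: "h \<in> K \<Longrightarrow> J h \<subseteq> J x"
  using K.ideal_mor[of h] by (simp add: rng_ideal_def K_iff)

lemma J_tau_inv_subset: "y \<in> objs G \<Longrightarrow> J (ginv G (\<tau> y)) \<subseteq> J x"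
  using ideal_transversal_inv[of y] unfolding rng_ideal_def by blast

lemma ginv_K: "h \<in> K \<Longrightarrow> ginv G h \<in> K"
  by (simp add: K_iff)

lemma lifted_obj: "y \<in> objs G \<Longrightarrow> B y = J y" "y \<in> objs G \<Longrightarrow> \<beta> y a = a"
  by (simp_all add: lifted_ideal_def lifted_map_def lifted_def pb_range_def)

text \<open>Writing an element of the domain as \<open>c (src G g) b\<close> removes the inverse
  partial bijection, so that computations can take place inside \<open>J x\<close>.\<close>

lemma lifted_map_c:
  assumes g: "g \<in> mor G" "g \<notin> objs G" and b: "b \<in> J (ginv G (\<tau> (src G g)))"
  shows "\<beta> g (c (src G g) b) = c (tgt G g) (\<gamma> (red g) b)"
  using g b c_inj[of "src G g"]
  by (simp add: lifted_map_def lifted_def Let_def pb_comp_def pb_inv_def inv_into_f_f)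

lemma lifted_ideal_eq:
  assumes g: "g \<in> mor G" "g \<notin> objs G"
  shows "B g = c (tgt G g) ` \<gamma> (red g) ` {b \<in> J (ginv G (\<tau> (src G g))) \<inter> J (ginv G (red g)).
    \<gamma> (red g) b \<in> J (ginv G (\<tau> (tgt G g)))}"
proof -
  let ?r = "inv_into (J (ginv G (\<tau> (src G g)))) (c (src G g))"
  let ?M = "{b \<in> J (ginv G (\<tau> (src G g))) \<inter> J (ginv G (red g)).
    \<gamma> (red g) b \<in> J (ginv G (\<tau> (tgt G g)))}"
  have r: "?r (c (src G g) b) = b" if "b \<in> J (ginv G (\<tau> (src G g)))" for b
    using that c_inj g by (simp add: inv_into_f_f)
  let ?W = "{a \<in> c (src G g) ` J (ginv G (\<tau> (src G g))). ?r a \<in> J (ginv G (red g))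
      \<and> \<gamma> (red g) (?r a) \<in> J (ginv G (\<tau> (tgt G g)))}"
  have "B g = (\<lambda>a. c (tgt G g) (\<gamma> (red g) (?r a))) ` ?W"
    using g by (simp add: lifted_ideal_def lifted_def Let_def pb_comp_def pb_inv_def pb_range_def comp_def)
  also have "?W = c (src G g) ` ?M"
    using r by auto
  also have "(\<lambda>a. c (tgt G g) (\<gamma> (red g) (?r a))) ` c (src G g) ` ?M = c (tgt G g) ` \<gamma> (red g) ` ?M"
    unfolding image_image by (rule image_cong) (simp_all add: r)
  finally show ?thesis .
qed

text \<open>Globality is given for \<open>B\<close> but needed for \<open>J\<close>. For
  \<open>y\<close> other than \<open>x\<close> neither \<open>\<tau> y\<close> nor its inverse is an
  identity, and both reduce to \<open>x\<close>, which acts trivially; hence \<open>B\<close> and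
  \<open>J\<close> agree there. For \<open>y = x\<close> all these ideals are
  \<open>J x\<close>.\<close>

lemma J_tau: "y \<in> objs G \<Longrightarrow> J (\<tau> y) = J y"
  and J_tau_inv: "y \<in> objs G \<Longrightarrow> J (ginv G (\<tau> y)) = J x"
proof -
  assume y: "y \<in> objs G"
  have "J (\<tau> y) = J y \<and> J (ginv G (\<tau> y)) = J x"
  proof (cases "y = x")
    case True
    then show ?thesis by simp
  next
    case False
    have nobj: "\<tau> y \<notin> objs G" "ginv G (\<tau> y) \<notin> objs G"
    proof -
      have not_obj: "g \<notin> objs G" if "src G g \<noteq> tgt G g" for g
        using that by auto
      show "\<tau> y \<notin> objs G" "ginv G (\<tau> y) \<notin> objs G"
        by (rule not_obj, use y False in simp)+
    qed
    have sub: "J (ginv G (\<tau> y)) \<subseteq> J x" by (rule J_tau_inv_subset[OF y])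
    have "B (\<tau> y) = c y ` \<gamma> x ` {b \<in> J x. \<gamma> x b \<in> J (ginv G (\<tau> y))}"
      using lifted_ideal_eq[of "\<tau> y"] y nobj by (simp add: red_tau)
    also have "{b \<in> J x. \<gamma> x b \<in> J (ginv G (\<tau> y))} = J (ginv G (\<tau> y))"
      using sub gamma_x by auto
    also have "\<gamma> x ` J (ginv G (\<tau> y)) = J (ginv G (\<tau> y))"
      using sub gamma_x by (auto simp: image_iff subset_iff)
    also have "c y ` J (ginv G (\<tau> y)) = J (\<tau> y)"
      by (rule c_image[OF y])
    finally have 1: "B (\<tau> y) = J (\<tau> y)" .
    have "B (ginv G (\<tau> y)) = c x ` \<gamma> x ` {b \<in> J (ginv G (\<tau> y)) \<inter> J x. \<gamma> x b \<in> J x}"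
      using lifted_ideal_eq[of "ginv G (\<tau> y)"] y nobj by (simp add: red_ginv_tau)
    also have "{b \<in> J (ginv G (\<tau> y)) \<inter> J x. \<gamma> x b \<in> J x} = J (ginv G (\<tau> y))"
      using sub gamma_x by auto
    also have "c x ` \<gamma> x ` J (ginv G (\<tau> y)) = J (ginv G (\<tau> y))"
      using sub gamma_x by (auto simp: image_iff subset_iff)
    finally have 2: "B (ginv G (\<tau> y)) = J (ginv G (\<tau> y))" .
    show ?thesis
      using global 1 2 y by (simp add: transversal_global_def lifted_obj)
  qed
  then show "J (\<tau> y) = J y" "J (ginv G (\<tau> y)) = J x" by simp_all
qed

lemma c_iso: "y \<in> objs G \<Longrightarrow> rng_iso (c y) (J x) (J y)"
  using tau_iso[of y] by (simp add: J_tau J_tau_inv)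

text \<open>By globality the transversal maps are defined on all of \<open>J x\<close>, so the
  domain conditions in \<open>lifted_ideal_eq\<close> hold automatically.\<close>

lemma B_eq: assumes g: "g \<in> mor G" shows "B g = c (tgt G g) ` J (red g)"
proof (cases "g \<in> objs G")
  case True
  then show ?thesis
    using c_image[of g] by (simp add: lifted_obj red_obj J_tau J_tau_inv)
next
  case False
  have im: "\<gamma> (red g) ` J (ginv G (red g)) = J (red g)"
    using gamma_iso[of "red g"] g unfolding rng_iso_def bij_betw_def by simp
  have sub: "J (red g) \<subseteq> J x" "J (ginv G (red g)) \<subseteq> J x"
    using J_K_subset[of "red g"] J_K_subset[OF ginv_K, of "red g"] g by simp_all
  have "{b \<in> J x \<inter> J (ginv G (red g)). \<gamma> (red g) b \<in> J x} = J (ginv G (red g))"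
    using im sub by blast
  then show ?thesis
    using lifted_ideal_eq[OF g False] g im by (simp add: J_tau_inv)
qed

lemma \<beta>_c:
  assumes g: "g \<in> mor G" and b: "b \<in> J (ginv G (red g))"
  shows "\<beta> g (c (src G g) b) = c (tgt G g) (\<gamma> (red g) b)"
proof -
  have b': "b \<in> J x"
    using b J_K_subset[OF ginv_K, of "red g"] g by auto
  show ?thesis
  proof (cases "g \<in> objs G")
    case True
    then show ?thesis using gamma_x[OF b'] by (simp add: lifted_obj red_obj)
  next
    case False
    then show ?thesis using lifted_map_c[OF g False] b' g by (simp add: J_tau_inv)
  qed
qed

lemma B_ginv: "g \<in> mor G \<Longrightarrow> B (ginv G g) = c (src G g) ` J (ginv G (red g))"
  using B_eq[of "ginv G g"] by (simp add: red_ginv)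

lemma rng_iso_c:
  assumes y: "y \<in> objs G" and sub: "M \<subseteq> J x"
  shows "rng_iso (c y) M (c y ` M)"
  using c_iso[OF y] sub inj_on_subset[of "c y" "J x" M]
  by (auto simp: rng_iso_def bij_betw_def subset_iff)

text \<open>The map is the isomorphism \<open>\<gamma> (red g)\<close> transported along the
  isomorphisms \<open>c\<close> at the source and at the target.\<close>

lemma rng_iso_\<beta>:
  assumes g: "g \<in> mor G"
  shows "rng_iso (\<beta> g) (B (ginv G g)) (B g)"
proof -
  let ?M = "J (ginv G (red g))" and ?s = "src G g" and ?t = "tgt G g"
  have M: "?M \<subseteq> J x" "J (red g) \<subseteq> J x"
    using J_K_subset[of "red g"] J_K_subset[OF ginv_K, of "red g"] g by simp_all
  have s: "rng_iso (c ?s) ?M (B (ginv G g))"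
    using rng_iso_c[of ?s ?M] M g by (simp add: B_ginv)
  have t: "rng_iso (c ?t) (J (red g)) (B g)"
    using rng_iso_c[of ?t "J (red g)"] M g by (simp add: B_eq)
  have r: "rng_iso (\<gamma> (red g)) ?M (J (red g))"
    using gamma_iso g by simp
  have closed: "a + b \<in> ?M" "a * b \<in> ?M" if "a \<in> ?M" "b \<in> ?M" for a b
  proof -
    have "rng_ideal ?M (J x)"
      using K.ideal_mor[of "ginv G (red g)"] g ginv_K[of "red g"] by (simp add: K_iff)
    then show "a + b \<in> ?M" "a * b \<in> ?M" using that M unfolding rng_ideal_def by blast+
  qed
  have bij: "bij_betw (\<beta> g) (B (ginv G g)) (B g)"
  proof -
    have "bij_betw (c ?t \<circ> \<gamma> (red g)) ?M (B g)"
      using r t unfolding rng_iso_def by (blast intro: bij_betw_trans)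
    then have "bij_betw (\<beta> g \<circ> c ?s) ?M (B g)"
      by (subst bij_betw_cong[where g = "c ?t \<circ> \<gamma> (red g)"]) (simp_all add: \<beta>_c[OF g])
    then show ?thesis
      using s bij_betw_comp_iff[of "c ?s" ?M "B (ginv G g)" "\<beta> g" "B g"] by (simp add: rng_iso_def)
  qed
  have in_J: "\<gamma> (red g) a \<in> J (red g)" if "a \<in> ?M" for a
    using r that unfolding rng_iso_def bij_betw_def by blast
  have hom: "\<beta> g (c ?s a + c ?s b) = \<beta> g (c ?s a) + \<beta> g (c ?s b)"
    "\<beta> g (c ?s a * c ?s b) = \<beta> g (c ?s a) * \<beta> g (c ?s b)" if "a \<in> ?M" "b \<in> ?M" for a b
  proof -
    have "c ?s a + c ?s b = c ?s (a + b)" "c ?s a * c ?s b = c ?s (a * b)"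
      using s that by (simp_all add: rng_iso_def)
    then show "\<beta> g (c ?s a + c ?s b) = \<beta> g (c ?s a) + \<beta> g (c ?s b)"
      "\<beta> g (c ?s a * c ?s b) = \<beta> g (c ?s a) * \<beta> g (c ?s b)"
      using that closed[OF that] r t in_J by (simp_all add: \<beta>_c[OF g] rng_iso_def)
  qed
  show ?thesis
    unfolding rng_iso_def using bij hom by (auto simp: B_ginv[OF g])
qed

lemma partial_action_lifted: "partial_action G A B \<beta>"
proof (intro partial_action.intro)
  show "groupoid G" by (rule groupoid_axioms)
  show "subrng A" by (rule rng_A)
  show "rng_ideal (B (tgt G g)) A" if "g \<in> mor G" for g
    using that ideals[of "tgt G g"] by (simp add: lifted_obj)
  show "rng_ideal (B g) (B (tgt G g))" if g: "g \<in> mor G" for g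
  proof -
    have im: "\<gamma> (red g) ` J (ginv G (red g)) = J (red g)"
      using gamma_iso[of "red g"] g unfolding rng_iso_def bij_betw_def by simp
    have "J x \<inter> J (ginv G (red g)) = J (ginv G (red g))" "J x \<inter> J (red g) = J (red g)"
      using J_K_subset[of "red g"] J_K_subset[OF ginv_K, of "red g"] g by auto
    \<comment> \<open>With the intersections simplified by globality, \<open>ideal_lifted\<close> is
      exactly this claim.\<close>
    then show ?thesis
      using ideal_lifted[OF g] g im by (simp add: J_tau_inv B_eq[OF g] lifted_obj)
  qed
  show "rng_iso (\<beta> g) (B (ginv G g)) (B g)" if "g \<in> mor G" for g
    using that by (rule rng_iso_\<beta>)
  show "\<beta> y a = a" if "y \<in> objs G" "a \<in> B y" for y a
    using that by (simp add: lifted_obj)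
  show "a \<in> B (ginv G (cmp G g h)) \<and> \<beta> (cmp G g h) a = \<beta> g (\<beta> h a)"
    if g: "g \<in> mor G" and h: "h \<in> mor G" and s: "src G g = tgt G h"
      and a: "a \<in> B (ginv G h)" and ha: "\<beta> h a \<in> B (ginv G g)" for g h a
  proof -
    obtain b where b: "b \<in> J (ginv G (red h))" "a = c (src G h) b"
      using a B_ginv[OF h] by auto
    have \<beta>h: "\<beta> h a = c (tgt G h) (\<gamma> (red h) b)" using b \<beta>_c[OF h] by simp
    obtain b' where b': "b' \<in> J (ginv G (red g))" "\<beta> h a = c (src G g) b'"
      using ha B_ginv[OF g] by auto
    have "\<gamma> (red h) b \<in> J (red h)"
      using gamma_iso[of "red h"] h b(1) unfolding rng_iso_def bij_betw_def by auto
    then have "\<gamma> (red h) b \<in> J x" using J_K_subset[of "red h"] h by auto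
    moreover have "b' \<in> J x" using b'(1) J_K_subset[OF ginv_K, of "red g"] g by auto
    moreover have "inj_on (c (src G g)) (J x)"
      using c_inj[of "src G g"] g by (simp add: J_tau_inv)
    \<comment> \<open>At the middle object both descriptions of \<open>\<beta> h a\<close> are
      pulled back to \<open>J x\<close> by the same injective map. The composite is thus defined at
      \<open>a\<close> because the partial group action is defined at \<open>b\<close>, and its
      axiom applies since reduction is multiplicative.\<close>
    ultimately have eq: "\<gamma> (red h) b = b'"
      using \<beta>h b'(2) s by (simp add: inj_on_eq_iff)
    have K: "red g \<in> K" "red h \<in> K" "cmp G (red g) (red h) \<in> K"
      using g h by (simp_all add: K_iff)
    have "b \<in> J (ginv H (cmp H (red g) (red h))) \<and> \<gamma> (cmp H (red g) (red h)) b = \<gamma> (red g) (\<gamma> (red h) b)"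
      using K.extends[of "red g" "red h" b] K b b' eq g h by (simp add: ginv_isotropy[OF x_obj] del: ginv_cmp)
    then have *: "b \<in> J (ginv G (red (cmp G g h)))" "\<gamma> (red (cmp G g h)) b = \<gamma> (red g) b'"
      using K eq g h s by (simp_all add: ginv_isotropy[OF x_obj] red_cmp del: ginv_cmp)
    have gh: "cmp G g h \<in> mor G" "src G (cmp G g h) = src G h" "tgt G (cmp G g h) = tgt G g"
      using g h s by simp_all
    have "a \<in> B (ginv G (cmp G g h))"
      unfolding B_ginv[OF gh(1)] gh(2) using * b by blast
    moreover have "\<beta> (cmp G g h) a = \<beta> g (\<beta> h a)"
      using \<beta>_c[OF gh(1) *(1)] *(2) b(2) b'(2) \<beta>_c[OF g b'(1)] gh by simp
    ultimately show ?thesis ..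
  qed
qed

text \<open>The identity of \<open>B g\<close> is the image under \<open>c (tgt G g)\<close> of the
  identity of \<open>J (red g)\<close>, which the unital group action supplies.\<close>

lemma global_partial_action_lifted:
  assumes fin: "finite (mor G)" and unital: "gamma_unital G x J \<gamma>"
    and sum: "finite_direct_sum A (objs G) B"
  shows "global_partial_action G A B \<beta> x \<tau>"
proof (intro global_partial_action.intro unital_partial_action.intro partial_action_lifted
    unital_partial_action_axioms.intro global_partial_action_axioms.intro
    transversal_groupoid_axioms global fin sum)
  fix g assume g: "g \<in> mor G"
  obtain u where "is_identity (J (red g)) u"
    using unital red_simps(4)[OF g] unfolding gamma_unital_def unital_partial_group_action_def isotropy_simps by blast
  moreover have "rng_iso (c (tgt G g)) (J (red g)) (B g)"
    using rng_iso_c[of "tgt G g" "J (red g)"] J_K_subset[of "red g"] g by (simp add: B_eq)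
  ultimately show "rng_unital (B g)"
    using rng_iso_identity unfolding rng_unital_def by blast
qed

end

theorem theorem7p5:
  fixes G :: "'g category" and x :: 'g and \<tau> :: "'g \<Rightarrow> 'g"
    and A :: "'a::ring set" and J :: "'g \<Rightarrow> 'a set" and \<gamma> :: "'g \<Rightarrow> 'a \<Rightarrow> 'a"
    and B :: "'g \<Rightarrow> 'a set" and \<beta> :: "'g \<Rightarrow> 'a \<Rightarrow> 'a"
    and H :: "'g category"
  assumes "connected_groupoid G" and "finite (mor G)"
    and "x \<in> objs G" and "transversal G x \<tau>"
    and "subrng A"
    and "lifting_datum G x \<tau> A J \<gamma>"
    and B_def: "B = lifted_ideal G \<tau> J \<gamma>" and beta_def: "\<beta> = lifted_map G \<tau> J \<gamma>"
    and "transversal_global G x \<tau> B"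
    and "gamma_unital G x J \<gamma>"
    and "finite_direct_sum A (objs G) J" and "finite_direct_sum A (objs G) B"
    and H_def: "H = isotropy G x"
    and "fg_projective (fixed_ring G A B \<beta>) (fixed_skew_bimodule G A B \<beta>)"
    and "fg_projective (fixed_ring H (B x) B \<beta>) (fixed_skew_bimodule H (B x) B \<beta>)"
  shows "strict_morita_context
           (fixed_ring G A B \<beta>) (skew_ring G B \<beta>)
           (fixed_skew_bimodule G A B \<beta>) (skew_fixed_bimodule G A B \<beta>)
           (Gamma_map G A B \<beta>) (Gamma_map' G B \<beta>)
     \<longleftrightarrow> strict_morita_context
           (fixed_ring H (B x) B \<beta>) (skew_ring H B \<beta>)
           (fixed_skew_bimodule H (B x) B \<beta>) (skew_fixed_bimodule H (B x) B \<beta>)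
           (Gamma_map H (B x) B \<beta>) (Gamma_map' H B \<beta>)"
proof -
  have "transversal_groupoid G x \<tau>"
    using assms(1,3,4)
    by (simp add: transversal_groupoid_def transversal_groupoid_axioms_def connected_groupoid_def)
  then interpret global_lifting G x \<tau> A J \<gamma>
    using assms by (simp add: global_lifting_def global_lifting_axioms_def)
  have "global_partial_action G A B \<beta> x \<tau>"
    using global_partial_action_lifted assms by simp
  then show ?thesis
    unfolding H_def by (rule global_partial_action.strict_iff_isotropy)
qed

end
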